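(* Let $\mathcal Q(a,u;x,y)\equiv\mathcal Q(x,y)\in\mathbb{N}[a,x,y][[u]]$ be the generating function of quarter plane walks, and write $\bar x=1/x$, $\bar y=1/y$. Then $\mathcal Q(x,y)$ is the unique formal power series in $u$ with coefficients in $\mathbb{Q}[a,x,y]$ satisfying $$\big(1-u(x+\bar x+y+\bar y)-u^2(a-1)(x\bar y+y\bar x)\big)\mathcal Q(x,y)=1-u\bar y\,(1+ux(a-1))\,\mathcal Q(x,0)-u\bar x\,(1+uy(a-1))\,\mathcal Q(0,y).$$ The generating function of quarter plane loops is $Q(a,u)=\mathcal Q(a,\sqrt u;0,0)$. The generating function $C(b,v)$ of standard connected arch systems is the unique power series $C(b,v)\in\mathbb{Q}[b][[v]]$ with $C(b,0)=0$ satisfying $$Q(a,u)=1+2\,C\!\left(1-\frac{1-a}{Q(a,u)},\; u\,Q(a,u)^2\right).$$ Finally, the generating function $S(t)=\sum_{n\ge0}s_nt^n$, where $s_n$ is the number of permutations of length $n$ that can be produced by two parallel stacks, is the unique formal power series in $t$ with constant term $1$ satisfying $$S(t)=1+C\!\left(1-\frac1{S(t)},\; t\,S(t)^2\right).$$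
   Context: Square lattice walks start at $(0,0)$ and use steps $\mathsf E=(1,0)$, $\mathsf N=(0,1)$, $\mathsf W=(-1,0)$, $\mathsf S=(0,-1)$. A walk is a quarter plane walk if it stays in $\{(x,y):x\ge0,y\ge0\}$, and a loop if it ends at $(0,0)$. A $\mathsf{NW}$ (resp. $\mathsf{ES}$) corner is a factor consisting of an $\mathsf N$ step immediately followed by a $\mathsf W$ step (resp. an $\mathsf E$ step immediately followed by an $\mathsf S$ step). $\mathcal Q(a,u;x,y)=\sum_w a^{c(w)}u^{|w|}x^{i}y^{j}$, summed over quarter plane walks $w$ with endpoint $(i,j)$, where $|w|$ is the length and $c(w)$ the number of $\mathsf{NW}$ plus $\mathsf{ES}$ corners. $Q(a,u)$ counts quarter plane loops with $u$ marking half-length and $a$ marking corners. Two parallel stacks: input items $1,\dots,n$ arrive in this order; an operation sequence is a word over $\{I_1,I_2,O_1,O_2\}$ ($I_i$: push the next input item onto stack $i$; $O_i$: pop the top of stack $i$ to the output) having as many $I_i$ as $O_i$ for $i=1,2$ and such that every prefix has at least as many $I_i$ as $O_i$. The produced permutation is the output order. Arch system of an operation sequence of length $2n$: points $1,\dots,2n$ on a line; for each item an arch joining its input time and output time, red (above the line) if it uses stack 1 and blue (below) if it uses stack 2. The $k$-th arch is the one with $k$-th smallest left endpoint. A left-right pair is a left endpoint of an arch immediately followed (at the next point) by a right endpoint of an arch of the other colour. Two arches of different colours cross if their endpoints interleave. The crossing graph has the arches as vertices and crossing pairs as edges; its connected components are the components of the arch system, which is connected if it is non-empty and this graph is connected.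 An arch system is standard if the first arch (smallest left endpoint) of every component is red. $C(b,v)=\sum b^{k}v^{n}$ over standard connected arch systems with $n$ arches and $k$ left-right pairs. *)

theory Defs
  imports
    "HOL-Computational_Algebra.Computational_Algebra"
    "HOL-Combinatorics.Multiset_Permutations"
begin

section \<open>Quarter plane walks\<close>

datatype dir = East | North | West | South

type_synonym walk = "dir list"

fun dir_vec :: "dir \<Rightarrow> int \<times> int" where
  "dir_vec East = (1, 0)"
| "dir_vec North = (0, 1)"
| "dir_vec West = (-1, 0)"
| "dir_vec South = (0, -1)"

definition endpoint :: "walk \<Rightarrow> int \<times> int" where
  "endpoint w = (sum_list (map (fst \<circ> dir_vec) w), sum_list (map (snd \<circ> dir_vec) w))"

definition quarter_walk :: "walk \<Rightarrow> bool" where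
  "quarter_walk w \<longleftrightarrow>
     (\<forall>k\<le>length w. fst (endpoint (take k w)) \<ge> 0 \<and> snd (endpoint (take k w)) \<ge> 0)"

definition quarter_loop :: "walk \<Rightarrow> bool" where
  "quarter_loop w \<longleftrightarrow> quarter_walk w \<and> endpoint w = (0, 0)"

definition corners :: "walk \<Rightarrow> nat" where
  "corners w = card {i. Suc i < length w \<and>
     (w ! i = North \<and> w ! Suc i = West \<or> w ! i = East \<and> w ! Suc i = South)}"

text \<open>The ring of polynomials in \<open>a\<close>, \<open>x\<close>, \<open>y\<close> over the rationals is represented by iterated
  univariate polynomials; \<open>a\<close> is the innermost and \<open>y\<close> the outermost variable.\<close>

type_synonym poly_axy = "rat poly poly poly"

definition var_a :: poly_axy where "var_a = [:[:[:0, 1:]:]:]"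
definition var_x :: poly_axy where "var_x = [:[:0, 1:]:]"
definition var_y :: poly_axy where "var_y = [:0, 1:]"

definition walk_gf :: "poly_axy fps" where
  "walk_gf = Abs_fps (\<lambda>n. \<Sum>w | quarter_walk w \<and> length w = n.
     var_a ^ corners w * var_x ^ nat (fst (endpoint w)) * var_y ^ nat (snd (endpoint w)))"

definition loop_gf :: "rat poly fps" where
  "loop_gf = Abs_fps (\<lambda>n. \<Sum>w | quarter_loop w \<and> length w = 2 * n. [:0, 1:] ^ corners w)"

definition at_x0 :: "poly_axy fps \<Rightarrow> poly_axy fps" where
  "at_x0 F = Abs_fps (\<lambda>n. map_poly (\<lambda>q. [:poly q 0:]) (fps_nth F n))"

definition at_y0 :: "poly_axy fps \<Rightarrow> poly_axy fps" where
  "at_y0 F = Abs_fps (\<lambda>n. [:poly (fps_nth F n) 0:])"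

definition at_x0_y0 :: "poly_axy fps \<Rightarrow> rat poly fps" where
  "at_x0_y0 F = Abs_fps (\<lambda>n. poly (poly (fps_nth F n) 0) 0)"

text \<open>As the functional equation involves \<open>1/x\<close> and \<open>1/y\<close>, it is read in the power series in
  \<open>u\<close> over the fraction field of the polynomial ring.\<close>

definition fps_to_fract :: "'r::idom fps \<Rightarrow> 'r fract fps" where
  "fps_to_fract F = Abs_fps (\<lambda>n. to_fract (fps_nth F n))"

definition walk_equation :: "poly_axy fps \<Rightarrow> bool" where
  "walk_equation F \<longleftrightarrow>
    (let u = fps_X;
         a = fps_const (to_fract var_a);
         x = fps_const (to_fract var_x); x' = inverse x;
         y = fps_const (to_fract var_y); y' = inverse y
     in (1 - u * (x + x' + y + y') - u^2 * (a - 1) * (x * y' + y * x')) * fps_to_fract F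
        = 1 - u * y' * (1 + u * x * (a - 1)) * fps_to_fract (at_y0 F)
            - u * x' * (1 + u * y * (a - 1)) * fps_to_fract (at_x0 F))"


section \<open>Two parallel stacks\<close>

text \<open>Stack 1 is \<open>Red\<close> and stack 2 is \<open>Blue\<close>; \<open>Push\<close> is the letter \<open>I\<close> and \<open>Pop\<close> the
  letter \<open>O\<close>.\<close>

datatype colour = Red | Blue
datatype operation = Push colour | Pop colour

definition op_sequence :: "operation list \<Rightarrow> bool" where
  "op_sequence w \<longleftrightarrow> (\<forall>c.
     count_list w (Push c) = count_list w (Pop c) \<and>
     (\<forall>k\<le>length w. count_list (take k w) (Push c) \<ge> count_list (take k w) (Pop c)))"

text \<open>A state consists of the next input item, the contents of the stacks (top first), and the
  output so far.\<close>

type_synonym state = "nat \<times> (colour \<Rightarrow> nat list) \<times> nat list"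

fun exec_op :: "operation \<Rightarrow> state \<Rightarrow> state" where
  "exec_op (Push c) (k, st, out) = (Suc k, st(c := k # st c), out)"
| "exec_op (Pop c) (k, st, out) = (k, st(c := tl (st c)), out @ [hd (st c)])"

definition exec :: "operation list \<Rightarrow> state" where
  "exec w = fold exec_op w (1, (\<lambda>_. []), [])"

definition produced :: "operation list \<Rightarrow> nat list" where
  "produced w = snd (snd (exec w))"

definition stack_perms :: "nat \<Rightarrow> nat list set" where
  "stack_perms n = {p \<in> permutations_of_set {1..n}. \<exists>w. op_sequence w \<and> produced w = p}"

definition stack_gf :: "rat fps" where
  "stack_gf = Abs_fps (\<lambda>n. of_nat (card (stack_perms n)))"

text \<open>The item moved by the operation at (0-based) position \<open>i\<close>.\<close>

definition moved_item :: "operation list \<Rightarrow> nat \<Rightarrow> nat" where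
  "moved_item w i = (case exec (take i w) of (k, st, out) \<Rightarrow>
     (case w ! i of Push c \<Rightarrow> k | Pop c \<Rightarrow> hd (st c)))"


section \<open>Arch systems\<close>

text \<open>An arch is given by its colour, its left endpoint and its right endpoint.\<close>

type_synonym arch = "colour \<times> nat \<times> nat"

definition arch_colour :: "arch \<Rightarrow> colour" where "arch_colour \<alpha> = fst \<alpha>"
definition left_end :: "arch \<Rightarrow> nat" where "left_end \<alpha> = fst (snd \<alpha>)"
definition right_end :: "arch \<Rightarrow> nat" where "right_end \<alpha> = snd (snd \<alpha>)"

text \<open>Points on the line are numbered from 1, whereas list positions start at 0.\<close>

definition arch_system_of :: "operation list \<Rightarrow> arch set" where
  "arch_system_of w = {(c, Suc i, Suc j) | c i j. i < length w \<and> j < length w \<and>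
     w ! i = Push c \<and> w ! j = Pop c \<and> moved_item w i = moved_item w j}"

definition arch_systems :: "arch set set" where
  "arch_systems = arch_system_of ` {w. op_sequence w}"

definition left_right_pairs :: "arch set \<Rightarrow> nat" where
  "left_right_pairs A = card {p. \<exists>\<alpha>\<in>A. \<exists>\<beta>\<in>A.
     left_end \<alpha> = p \<and> right_end \<beta> = Suc p \<and> arch_colour \<alpha> \<noteq> arch_colour \<beta>}"

definition arches_cross :: "arch \<Rightarrow> arch \<Rightarrow> bool" where
  "arches_cross \<alpha> \<beta> \<longleftrightarrow> arch_colour \<alpha> \<noteq> arch_colour \<beta> \<and>
     (left_end \<alpha> < left_end \<beta> \<and> left_end \<beta> < right_end \<alpha> \<and> right_end \<alpha> < right_end \<beta> \<or>
      left_end \<beta> < left_end \<alpha> \<and> left_end \<alpha> < right_end \<beta> \<and> right_end \<beta> < right_end \<alpha>)"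

definition crossing_graph :: "arch set \<Rightarrow> (arch \<times> arch) set" where
  "crossing_graph A = {(\<alpha>, \<beta>). \<alpha> \<in> A \<and> \<beta> \<in> A \<and> arches_cross \<alpha> \<beta>}"

definition components :: "arch set \<Rightarrow> arch set set" where
  "components A = A // ((crossing_graph A)\<^sup>* \<inter> A \<times> A)"

definition connected_arches :: "arch set \<Rightarrow> bool" where
  "connected_arches A \<longleftrightarrow> A \<noteq> {} \<and> (\<forall>\<alpha>\<in>A. \<forall>\<beta>\<in>A. (\<alpha>, \<beta>) \<in> (crossing_graph A)\<^sup>*)"

definition standard_arches :: "arch set \<Rightarrow> bool" where
  "standard_arches A \<longleftrightarrow> (\<forall>K\<in>components A. arch_colour (arg_min_on left_end K) = Red)"

definition arch_gf :: "rat poly fps" where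
  "arch_gf = Abs_fps (\<lambda>n.
     \<Sum>A | A \<in> arch_systems \<and> standard_arches A \<and> connected_arches A \<and> card A = n.
       [:0, 1:] ^ left_right_pairs A)"


section \<open>Substitution\<close>

text \<open>For \<open>F(b,v)\<close> a power series in \<open>v\<close> with polynomial coefficients in \<open>b\<close>, this is
  \<open>F(B,V)\<close>, provided \<open>V\<close> has zero constant term (the sum is truncated for the same reason as
  in \<^const>\<open>fps_compose\<close>). The function \<open>h\<close> embeds the rationals in the coefficient ring of
  \<open>B\<close> and \<open>V\<close>.\<close>

definition fps_subst :: "(rat \<Rightarrow> 'r) \<Rightarrow> rat poly fps \<Rightarrow> 'r::comm_ring_1 fps \<Rightarrow> 'r fps \<Rightarrow> 'r fps" where
  "fps_subst h F B V = Abs_fps (\<lambda>n. \<Sum>i=0..n.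
     fps_nth (poly (map_poly (\<lambda>r. fps_const (h r)) (fps_nth F i)) B * V ^ i) n)"

text \<open>The equation relating \<open>C\<close> and the loop series \<open>Q\<close>. Here \<open>Q\<close> has constant term 1 and its
  coefficients lie in a polynomial ring, which is not a field; hence its multiplicative inverse
  \<open>1/Q\<close> is \<^term>\<open>fps_right_inverse Q 1\<close>.\<close>

definition arch_equation :: "rat poly fps \<Rightarrow> rat poly fps \<Rightarrow> bool" where
  "arch_equation Q C \<longleftrightarrow>
    (let a = fps_const [:0, 1:]; u = fps_X
     in Q = 1 + 2 * fps_subst (\<lambda>r. [:r:]) C (1 - (1 - a) * fps_right_inverse Q 1) (u * Q^2))"

definition stack_equation :: "rat poly fps \<Rightarrow> rat fps \<Rightarrow> bool" where
  "stack_equation C S \<longleftrightarrow>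
    (let t = fps_X in S = 1 + fps_subst (\<lambda>r. r) C (1 - 1 / S) (t * S^2))"

end

theory Submission
  imports Defs
begin

text \<open>
  Reading the steps E, N, W, S as push and pop operations turns quarter plane loops into operation
  sequences and corners into left-right pairs. In the arch system of a non-empty operation sequence,
  the component of the first arch is again a connected arch system with some number \<open>n\<close> of arches; the
  remaining letters fill the \<open>2n\<close> gaps after its points, and no arch leaves its gap. Hence each gap holds
  an arbitrary operation sequence (a factor \<open>Q\<close>), except that a left-right pair of the component
  survives only if its gap is empty, so that such a gap contributes \<open>Q - 1 + a = Q (1 - (1 - a) / Q)\<close>.
  The colour of the first arch accounts for the factor 2.

  Every permutation produced by two parallel stacks comes from exactly one standard operation sequence
  without left-right pairs: a push followed by a pop on the other stack may be exchanged, and the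
  colours may be swapped within a component. Conversely, without left-right pairs a pop following a
  push outputs the item just pushed, so the output fixes the uncoloured arches, and then every
  component has a unique colouring with a red first arch. The same decomposition, with \<open>a = 0\<close> and
  standard sequences only, gives the equation for \<open>S\<close>.
\<close>

section \<open>Arch systems as noncrossing matchings\<close>

text \<open>The definitions run the stacks, whereas the arguments move, recolour or cut arches. The
  notion \<open>matching\<close> removes this obstacle: a set of arches that join pushes to later
  pops of the same colour, no two arches of one colour being interleaved. A word has at most one
  matching, and has one iff it is an operation sequence, so exhibiting a matching computes the arch
  system of a new word. The component of the first arch contains the first point, so no letter
  precedes it, there are exactly as many gaps as points, and the cut can be read off from the word.
  Both substitution equations come from one computation with the inverse of the series as a
  parameter, but their solutions are unique for different reasons: the equation for C is triangular,
  because 1 - (1 - a) / Q has constant term a and u Q^2 begins with u; the equation for S determines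
  each coefficient from the earlier ones, because C(b, 0) = 0 and t S^2 carries a factor t. For
  walks the last step is removed; the terms with a - 1 correct for steps that complete a corner, and
  multiplication by x y brings everything back to polynomial coefficients.\<close>

fun is_push :: "operation \<Rightarrow> bool" where
  "is_push (Push c) = True"
| "is_push (Pop c) = False"

text \<open>Describes the arch system of \<open>w\<close>, with points numbered from 0, by order
  conditions alone: partners exist and are unique, and arches of one colour are nested or
  disjoint.\<close>

definition matching :: "operation list \<Rightarrow> arch set \<Rightarrow> bool" where
  "matching w A \<longleftrightarrow>
     (\<forall>c i j. (c, i, j) \<in> A \<longrightarrow> i < j \<and> j < length w \<and> w ! i = Push c \<and> w ! j = Pop c) \<and>
     (\<forall>i c. i < length w \<longrightarrow> w ! i = Push c \<longrightarrow> (\<exists>!j. (c, i, j) \<in> A)) \<and>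
     (\<forall>j c. j < length w \<longrightarrow> w ! j = Pop c \<longrightarrow> (\<exists>!i. (c, i, j) \<in> A)) \<and>
     (\<forall>c i j i' j'. (c, i, j) \<in> A \<longrightarrow> (c, i', j') \<in> A \<longrightarrow> \<not> (i < i' \<and> i' < j \<and> j < j'))"

lemma matchingI:
  assumes "\<And>c i j. (c, i, j) \<in> A \<Longrightarrow> i < j \<and> j < length w \<and> w ! i = Push c \<and> w ! j = Pop c"
    and "\<And>i c. i < length w \<Longrightarrow> w ! i = Push c \<Longrightarrow> \<exists>j. (c, i, j) \<in> A"
    and "\<And>j c. j < length w \<Longrightarrow> w ! j = Pop c \<Longrightarrow> \<exists>i. (c, i, j) \<in> A"
    and "\<And>c i j j'. (c, i, j) \<in> A \<Longrightarrow> (c, i, j') \<in> A \<Longrightarrow> j = j'"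
    and "\<And>c i i' j. (c, i, j) \<in> A \<Longrightarrow> (c, i', j) \<in> A \<Longrightarrow> i = i'"
    and "\<And>c i j i' j'. (c, i, j) \<in> A \<Longrightarrow> (c, i', j') \<in> A \<Longrightarrow> i < i' \<Longrightarrow> i' < j \<Longrightarrow> j < j' \<Longrightarrow> False"
  shows "matching w A"
  unfolding matching_def
proof (intro conjI allI impI)
  fix i c assume "i < length w" "w ! i = Push c"
  then show "\<exists>!j. (c, i, j) \<in> A" using assms(2,4) by blast
next
  fix j c assume "j < length w" "w ! j = Pop c"
  then show "\<exists>!i. (c, i, j) \<in> A" using assms(3,5) by blast
next
  fix c i j assume "(c, i, j) \<in> A"
  then show "i < j" "j < length w" "w ! i = Push c" "w ! j = Pop c" using assms(1) by simp_all
next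
  fix c i j i' j' assume "(c, i, j) \<in> A" "(c, i', j') \<in> A"
  then show "\<not> (i < i' \<and> i' < j \<and> j < j')" using assms(6) by metis
qed

lemma matchingD:
  assumes "matching w A"
  shows "\<forall>c i j. (c, i, j) \<in> A \<longrightarrow> i < j \<and> j < length w \<and> w ! i = Push c \<and> w ! j = Pop c"
    and "\<forall>i c. i < length w \<longrightarrow> w ! i = Push c \<longrightarrow> (\<exists>!j. (c, i, j) \<in> A)"
    and "\<forall>j c. j < length w \<longrightarrow> w ! j = Pop c \<longrightarrow> (\<exists>!i. (c, i, j) \<in> A)"
    and "\<forall>c i j i' j'. (c, i, j) \<in> A \<longrightarrow> (c, i', j') \<in> A \<longrightarrow> \<not> (i < i' \<and> i' < j \<and> j < j')"
  using assms unfolding matching_def by - ((elim conjE, assumption)+)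

lemma matching_arch:
  assumes "matching w A" "(c, i, j) \<in> A"
  shows "i < j" "j < length w" "i < length w" "w ! i = Push c" "w ! j = Pop c"
proof -
  have "i < j \<and> j < length w \<and> w ! i = Push c \<and> w ! j = Pop c"
    using matchingD(1)[OF assms(1)] assms(2) by blast
  then show "i < j" "j < length w" "i < length w" "w ! i = Push c" "w ! j = Pop c" by auto
qed

lemma matching_push: "matching w A \<Longrightarrow> i < length w \<Longrightarrow> w ! i = Push c \<Longrightarrow> \<exists>j. (c, i, j) \<in> A"
  using matchingD(2) by (metis ex1_implies_ex)

lemma matching_pop: "matching w A \<Longrightarrow> j < length w \<Longrightarrow> w ! j = Pop c \<Longrightarrow> \<exists>i. (c, i, j) \<in> A"
  using matchingD(3) by (metis ex1_implies_ex)

lemma matching_left_unique: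
  assumes "matching w A" "(c, i, j) \<in> A" "(c', i, j') \<in> A"
  shows "c = c'" "j = j'"
proof -
  show "c = c'"
    using matching_arch(4)[OF assms(1,2)] matching_arch(4)[OF assms(1,3)] by simp
  then show "j = j'"
    using assms(2,3) matching_arch(3,4)[OF assms(1,2)] matchingD(2)[OF assms(1)] by (metis (no_types))
qed

lemma matching_right_unique:
  assumes "matching w A" "(c, i, j) \<in> A" "(c', i', j) \<in> A"
  shows "c = c'" "i = i'"
proof -
  show "c = c'"
    using matching_arch(5)[OF assms(1,2)] matching_arch(5)[OF assms(1,3)] by simp
  then show "i = i'"
    using assms(2,3) matching_arch(2,5)[OF assms(1,2)] matchingD(3)[OF assms(1)] by (metis (no_types))
qed

lemma matching_left_right:
  assumes "matching w A" "(c, i, j) \<in> A" "(c', i', j') \<in> A"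
  shows "i \<noteq> j'"
  using matching_arch(4)[OF assms(1,2)] matching_arch(5)[OF assms(1,3)] by auto

lemma matching_noncrossing:
  assumes "matching w A" "(c, i, j) \<in> A" "(c, i', j') \<in> A" "i < i'" "i' < j"
  shows "j' < j"
proof -
  have "j' \<noteq> j" using matching_right_unique[OF assms(1,2)] assms by blast
  moreover have "\<not> j < j'" using assms matchingD(4)[OF assms(1)] by metis
  ultimately show ?thesis by linarith
qed

lemma matching_cover:
  assumes "matching w A" "p < length w"
  obtains c i j where "(c, i, j) \<in> A" "p = i \<or> p = j"
proof (cases "w ! p")
  case (Push c)
  then show thesis using matching_push[OF assms] that by blast
next
  case (Pop c)
  then show thesis using matching_pop[OF assms] that by blast
qed

lemma finite_matching:
  assumes "matching w A"
  shows "finite A"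
proof (rule finite_subset)
  show "A \<subseteq> {Red, Blue} \<times> {..<length w} \<times> {..<length w}"
    by (auto dest: matching_arch[OF assms]) (metis colour.exhaust)
qed simp

text \<open>Induction on the right endpoint in \<open>A\<close>. If \<open>B\<close> pairs the
  endpoints differently, then by noncrossing some arch of \<open>A\<close> with a smaller right
  endpoint meets an arch of \<open>B\<close> in a point, and the induction hypothesis, which puts it
  into \<open>B\<close>, contradicts the uniqueness of partners.\<close>

lemma matching_subset:
  assumes A: "matching w A" and B: "matching w B"
  shows "A \<subseteq> B"
proof -
  have "(c, i, j) \<in> B" if "(c, i, j) \<in> A" for c i j
    using that
  proof (induction j arbitrary: c i rule: less_induct)
    case (less j)
    note ar = matching_arch[OF A less.prems]
    obtain i' where i': "(c, i', j) \<in> B" using matching_pop[OF B ar(2,5)] by blast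
    obtain j' where j': "(c, i, j') \<in> B" using matching_push[OF B ar(3,4)] by blast
    consider "i = i'" | "i < i'" | "i' < i" by linarith
    then show ?case
    proof cases
      case 1
      then show ?thesis using i' by simp
    next
      case 2
      obtain k where k: "(c, i', k) \<in> A"
        using matching_push[OF A] matching_arch[OF B i'] by blast
      have "k < j" using matching_noncrossing[OF A less.prems k] 2 matching_arch[OF B i'] by blast
      then have "(c, i', k) \<in> B" using less.IH k by blast
      then show ?thesis using matching_left_unique[OF B i'] \<open>k < j\<close> by blast
    next
      case 3
      have "j' < j" using matching_noncrossing[OF B i' j' 3] ar by blast
      have "i < j'" using matching_arch[OF B j'] by blast
      obtain k where k: "(c, k, j') \<in> A"
        using matching_pop[OF A] matching_arch[OF B j'] by blast
      have "(c, k, j') \<in> B" using less.IH[OF \<open>j' < j\<close> k] .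
      then have "k = i" using matching_right_unique[OF B j'] by blast
      then show ?thesis using matching_left_unique[OF A less.prems] k \<open>j' < j\<close> by blast
    qed
  qed
  then show ?thesis by auto
qed

lemma matching_unique: "matching w A \<Longrightarrow> matching w B \<Longrightarrow> A = B"
  using matching_subset by (simp add: subset_antisym)

lemma count_list_take_card: "count_list (take k w) x = card {i. i < k \<and> i < length w \<and> w ! i = x}"
proof -
  have "count_list (take k w) x = card {i. i < length (take k w) \<and> x = take k w ! i}"
    by (simp add: count_list_eq_length_filter length_filter_conv_card)
  also have "{i. i < length (take k w) \<and> x = take k w ! i} = {i. i < k \<and> i < length w \<and> w ! i = x}"
    by auto
  finally show ?thesis .
qed

text \<open>Sending each pop to its partner is injective and moves to the left, so no prefix has
  more pops than pushes of a colour; sending each push to its partner gives the reverse inequality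
  for the whole word.\<close>

lemma matching_imp_op_sequence:
  assumes A: "matching w A"
  shows "op_sequence w"
  unfolding op_sequence_def
proof (intro allI conjI impI)
  fix c
  define L R where "L k = {i. i < k \<and> i < length w \<and> w ! i = Push c}"
    and "R k = {i. i < k \<and> i < length w \<and> w ! i = Pop c}" for k
  have fin: "finite (L k)" "finite (R k)" for k
    by (auto simp: L_def R_def)
  define m where "m j = (SOME i. (c, i, j) \<in> A)" for j
  have m: "(c, m j, j) \<in> A" if "j \<in> R k" for j k
    unfolding m_def using someI_ex[OF matching_pop[OF A, of j c]] that by (simp add: R_def)
  have "inj_on m (R k)" for k
    proof (rule inj_onI)
    fix x y assume "x \<in> R k" "y \<in> R k" "m x = m y"
    then have "(c, m x, x) \<in> A" "(c, m x, y) \<in> A" using m[of x k] m[of y k] by simp_all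
    then show "x = y" by (rule matching_left_unique(2)[OF A])
  qed
  moreover have "m ` R k \<subseteq> L k" for k
  proof
    fix i assume "i \<in> m ` R k"
    then obtain j where "j \<in> R k" "i = m j" by blast
    then have "(c, i, j) \<in> A" using m by blast
    from matching_arch[OF A this] show "i \<in> L k" using \<open>j \<in> R k\<close> by (auto simp: R_def L_def)
  qed
  ultimately have le: "card (R k) \<le> card (L k)" for k
    by (intro card_inj_on_le[of m] fin)
  then show "count_list (take k w) (Pop c) \<le> count_list (take k w) (Push c)" for k
    by (simp add: count_list_take_card L_def R_def)
  define m' where "m' i = (SOME j. (c, i, j) \<in> A)" for i
  have m': "(c, i, m' i) \<in> A" if "i \<in> L k" for i k
    unfolding m'_def using someI_ex[OF matching_push[OF A, of i c]] that by (simp add: L_def)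
  have "inj_on m' (L (length w))"
    proof (rule inj_onI)
    fix x y assume "x \<in> L (length w)" "y \<in> L (length w)" "m' x = m' y"
    then have "(c, x, m' x) \<in> A" "(c, y, m' x) \<in> A"
      using m'[of x "length w"] m'[of y "length w"] by simp_all
    then show "x = y" by (rule matching_right_unique(2)[OF A])
  qed
  moreover have "m' ` L (length w) \<subseteq> R (length w)"
  proof
    fix j assume "j \<in> m' ` L (length w)"
    then obtain i where "i \<in> L (length w)" "j = m' i" by blast
    then have "(c, i, j) \<in> A" using m' by blast
    from matching_arch[OF A this] show "j \<in> R (length w)" by (simp add: R_def)
  qed
  ultimately have "card (L (length w)) \<le> card (R (length w))"
    by (rule card_inj_on_le) (rule fin)
  with le[of "length w"] show "count_list w (Push c) = count_list w (Pop c)"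
    using count_list_take_card[of "length w" w] by (simp add: L_def R_def)
qed

section \<open>The arches of an operation sequence, from the execution of the stacks\<close>

definition arcs :: "operation list \<Rightarrow> arch set" where
  "arcs w = {(c, i, j). i < length w \<and> j < length w \<and> w ! i = Push c \<and> w ! j = Pop c \<and>
     moved_item w i = moved_item w j}"

fun amap :: "(nat \<Rightarrow> nat) \<Rightarrow> arch \<Rightarrow> arch" where
  "amap f (c, i, j) = (c, f i, f j)"

lemma arch_system_of_arcs: "arch_system_of w = amap Suc ` arcs w"
  unfolding arch_system_of_def arcs_def by (auto simp: image_iff)

text \<open>The half of \<open>op_sequence\<close> that passes to prefixes, so that facts about the
  stacks can be proved by induction on the last letter.\<close>

definition prefix_ok :: "operation list \<Rightarrow> bool" where
  "prefix_ok w \<longleftrightarrow>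
     (\<forall>c. \<forall>k\<le>length w. count_list (take k w) (Pop c) \<le> count_list (take k w) (Push c))"

abbreviation stk :: "operation list \<Rightarrow> colour \<Rightarrow> nat list" where
  "stk w \<equiv> fst (snd (exec w))"

lemma exec_Nil [simp]: "exec [] = (1, (\<lambda>_. []), [])"
  by (simp add: exec_def)

lemma exec_snoc [simp]: "exec (w @ [x]) = exec_op x (exec w)"
  by (simp add: exec_def)

lemma fst_exec: "fst (exec w) = Suc (length (filter is_push w))"
proof (induction w rule: rev_induct)
  case (snoc x w)
  then show ?case by (cases x; cases "exec w") auto
qed simp

lemma moved_item_snoc [simp]:
  "i < length w \<Longrightarrow> moved_item (w @ [x]) i = moved_item w i"
  "moved_item (w @ [Push c]) (length w) = fst (exec w)"
  "moved_item (w @ [Pop c]) (length w) = hd (stk w c)"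
  by (simp_all add: moved_item_def nth_append split: prod.splits)

lemma moved_item_take: "i < k \<Longrightarrow> i < length w \<Longrightarrow> moved_item (take k w) i = moved_item w i"
  by (simp add: moved_item_def)

lemma moved_item_push:
  "w ! i = Push c \<Longrightarrow> moved_item w i = Suc (length (filter is_push (take i w)))"
  using fst_exec[of "take i w"] by (cases "exec (take i w)") (simp add: moved_item_def)

lemma prefix_ok_snoc:
  assumes "prefix_ok (w @ [x])"
  shows "prefix_ok w"
  unfolding prefix_ok_def
proof (intro allI impI)
  fix c k assume "k \<le> length w"
  then show "count_list (take k w) (Pop c) \<le> count_list (take k w) (Push c)"
    using assms[unfolded prefix_ok_def, rule_format, of k c] by simp
qed

lemma prefix_ok_take:
  assumes "prefix_ok w"
  shows "prefix_ok (take k w)"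
  unfolding prefix_ok_def
proof (intro allI impI)
  fix c m assume "m \<le> length (take k w)"
  then show "count_list (take m (take k w)) (Pop c) \<le> count_list (take m (take k w)) (Push c)"
    using assms[unfolded prefix_ok_def, rule_format, of m c] by (simp add: min.absorb1)
qed

lemma op_sequence_prefix_ok: "op_sequence w \<Longrightarrow> prefix_ok w"
  by (simp add: op_sequence_def prefix_ok_def)

lemma length_stk:
  "prefix_ok w \<Longrightarrow> length (stk w c) + count_list w (Pop c) = count_list w (Push c)"
proof (induction w arbitrary: c rule: rev_induct)
  case (snoc x w)
  note IH = snoc.IH[OF prefix_ok_snoc[OF snoc.prems]]
  show ?case
  proof (cases x)
    case (Push d)
    then show ?thesis using IH[of c] by (cases "exec w") auto
  next
    case (Pop d)
    \<comment> \<open>A pop on an empty stack would leave the stack as it is, since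
      \<open>tl [] = []\<close>, and break the count; the prefix condition rules this out.\<close>
    have "count_list (w @ [x]) (Pop d) \<le> count_list (w @ [x]) (Push d)"
      using snoc.prems[unfolded prefix_ok_def, rule_format, of "length (w @ [x])" d] by simp
    then have "stk w d \<noteq> []" using IH[of d] Pop by auto
    then show ?thesis using IH[of c] Pop by (cases "exec w"; cases "stk w d") auto
  qed
qed simp

lemma stk_nonempty:
  assumes "prefix_ok w" "j < length w" "w ! j = Pop c"
  shows "stk (take j w) c \<noteq> []"
proof -
  have "count_list (take (Suc j) w) (Pop c) \<le> count_list (take (Suc j) w) (Push c)"
    using assms(1)[unfolded prefix_ok_def, rule_format, of "Suc j" c] assms(2) by simp
  then have "count_list (take j w) (Pop c) < count_list (take j w) (Push c)"
    using assms(2,3) by (simp add: take_Suc_conv_app_nth)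
  then show ?thesis using length_stk[OF prefix_ok_take[OF assms(1)], of j c] by auto
qed

lemma moved_item_push_mono:
  assumes "i < j" "j < length w" "is_push (w ! i)" "is_push (w ! j)"
  shows "moved_item w i < moved_item w j"
proof -
  obtain c d where cd: "w ! i = Push c" "w ! j = Push d"
    using assms(3,4) by (metis is_push.elims(2))
  have "take j w = take (Suc i) w @ drop (Suc i) (take j w)"
    using assms(1) append_take_drop_id[of "Suc i" "take j w"] by (simp add: min.absorb1)
  then have "take j w = take i w @ [w ! i] @ drop (Suc i) (take j w)"
    using assms(1,2) by (simp add: take_Suc_conv_app_nth)
  then obtain v where "take j w = take i w @ [w ! i] @ v" by blast
  then have "filter is_push (take j w) = filter is_push (take i w) @ [w ! i] @ filter is_push v"
    using assms(3) by simp
  then show ?thesis using cd by (simp add: moved_item_push)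
qed

lemma moved_item_push_inj:
  assumes "i < length w" "j < length w" "is_push (w ! i)" "is_push (w ! j)"
    and "moved_item w i = moved_item w j"
  shows "i = j"
  using assms moved_item_push_mono[of i j w] moved_item_push_mono[of j i w]
  by (cases i j rule: linorder_cases) auto

text \<open>The contents of a stack described by the history of moves alone. The pop in the second
  clause may have either colour; that an item leaves only the stack on which it was pushed is part
  of the invariant below.\<close>

definition on_stack :: "operation list \<Rightarrow> colour \<Rightarrow> nat \<Rightarrow> bool" where
  "on_stack w c x \<longleftrightarrow> (\<exists>i<length w. w ! i = Push c \<and> moved_item w i = x) \<and>
     \<not> (\<exists>j<length w. \<not> is_push (w ! j) \<and> moved_item w j = x)"

lemma ex_less_Suc_length_snoc:
  "(\<exists>i<length (w @ [x]). P i) \<longleftrightarrow> (\<exists>i<length w. P i) \<or> P (length w)"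
  by (auto simp: less_Suc_eq)

text \<open>The three claims support each other. A pushed item exceeds all earlier ones, which keeps
  the stacks decreasing from the top; hence the popped item is the largest on its stack, and
  last-in-first-out becomes a comparison of numbers.\<close>

lemma stack_invariant:
  assumes "prefix_ok w"
  shows "(\<forall>i<length w. moved_item w i < fst (exec w)) \<and>
    (\<forall>c x. x \<in> set (stk w c) \<longleftrightarrow> on_stack w c x) \<and> (\<forall>c. sorted_wrt (>) (stk w c))"
  using assms
proof (induction w rule: rev_induct)
  case Nil
  then show ?case by (simp add: on_stack_def)
next
  case (snoc x w)
  note ok = prefix_ok_snoc[OF snoc.prems]
  note IH = snoc.IH[OF ok]
  obtain k st out where ex: "exec w = (k, st, out)" by (metis prod_cases3)
  have lt: "moved_item w i < k" if "i < length w" for i using IH that ex by auto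
  have mem: "y \<in> set (st c) \<longleftrightarrow> on_stack w c y" for y c using IH ex by auto
  have srt: "sorted_wrt (>) (st c)" for c using IH ex by auto
  show ?case
  proof (cases x)
    case (Push d)
    have os: "on_stack (w @ [x]) c y \<longleftrightarrow> (c = d \<and> y = k) \<or> on_stack w c y" for c y
    proof -
      have "\<exists>j<length w. \<not> is_push (w ! j) \<and> moved_item w j = k \<Longrightarrow> False"
        using lt by auto
      then show ?thesis
        unfolding on_stack_def ex_less_Suc_length_snoc
        using Push ex lt by (auto simp: nth_append) 
    qed
    have "\<forall>y\<in>set (st d). y < k" using mem lt unfolding on_stack_def by auto
    then show ?thesis
      using ex Push lt mem srt os by (auto simp: less_Suc_eq nth_append)
  next
    case (Pop d)
    have ne: "st d \<noteq> []"
      using stk_nonempty[OF snoc.prems, of "length w" d] Pop ex by simp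
    then obtain h t where ht: "st d = h # t" by (cases "st d") auto
    have sh: "on_stack w d h" using mem[of h d] ht by simp
    have hd: "moved_item (w @ [x]) (length w) = h" using Pop ex ht by simp
    have lth: "h < k" using sh lt unfolding on_stack_def by auto
    have hn: "h \<notin> set t" using srt[of d] ht by auto
    have os: "on_stack (w @ [x]) c y \<longleftrightarrow> on_stack w c y \<and> y \<noteq> h" for c y
      unfolding on_stack_def ex_less_Suc_length_snoc
      using Pop hd by (auto simp: nth_append)
    \<comment> \<open>Popping \<open>h\<close> from stack \<open>d\<close> ends its presence on
      every stack in the sense of \<open>on_stack\<close>, so it must be absent from the other
      stack: each item has a single push.\<close>
    have "h \<notin> set (st c)" if "c \<noteq> d" for c
    proof
      assume "h \<in> set (st c)"
      then have "on_stack w c h" using mem by simp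
      then obtain i j where ij: "i < length w" "j < length w" "w ! i = Push c" "w ! j = Push d"
        "moved_item w i = h" "moved_item w j = h"
        using sh unfolding on_stack_def by blast
      then have "i = j" using moved_item_push_inj[of i w j] by simp
      then show False using ij that by simp
    qed
    then show ?thesis
      using ex Pop lt mem srt[of d] srt os lth ht hn hd
      by (auto simp: less_Suc_eq nth_append)
        (metis list.set_intros(2) set_ConsD mem)+
  qed
qed

lemma popped_on_stack:
  assumes "prefix_ok w" "j < length w" "w ! j = Pop c"
  shows "on_stack (take j w) c (moved_item w j)"
    and "\<And>x. on_stack (take j w) c x \<Longrightarrow> x \<le> moved_item w j"
proof -
  note inv = stack_invariant[OF prefix_ok_take[OF assms(1)], of j]
  have mi: "moved_item w j = hd (stk (take j w) c)"
    using assms by (simp add: moved_item_def split: prod.splits)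
  obtain h t where ht: "stk (take j w) c = h # t"
    using stk_nonempty[OF assms] by (cases "stk (take j w) c") auto
  show "on_stack (take j w) c (moved_item w j)"
    using inv ht mi by (metis list.sel(1) list.set_intros(1))
  fix x assume "on_stack (take j w) c x"
  then have "x \<in> set (h # t)" using inv ht by metis
  moreover have "sorted_wrt (>) (h # t)" using inv ht by metis
  ultimately show "x \<le> moved_item w j" using mi ht by auto
qed

lemma pop_pushed_before:
  assumes "prefix_ok w" "j < length w" "w ! j = Pop c"
  shows "\<exists>i<j. w ! i = Push c \<and> moved_item w i = moved_item w j"
  using popped_on_stack(1)[OF assms] assms(2) unfolding on_stack_def
  by (auto simp: moved_item_take)

lemma moved_item_pop_inj:
  assumes "prefix_ok w" "i < length w" "j < length w" "\<not> is_push (w ! i)" "\<not> is_push (w ! j)"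
    and "moved_item w i = moved_item w j"
  shows "i = j"
proof -
  have False if "i < j" "j < length w" "\<not> is_push (w ! i)" and pj: "\<not> is_push (w ! j)"
    and "moved_item w i = moved_item w j" for i j
  proof -
    obtain c where "w ! j = Pop c" using pj by (metis is_push.elims(3))
    then have "on_stack (take j w) c (moved_item w j)" using popped_on_stack(1) assms(1) that by blast
    then show False using that unfolding on_stack_def by (auto simp: moved_item_take)
  qed
  then show ?thesis using assms by (metis linorder_neqE_nat)
qed

lemma op_sequence_matching:
  assumes w: "op_sequence w"
  shows "matching w (arcs w)"
proof (rule matchingI)
  note ok = op_sequence_prefix_ok[OF w]
  {
    fix c i j assume "(c, i, j) \<in> arcs w"
    then have *: "i < length w" "j < length w" "w ! i = Push c" "w ! j = Pop c"
      "moved_item w i = moved_item w j" by (auto simp: arcs_def)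
    obtain i' where "i' < j" "w ! i' = Push c" "moved_item w i' = moved_item w j"
      using pop_pushed_before[OF ok *(2,4)] by blast
    then show "i < j \<and> j < length w \<and> w ! i = Push c \<and> w ! j = Pop c"
      using moved_item_push_inj[of i w i'] * by simp
  }
  note arc = this
  {
    fix i c assume i: "i < length w" "w ! i = Push c"
    have "length (stk w c) = 0" using length_stk[OF ok, of c] w by (simp add: op_sequence_def)
    then have "\<not> on_stack w c (moved_item w i)" using stack_invariant[OF ok] by force
    then obtain j where j: "j < length w" "\<not> is_push (w ! j)" "moved_item w i = moved_item w j"
      using i unfolding on_stack_def by metis
    then obtain d where d: "w ! j = Pop d" using j(2) by (cases "w ! j") auto
    obtain i' where i': "i' < j" "w ! i' = Push d" "moved_item w i' = moved_item w j"
      using pop_pushed_before[OF ok j(1) d] by blast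
    then have "i' = i" using moved_item_push_inj[of i' w i] i j by simp
    then have "d = c" using i i' by simp
    then show "\<exists>j. (c, i, j) \<in> arcs w" using i j d by (auto simp: arcs_def)
  }
  {
    fix j c assume j: "j < length w" "w ! j = Pop c"
    then show "\<exists>i. (c, i, j) \<in> arcs w"
      using pop_pushed_before[OF ok j] unfolding arcs_def by (metis (mono_tags, lifting) case_prodI mem_Collect_eq order.strict_trans)
  }
  {
    fix c i j j' assume "(c, i, j) \<in> arcs w" "(c, i, j') \<in> arcs w"
    then show "j = j'" using moved_item_pop_inj[OF ok, of j j'] by (auto simp: arcs_def)
  }
  {
    fix c i i' j assume "(c, i, j) \<in> arcs w" "(c, i', j) \<in> arcs w"
    then show "i = i'" using moved_item_push_inj[of i w i'] by (auto simp: arcs_def)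
  }
  {
    fix c i j i' j' assume A: "(c, i, j) \<in> arcs w" "(c, i', j') \<in> arcs w" "i < i'" "i' < j" "j < j'"
    then have *: "i < length w" "j < length w" "w ! i = Push c" "w ! j = Pop c" 
       "j' < length w" "w ! i' = Push c" "w ! j' = Pop c" 
       "moved_item w i = moved_item w j" "moved_item w i' = moved_item w j'" by (auto simp: arcs_def)
    \<comment> \<open>When \<open>j\<close> pops, the item pushed at \<open>i'\<close> is still on
      the same stack and larger than the popped item, which should be the maximum of that
      stack.\<close>
    have "on_stack (take j w) c (moved_item w i')"
      unfolding on_stack_def
    proof (intro conjI notI)
      show "\<exists>i<length (take j w). take j w ! i = Push c \<and> moved_item (take j w) i = moved_item w i'"
        using * A by (intro exI[of _ i']) (auto simp: moved_item_take)
    next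
      assume "\<exists>k<length (take j w). \<not> is_push (take j w ! k) \<and> moved_item (take j w) k = moved_item w i'"
      then obtain k where "k < j" "\<not> is_push (w ! k)" "moved_item w k = moved_item w j'"
        using * by (auto simp: moved_item_take)
      then show False using moved_item_pop_inj[OF ok, of k j'] * \<open>j < j'\<close> by simp
    qed
    then have "moved_item w i' \<le> moved_item w j" using popped_on_stack(2)[OF ok *(2,4)] by simp
    then show False using moved_item_push_mono[of i i' w] * A by simp
  }
qed

text \<open>From here on an arch system is computed by exhibiting a matching instead of executing
  the word.\<close>

lemma arcs_eqI: "matching w A \<Longrightarrow> arcs w = A"
  using matching_unique matching_imp_op_sequence op_sequence_matching by blast

section \<open>Components\<close>

definition component :: "arch set \<Rightarrow> arch \<Rightarrow> arch set" where
  "component A \<alpha> = {\<beta> \<in> A. (\<alpha>, \<beta>) \<in> (crossing_graph A)\<^sup>*}"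

text \<open>Such a set is a union of components of \<open>A\<close>. The condition can be checked
  for the parts of a word before their components are known.\<close>

definition crossing_closed :: "arch set \<Rightarrow> arch set \<Rightarrow> bool" where
  "crossing_closed A X \<longleftrightarrow> X \<subseteq> A \<and> (\<forall>\<alpha>\<in>X. \<forall>\<beta>\<in>A. arches_cross \<alpha> \<beta> \<longrightarrow> \<beta> \<in> X)"

lemma arches_cross_sym: "arches_cross \<alpha> \<beta> \<longleftrightarrow> arches_cross \<beta> \<alpha>"
  unfolding arches_cross_def by auto

lemma crossing_rtrancl_sym:
  "(\<alpha>, \<beta>) \<in> (crossing_graph A)\<^sup>* \<Longrightarrow> (\<beta>, \<alpha>) \<in> (crossing_graph A)\<^sup>*"
proof -
  have "sym (crossing_graph A)"
    unfolding sym_def crossing_graph_def using arches_cross_sym by blast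
  then show "(\<alpha>, \<beta>) \<in> (crossing_graph A)\<^sup>* \<Longrightarrow> (\<beta>, \<alpha>) \<in> (crossing_graph A)\<^sup>*"
    by (meson sym_rtrancl symD)
qed

lemma self_in_comp: "\<alpha> \<in> A \<Longrightarrow> \<alpha> \<in> component A \<alpha>"
  by (simp add: component_def)

lemma comp_subset: "component A \<alpha> \<subseteq> A"
  by (auto simp: component_def)

lemma comp_eq:
  assumes "\<beta> \<in> component A \<alpha>"
  shows "component A \<beta> = component A \<alpha>"
proof -
  have ab: "(\<alpha>, \<beta>) \<in> (crossing_graph A)\<^sup>*" using assms by (simp add: component_def)
  show ?thesis
    unfolding component_def
    using rtrancl_trans[OF ab] rtrancl_trans[OF crossing_rtrancl_sym[OF ab]] by blast
qed

lemma components_eq: "components A = component A ` A"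
  unfolding components_def quotient_def component_def by auto

lemma standard_arches_iff:
  "standard_arches A \<longleftrightarrow> (\<forall>\<alpha>\<in>A. arch_colour (arg_min_on left_end (component A \<alpha>)) = Red)"
  unfolding standard_arches_def components_eq by blast

lemma connected_arches_iff: "connected_arches A \<longleftrightarrow> A \<noteq> {} \<and> (\<forall>\<alpha>\<in>A. component A \<alpha> = A)"
  unfolding connected_arches_def component_def by blast

text \<open>A path of crossings that starts in \<open>X\<close> never leaves
  \<open>X\<close>.\<close>

lemma comp_crossing_closed:
  assumes X: "crossing_closed A X" and "\<alpha> \<in> X"
  shows "component A \<alpha> = component X \<alpha>"
proof -
  have sub: "crossing_graph X \<subseteq> crossing_graph A"
    using X unfolding crossing_closed_def crossing_graph_def by blast
  have "\<beta> \<in> X \<and> (\<alpha>, \<beta>) \<in> (crossing_graph X)\<^sup>*" if "(\<alpha>, \<beta>) \<in> (crossing_graph A)\<^sup>*" for \<beta>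
    using that
  proof (induction rule: rtrancl_induct)
    case base
    then show ?case using \<open>\<alpha> \<in> X\<close> by simp
  next
    case (step \<beta> \<gamma>)
    then have "\<gamma> \<in> X" using X unfolding crossing_closed_def crossing_graph_def by blast
    then have "(\<beta>, \<gamma>) \<in> crossing_graph X" using step unfolding crossing_graph_def by blast
    then show ?case using step \<open>\<gamma> \<in> X\<close> by (meson rtrancl.rtrancl_into_rtrancl)
  qed
  then show ?thesis
    using rtrancl_mono[OF sub] X unfolding component_def crossing_closed_def by blast
qed

lemma crossing_closed_comp: "crossing_closed A (component A \<alpha>)"
  unfolding crossing_closed_def component_def
proof (intro conjI ballI impI)
  fix \<beta> \<gamma> assume *: "\<beta> \<in> {\<beta> \<in> A. (\<alpha>, \<beta>) \<in> (crossing_graph A)\<^sup>*}" "\<gamma> \<in> A" "arches_cross \<beta> \<gamma>"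
  then have "(\<beta>, \<gamma>) \<in> crossing_graph A" by (simp add: crossing_graph_def)
  then show "\<gamma> \<in> {\<beta> \<in> A. (\<alpha>, \<beta>) \<in> (crossing_graph A)\<^sup>*}"
    using * by (auto intro: rtrancl.rtrancl_into_rtrancl)
qed auto

lemma standard_arches_Union:
  assumes "A = \<Union> (X ` I)" and "\<And>x. x \<in> I \<Longrightarrow> crossing_closed A (X x)"
  shows "standard_arches A \<longleftrightarrow> (\<forall>x\<in>I. standard_arches (X x))"
proof -
  have "component A \<alpha> = component (X x) \<alpha>" if "x \<in> I" "\<alpha> \<in> X x" for x \<alpha>
    using comp_crossing_closed[OF assms(2)] that by blast
  then show ?thesis unfolding standard_arches_iff assms(1) by (simp del: UN_simps)
qed

lemma connected_imp_comp:
  assumes "crossing_closed A X" "connected_arches X" "\<alpha> \<in> X"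
  shows "component A \<alpha> = X"
  using assms comp_crossing_closed connected_arches_iff by metis

lemma connected_comp:
  assumes "\<alpha> \<in> A"
  shows "connected_arches (component A \<alpha>)"
  unfolding connected_arches_iff
  using comp_eq comp_crossing_closed[OF crossing_closed_comp] self_in_comp[OF assms] by blast

text \<open>Paths of crossings are transported one edge at a time in both directions. The map is a
  shift of positions, a recolouring or an exchange of the colours in the applications.\<close>

lemma comp_image:
  assumes cr: "\<And>\<alpha> \<beta>. \<alpha> \<in> A \<Longrightarrow> \<beta> \<in> A \<Longrightarrow> arches_cross (\<phi> \<alpha>) (\<phi> \<beta>) = arches_cross \<alpha> \<beta>"
    and a: "\<alpha> \<in> A"
  shows "component (\<phi> ` A) (\<phi> \<alpha>) = \<phi> ` component A \<alpha>"
proof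
  have "\<exists>\<gamma>\<in>A. \<beta> = \<phi> \<gamma> \<and> (\<alpha>, \<gamma>) \<in> (crossing_graph A)\<^sup>*"
    if "(\<phi> \<alpha>, \<beta>) \<in> (crossing_graph (\<phi> ` A))\<^sup>*" for \<beta>
    using that
  proof (induction rule: rtrancl_induct)
    case base
    then show ?case using a by blast
  next
    case (step \<beta> \<beta>')
    then obtain \<gamma> where g: "\<gamma> \<in> A" "\<beta> = \<phi> \<gamma>" "(\<alpha>, \<gamma>) \<in> (crossing_graph A)\<^sup>*" by blast
    obtain \<gamma>' where g': "\<gamma>' \<in> A" "\<beta>' = \<phi> \<gamma>'" "arches_cross \<beta> \<beta>'"
      using step unfolding crossing_graph_def by blast
    then have "(\<gamma>, \<gamma>') \<in> crossing_graph A" using g cr by (simp add: crossing_graph_def)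
    then show ?case using g(3) g'(1,2) by (blast intro: rtrancl.rtrancl_into_rtrancl)
  qed
  then show "component (\<phi> ` A) (\<phi> \<alpha>) \<subseteq> \<phi> ` component A \<alpha>"
    unfolding component_def by blast
next
  have "(\<phi> \<alpha>, \<phi> \<beta>) \<in> (crossing_graph (\<phi> ` A))\<^sup>*" if "(\<alpha>, \<beta>) \<in> (crossing_graph A)\<^sup>*" for \<beta>
    using that
  proof (induction rule: rtrancl_induct)
    case (step \<beta> \<gamma>)
    then have "\<beta> \<in> A" "\<gamma> \<in> A" "arches_cross \<beta> \<gamma>" by (simp_all add: crossing_graph_def)
    then have "(\<phi> \<beta>, \<phi> \<gamma>) \<in> crossing_graph (\<phi> ` A)" using cr by (simp add: crossing_graph_def)
    then show ?case using step.IH by (rule rtrancl.rtrancl_into_rtrancl[rotated])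
  qed simp
  then show "\<phi> ` component A \<alpha> \<subseteq> component (\<phi> ` A) (\<phi> \<alpha>)"
    unfolding component_def by blast
qed

text \<open>\<open>arg_min_on\<close> is a choice among minimisers; injectivity of \<open>f\<close>
  leaves only one.\<close>

lemma arg_min_on_eqI:
  fixes f :: "'a \<Rightarrow> nat"
  assumes "\<beta> \<in> K" "\<And>\<gamma>. \<gamma> \<in> K \<Longrightarrow> f \<beta> \<le> f \<gamma>" "inj_on f K"
  shows "arg_min_on f K = \<beta>"
proof -
  have m: "is_arg_min f (\<lambda>x. x \<in> K) \<beta>"
    using assms(1,2) unfolding is_arg_min_def by (meson leD)
  have u: "x = \<beta>" if "is_arg_min f (\<lambda>x. x \<in> K) x" for x
  proof -
    have "x \<in> K" "\<not> f \<beta> < f x" using that assms(1) unfolding is_arg_min_def by auto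
    then have "f x = f \<beta>" using assms(2)[of x] by simp
    then show ?thesis using inj_onD[OF assms(3)] \<open>x \<in> K\<close> assms(1) by blast
  qed
  show ?thesis
    unfolding arg_min_on_def arg_min_def using m u by (rule some_equality)
qed

lemma arg_min_on_image:
  fixes f :: "'a \<Rightarrow> nat" and g :: "'b \<Rightarrow> nat"
  assumes "K \<noteq> {}" "inj_on f K"
    and "\<And>x y. x \<in> K \<Longrightarrow> y \<in> K \<Longrightarrow> g (\<phi> x) \<le> g (\<phi> y) \<longleftrightarrow> f x \<le> f y"
  shows "arg_min_on g (\<phi> ` K) = \<phi> (arg_min_on f K)" "arg_min_on f K \<in> K"
proof -
  obtain x where "x \<in> K" using assms(1) by blast
  then obtain \<beta> where b: "\<beta> \<in> K" "\<And>\<gamma>. \<gamma> \<in> K \<Longrightarrow> f \<beta> \<le> f \<gamma>"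
    using ex_has_least_nat[of "\<lambda>x. x \<in> K" x f] by blast
  have 1: "arg_min_on f K = \<beta>" using b assms(2) by (rule arg_min_on_eqI)
  have "inj_on g (\<phi> ` K)"
  proof (rule inj_onI)
    fix x y assume "x \<in> \<phi> ` K" "y \<in> \<phi> ` K" "g x = g y"
    then obtain x' y' where *: "x' \<in> K" "y' \<in> K" "x = \<phi> x'" "y = \<phi> y'" by blast
    then have "f x' = f y'" using assms(3)[of x' y'] assms(3)[of y' x'] \<open>g x = g y\<close> by simp
    then show "x = y" using inj_onD[OF assms(2)] * by blast
  qed
  moreover have "g (\<phi> \<beta>) \<le> g y" if "y \<in> \<phi> ` K" for y
    using that b assms(3) by blast
  ultimately have "arg_min_on g (\<phi> ` K) = \<phi> \<beta>"
    using b(1) by (intro arg_min_on_eqI) blast+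
  then show "arg_min_on g (\<phi> ` K) = \<phi> (arg_min_on f K)" "arg_min_on f K \<in> K" using 1 b by simp_all
qed

lemma standard_arches_image:
  assumes cr: "\<And>\<alpha> \<beta>. \<alpha> \<in> A \<Longrightarrow> \<beta> \<in> A \<Longrightarrow> arches_cross (\<phi> \<alpha>) (\<phi> \<beta>) = arches_cross \<alpha> \<beta>"
    and "\<And>\<alpha>. \<alpha> \<in> A \<Longrightarrow> arch_colour (\<phi> \<alpha>) = arch_colour \<alpha>"
    and "inj_on left_end A"
    and "\<And>\<alpha> \<beta>. \<alpha> \<in> A \<Longrightarrow> \<beta> \<in> A \<Longrightarrow> left_end (\<phi> \<alpha>) \<le> left_end (\<phi> \<beta>) \<longleftrightarrow> left_end \<alpha> \<le> left_end \<beta>"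
  shows "standard_arches (\<phi> ` A) \<longleftrightarrow> standard_arches A"
proof -
  have "arch_colour (arg_min_on left_end (component (\<phi> ` A) (\<phi> \<alpha>))) = arch_colour (arg_min_on left_end (component A \<alpha>))"
    if "\<alpha> \<in> A" for \<alpha>
  proof -
    have sub: "component A \<alpha> \<subseteq> A" and ne: "component A \<alpha> \<noteq> {}"
      using comp_subset self_in_comp[OF that] by blast+
    have 1: "component (\<phi> ` A) (\<phi> \<alpha>) = \<phi> ` component A \<alpha>" by (rule comp_image[OF cr that])
    have 2: "inj_on left_end (component A \<alpha>)" using assms(3) sub by (rule inj_on_subset)
    have 4: "left_end (\<phi> x) \<le> left_end (\<phi> y) \<longleftrightarrow> left_end x \<le> left_end y"
      if "x \<in> component A \<alpha>" "y \<in> component A \<alpha>" for x y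
      using that assms(4) sub by blast
    note 3 = arg_min_on_image[OF ne 2, of left_end \<phi>, OF 4]
    have "arg_min_on left_end (component A \<alpha>) \<in> A" using 3(2) sub by blast
    then show ?thesis using 1 3(1) assms(2) by simp
  qed
  then show ?thesis unfolding standard_arches_iff by simp
qed

lemma connected_arches_image:
  assumes inj: "inj_on \<phi> A" and cr: "\<And>\<alpha> \<beta>. \<alpha> \<in> A \<Longrightarrow> \<beta> \<in> A \<Longrightarrow> arches_cross (\<phi> \<alpha>) (\<phi> \<beta>) = arches_cross \<alpha> \<beta>"
  shows "connected_arches (\<phi> ` A) \<longleftrightarrow> connected_arches A"
proof -
  have "component (\<phi> ` A) (\<phi> \<alpha>) = \<phi> ` A \<longleftrightarrow> component A \<alpha> = A" if "\<alpha> \<in> A" for \<alpha>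
    using comp_image[OF cr that] inj_on_image_eq_iff[OF inj comp_subset subset_refl] by simp
  then show ?thesis unfolding connected_arches_iff by simp
qed

lemma amap_simps [simp]:
  "arch_colour (amap f \<alpha>) = arch_colour \<alpha>"
  "left_end (amap f \<alpha>) = f (left_end \<alpha>)"
  "right_end (amap f \<alpha>) = f (right_end \<alpha>)"
  by (cases \<alpha>; simp add: arch_colour_def left_end_def right_end_def)+

lemma arch_eqI:
  "arch_colour \<alpha> = arch_colour \<beta> \<Longrightarrow> left_end \<alpha> = left_end \<beta> \<Longrightarrow> right_end \<alpha> = right_end \<beta> \<Longrightarrow> \<alpha> = \<beta>"
  by (cases \<alpha>; cases \<beta>) (simp add: arch_colour_def left_end_def right_end_def)

text \<open>A relabelling such as \<open>pos ps\<close> is increasing only on a range of positions,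
  so monotonicity is asked for on a set containing all endpoints.\<close>

definition endpoints_in :: "arch set \<Rightarrow> nat set \<Rightarrow> bool" where
  "endpoints_in A S \<longleftrightarrow> (\<forall>\<alpha>\<in>A. left_end \<alpha> \<in> S \<and> right_end \<alpha> \<in> S)"

lemma amap_inj_on:
  assumes "endpoints_in A S" "strict_mono_on S f"
  shows "inj_on (amap f) A"
proof (rule inj_onI)
  fix \<alpha> \<beta> assume "\<alpha> \<in> A" "\<beta> \<in> A" and eq: "amap f \<alpha> = amap f \<beta>"
  then have S: "left_end \<alpha> \<in> S" "right_end \<alpha> \<in> S" "left_end \<beta> \<in> S" "right_end \<beta> \<in> S"
    using assms(1) by (auto simp: endpoints_in_def)
  have inj: "inj_on f S" using assms(2) by (rule strict_mono_on_imp_inj_on)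
  have "arch_colour \<alpha> = arch_colour \<beta>" "f (left_end \<alpha>) = f (left_end \<beta>)"
    "f (right_end \<alpha>) = f (right_end \<beta>)"
    using eq by (metis amap_simps)+
  then show "\<alpha> = \<beta>" using inj_onD[OF inj] S by (intro arch_eqI)
qed

lemma amap_cross:
  assumes "endpoints_in A S" "strict_mono_on S f" "\<alpha> \<in> A" "\<beta> \<in> A"
  shows "arches_cross (amap f \<alpha>) (amap f \<beta>) = arches_cross \<alpha> \<beta>"
proof -
  have "left_end \<alpha> \<in> S" "right_end \<alpha> \<in> S" "left_end \<beta> \<in> S" "right_end \<beta> \<in> S"
    using assms by (auto simp: endpoints_in_def)
  then show ?thesis
    unfolding arches_cross_def by (simp add: strict_mono_on_less[OF assms(2)])
qed

lemma standard_amap: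
  assumes "endpoints_in A S" "strict_mono_on S f" "inj_on left_end A"
  shows "standard_arches (amap f ` A) \<longleftrightarrow> standard_arches A"
proof (rule standard_arches_image)
  show "arches_cross (amap f \<alpha>) (amap f \<beta>) = arches_cross \<alpha> \<beta>" if "\<alpha> \<in> A" "\<beta> \<in> A" for \<alpha> \<beta>
    by (rule amap_cross[OF assms(1,2) that])
  show "left_end (amap f \<alpha>) \<le> left_end (amap f \<beta>) \<longleftrightarrow> left_end \<alpha> \<le> left_end \<beta>"
    if "\<alpha> \<in> A" "\<beta> \<in> A" for \<alpha> \<beta>
    using strict_mono_on_less_eq[OF assms(2)] that assms(1) by (simp add: endpoints_in_def)
qed (use assms(3) in simp_all)

lemma connected_amap:
  assumes "endpoints_in A S" "strict_mono_on S f"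
  shows "connected_arches (amap f ` A) \<longleftrightarrow> connected_arches A"
  by (rule connected_arches_image[OF amap_inj_on[OF assms] amap_cross[OF assms]])

lemma matching_endpoints: "matching w A \<Longrightarrow> endpoints_in A {..<length w}"
  unfolding endpoints_in_def left_end_def right_end_def by (auto dest: matching_arch)

lemma matching_left_inj:
  assumes "matching w A"
  shows "inj_on left_end A"
proof (rule inj_onI)
  fix \<alpha> \<beta> assume *: "\<alpha> \<in> A" "\<beta> \<in> A" "left_end \<alpha> = left_end \<beta>"
  obtain c i j c' j' where "\<alpha> = (c, i, j)" "\<beta> = (c', i, j')"
    using *(3) by (cases \<alpha>; cases \<beta>) (simp add: left_end_def)
  then show "\<alpha> = \<beta>" using matching_left_unique[OF assms] * by blast
qed

lemma standard_arch_system_of: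
  assumes "op_sequence w"
  shows "standard_arches (arch_system_of w) \<longleftrightarrow> standard_arches (arcs w)"
    "connected_arches (arch_system_of w) \<longleftrightarrow> connected_arches (arcs w)"
proof -
  note m = op_sequence_matching[OF assms]
  have "strict_mono_on {..<length w} Suc" by (simp add: strict_mono_on_def)
  then show "standard_arches (arch_system_of w) \<longleftrightarrow> standard_arches (arcs w)"
    "connected_arches (arch_system_of w) \<longleftrightarrow> connected_arches (arcs w)"
    unfolding arch_system_of_arcs
    using standard_amap[OF matching_endpoints[OF m]] matching_left_inj[OF m]
      connected_amap[OF matching_endpoints[OF m]] by blast+
qed

section \<open>Cutting out the component of the first arch\<close>

text \<open>Gluing of matchings whose positions tile those of \<open>w\<close>. The last hypothesis
  forbids interleaving of two different parts whatever the colours; within one part noncrossing is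
  inherited.\<close>

lemma matching_Union:
  assumes m: "\<And>x. x \<in> I \<Longrightarrow> matching (v x) (A x)"
    and mono: "\<And>x. x \<in> I \<Longrightarrow> strict_mono_on {..<length (v x)} (f x)"
    and val: "\<And>x i. x \<in> I \<Longrightarrow> i < length (v x) \<Longrightarrow> f x i < length w \<and> w ! f x i = v x ! i"
    and cover: "\<And>p. p < length w \<Longrightarrow> \<exists>x\<in>I. \<exists>i<length (v x). p = f x i"
    and disj: "\<And>x y i j. x \<in> I \<Longrightarrow> y \<in> I \<Longrightarrow> i < length (v x) \<Longrightarrow> j < length (v y) \<Longrightarrow> f x i = f y j \<Longrightarrow> x = y"
    and nc: "\<And>x y i j i' j'. x \<in> I \<Longrightarrow> y \<in> I \<Longrightarrow> x \<noteq> y \<Longrightarrow> i < j \<Longrightarrow> j < length (v x) \<Longrightarrow> i' < j' \<Longrightarrow> j' < length (v y) \<Longrightarrow>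
      f x i < f y i' \<Longrightarrow> f y i' < f x j \<Longrightarrow> f x j < f y j' \<Longrightarrow> False"
  shows "matching w (\<Union>x\<in>I. amap (f x) ` A x)" (is "matching w ?U")
proof -
  have U: "\<exists>x\<in>I. \<exists>a b. (c, a, b) \<in> A x \<and> i = f x a \<and> j = f x b \<and> a < b \<and> a < length (v x) \<and> b < length (v x)"
    if "(c, i, j) \<in> ?U" for c i j
  proof -
    obtain x c' a b where x: "x \<in> I" "(c', a, b) \<in> A x" "(c, i, j) = amap (f x) (c', a, b)"
      using \<open>(c, i, j) \<in> ?U\<close> by fast
    then have "c = c'" "i = f x a" "j = f x b" by simp_all
    then show ?thesis using matching_arch[OF m[OF x(1)] x(2)] x(1,2) by blast
  qed
  have UI: "(c, f x a, f x b) \<in> ?U" if "x \<in> I" "(c, a, b) \<in> A x" for x c a b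
    using that by force
  have inj: "a = b" if "x \<in> I" "a < length (v x)" "b < length (v x)" "f x a = f x b" for x a b
    using inj_onD[OF strict_mono_on_imp_inj_on[OF mono[OF that(1)]], of a b] that by simp
  have less: "a < b \<longleftrightarrow> f x a < f x b" if "x \<in> I" "a < length (v x)" "b < length (v x)" for x a b
    using strict_mono_on_less[OF mono[OF that(1)], of a b] that by simp
  show ?thesis
  proof (rule matchingI)
    fix c i j assume "(c, i, j) \<in> ?U"
    then obtain x a b where x: "x \<in> I" "(c, a, b) \<in> A x" "i = f x a" "j = f x b"
      "a < b" "a < length (v x)" "b < length (v x)" using U by blast
    then show "i < j \<and> j < length w \<and> w ! i = Push c \<and> w ! j = Pop c"
      using less[OF x(1,6,7)] val[OF x(1,6)] val[OF x(1,7)] matching_arch[OF m[OF x(1)] x(2)] by simp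
  next
    fix p c assume p: "p < length w" "w ! p = Push c"
    then obtain x i where x: "x \<in> I" "i < length (v x)" "p = f x i" using cover by blast
    then have "v x ! i = Push c" using val[OF x(1,2)] p by simp
    then obtain j where "(c, i, j) \<in> A x" using matching_push[OF m[OF x(1)] x(2)] by blast
    from UI[OF x(1) this] show "\<exists>j. (c, p, j) \<in> ?U" unfolding x(3) by (rule exI)
  next
    fix p c assume p: "p < length w" "w ! p = Pop c"
    then obtain x i where x: "x \<in> I" "i < length (v x)" "p = f x i" using cover by blast
    then have "v x ! i = Pop c" using val[OF x(1,2)] p by simp
    then obtain j where "(c, j, i) \<in> A x" using matching_pop[OF m[OF x(1)] x(2)] by blast
    from UI[OF x(1) this] show "\<exists>j. (c, j, p) \<in> ?U" unfolding x(3) by (rule exI)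
  next
    fix c i j j' assume *: "(c, i, j) \<in> ?U" "(c, i, j') \<in> ?U"
    obtain x a b where x: "x \<in> I" "(c, a, b) \<in> A x" "i = f x a" "j = f x b"
      "a < length (v x)" using U[OF *(1)] by blast
    obtain y a' b' where y: "y \<in> I" "(c, a', b') \<in> A y" "i = f y a'" "j' = f y b'"
      "a' < length (v y)" using U[OF *(2)] by blast
    have "x = y" using disj[OF x(1) y(1) x(5) y(5)] x y by simp
    moreover have "a = a'" using inj[OF x(1), of a a'] x y \<open>x = y\<close> by simp
    ultimately show "j = j'" using matching_left_unique(2)[OF m[OF x(1)] x(2)] x y by blast
  next
    fix c i i' j assume *: "(c, i, j) \<in> ?U" "(c, i', j) \<in> ?U"
    obtain x a b where x: "x \<in> I" "(c, a, b) \<in> A x" "i = f x a" "j = f x b"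
      "b < length (v x)" using U[OF *(1)] by blast
    obtain y a' b' where y: "y \<in> I" "(c, a', b') \<in> A y" "i' = f y a'" "j = f y b'"
      "b' < length (v y)" using U[OF *(2)] by blast
    have "x = y" using disj[OF x(1) y(1) x(5) y(5)] x y by simp
    moreover have "b = b'" using inj[OF x(1), of b b'] x y \<open>x = y\<close> by simp
    ultimately show "i = i'" using matching_right_unique(2)[OF m[OF x(1)] x(2)] x y by blast
  next
    fix c i j i' j' assume *: "(c, i, j) \<in> ?U" "(c, i', j') \<in> ?U" and cr: "i < i'" "i' < j" "j < j'"
    obtain x a b where x: "x \<in> I" "(c, a, b) \<in> A x" "i = f x a" "j = f x b"
      "a < b" "a < length (v x)" "b < length (v x)" using U[OF *(1)] by blast
    obtain y a' b' where y: "y \<in> I" "(c, a', b') \<in> A y" "i' = f y a'" "j' = f y b'"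
      "a' < b'" "a' < length (v y)" "b' < length (v y)" using U[OF *(2)] by blast
    have xy: "x = y"
    proof (rule ccontr)
      assume "x \<noteq> y"
      from nc[OF x(1) y(1) this x(5,7) y(5,7)] show False using cr x(3,4) y(3,4) by simp
    qed
    then have "a < a'" "a' < b" "b < b'"
      using less[OF x(1,6), of a'] less[OF x(1), of a' b] less[OF x(1,7), of b'] cr x y by simp_all
    then show False using matching_noncrossing[OF m[OF x(1)] x(2), of a' b'] y xy by simp
  qed
qed

text \<open>The converse of gluing: as no arch joins the range of \<open>f\<close> to its
  complement, pulling \<open>A\<close> back along \<open>f\<close> gives a matching of the
  subword.\<close>

lemma matching_restrict:
  assumes m: "matching w A"
    and mono: "strict_mono_on {..<length v} f"
    and val: "\<And>i. i < length v \<Longrightarrow> f i < length w \<and> w ! f i = v ! i"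
    and closed: "\<And>c i j. (c, i, j) \<in> A \<Longrightarrow> i \<in> f ` {..<length v} \<longleftrightarrow> j \<in> f ` {..<length v}"
  shows "op_sequence v" and "amap f ` arcs v = {\<alpha> \<in> A. left_end \<alpha> \<in> f ` {..<length v}}"
proof -
  define B where "B = {(c, i, j). i < length v \<and> j < length v \<and> (c, f i, f j) \<in> A}"
  have inj: "a = b" if "a < length v" "b < length v" "f a = f b" for a b
    using inj_onD[OF strict_mono_on_imp_inj_on[OF mono], of a b] that by simp
  have less: "a < b \<longleftrightarrow> f a < f b" if "a < length v" "b < length v" for a b
    using strict_mono_on_less[OF mono, of a b] that by simp
  have mB: "matching v B"
  proof (rule matchingI)
    fix c i j assume "(c, i, j) \<in> B"
    then have b: "i < length v" "j < length v" "(c, f i, f j) \<in> A" by (simp_all add: B_def)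
    show "i < j \<and> j < length v \<and> v ! i = Push c \<and> v ! j = Pop c"
      using less[OF b(1,2)] b val[OF b(1)] val[OF b(2)] matching_arch[OF m b(3)] by simp
  next
    fix i c assume i: "i < length v" "v ! i = Push c"
    then obtain j where j: "(c, f i, j) \<in> A" using matching_push[OF m] val[OF i(1)] by metis
    then have "j \<in> f ` {..<length v}" using closed[OF j] i(1) by blast
    then obtain k where "k < length v" "j = f k" by blast
    then show "\<exists>j. (c, i, j) \<in> B" using i j by (auto simp: B_def)
  next
    fix i c assume i: "i < length v" "v ! i = Pop c"
    then obtain j where j: "(c, j, f i) \<in> A" using matching_pop[OF m] val[OF i(1)] by metis
    then have "j \<in> f ` {..<length v}" using closed[OF j] i(1) by blast
    then obtain k where "k < length v" "j = f k" by blast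
    then show "\<exists>j. (c, j, i) \<in> B" using i j by (auto simp: B_def)
  next
    fix c i j j' assume "(c, i, j) \<in> B" "(c, i, j') \<in> B"
    then have b: "j < length v" "j' < length v" "(c, f i, f j) \<in> A" "(c, f i, f j') \<in> A"
      by (simp_all add: B_def)
    then show "j = j'" using inj[OF b(1,2)] matching_left_unique(2)[OF m b(3,4)] by simp
  next
    fix c i i' j assume "(c, i, j) \<in> B" "(c, i', j) \<in> B"
    then have b: "i < length v" "i' < length v" "(c, f i, f j) \<in> A" "(c, f i', f j) \<in> A"
      by (simp_all add: B_def)
    then show "i = i'" using inj[OF b(1,2)] matching_right_unique(2)[OF m b(3,4)] by simp
  next
    fix c i j i' j' assume "(c, i, j) \<in> B" "(c, i', j') \<in> B" and cr: "i < i'" "i' < j" "j < j'"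
    then have b: "i < length v" "j < length v" "i' < length v" "j' < length v"
      "(c, f i, f j) \<in> A" "(c, f i', f j') \<in> A" by (simp_all add: B_def)
    have "f i < f i'" "f i' < f j" "f j < f j'"
      using less[OF b(1,3)] less[OF b(3,2)] less[OF b(2,4)] cr by simp_all
    then show False using matching_noncrossing[OF m b(5,6)] by simp
  qed
  then show "op_sequence v" by (rule matching_imp_op_sequence)
  have "amap f ` B = {\<alpha> \<in> A. left_end \<alpha> \<in> f ` {..<length v}}"
  proof (intro equalityI subsetI)
    fix \<alpha> assume "\<alpha> \<in> amap f ` B"
    then show "\<alpha> \<in> {\<alpha> \<in> A. left_end \<alpha> \<in> f ` {..<length v}}"
      by (auto simp: B_def left_end_def)
  next
    fix \<alpha> assume a: "\<alpha> \<in> {\<alpha> \<in> A. left_end \<alpha> \<in> f ` {..<length v}}"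
    obtain c i j where \<alpha>: "\<alpha> = (c, i, j)" by (cases \<alpha>)
    then have A: "(c, i, j) \<in> A" and i: "i \<in> f ` {..<length v}" using a by (simp_all add: left_end_def)
    have j: "j \<in> f ` {..<length v}" using closed[OF A] i by blast
    obtain i' j' where "i' < length v" "j' < length v" "i = f i'" "j = f j'" using i j by blast
    then have "(c, i', j') \<in> B" "\<alpha> = amap f (c, i', j')" using A \<alpha> by (simp_all add: B_def)
    then show "\<alpha> \<in> amap f ` B" by blast
  qed
  then show "amap f ` arcs v = {\<alpha> \<in> A. left_end \<alpha> \<in> f ` {..<length v}}"
    using arcs_eqI[OF mB] by simp
qed

section \<open>Words cut into a skeleton and the gaps after its letters\<close>

definition assemble :: "('a \<times> 'a list) list \<Rightarrow> 'a list" where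
  "assemble ps = concat (map (\<lambda>(s, g). s # g) ps)"

lemma assemble_simps [simp]:
  "assemble [] = []"
  "assemble ((s, g) # ps) = s # g @ assemble ps"
  "assemble (ps @ qs) = assemble ps @ assemble qs"
  by (simp_all add: assemble_def)

text \<open>The position of skeleton letter \<open>k\<close> in the assembled word. At
  \<open>length ps\<close> the value is the length of that word, so block \<open>k\<close> is always
  the interval from \<open>pos ps k\<close> up to, but excluding,
  \<open>pos ps (Suc k)\<close>.\<close>

definition pos :: "('a \<times> 'a list) list \<Rightarrow> nat \<Rightarrow> nat" where
  "pos ps k = length (assemble (take k ps))"

lemma pos_Suc: "k < length ps \<Longrightarrow> pos ps (Suc k) = Suc (pos ps k + length (snd (ps ! k)))"
  by (cases "ps ! k") (simp add: pos_def take_Suc_conv_app_nth)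

lemma pos_0 [simp]: "pos ps 0 = 0"
  by (simp add: pos_def)

lemma pos_length [simp]: "pos ps (length ps) = length (assemble ps)"
  by (simp add: pos_def)

lemma pos_less:
  assumes "k < m" "m \<le> length ps"
  shows "pos ps k + length (snd (ps ! k)) < pos ps m"
  using assms
proof (induction m)
  case (Suc m)
  then show ?case
    using pos_Suc[of m ps] pos_Suc[of k ps] by (cases "k = m") auto
qed simp

lemma pos_strict_mono: "strict_mono_on {..<length ps} (pos ps)"
proof (rule strict_mono_onI)
  fix r s assume "r \<in> {..<length ps}" "s \<in> {..<length ps}" "r < s"
  then show "pos ps r < pos ps s" using pos_less[of r s ps] by simp
qed

lemma assemble_split:
  assumes "k < length ps"
  shows "assemble ps = assemble (take k ps) @ fst (ps ! k) # snd (ps ! k) @ assemble (drop (Suc k) ps)"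
proof -
  have "assemble ps = assemble (take k ps @ ps ! k # drop (Suc k) ps)"
    using id_take_nth_drop[OF assms] by simp
  then show ?thesis by (cases "ps ! k") simp
qed

lemma assemble_nth:
  assumes "k < length ps"
  shows "assemble ps ! pos ps k = fst (ps ! k)"
    and "t < length (snd (ps ! k)) \<Longrightarrow> assemble ps ! Suc (pos ps k + t) = snd (ps ! k) ! t"
  unfolding pos_def by (subst assemble_split[OF assms], simp add: nth_append)+

lemma pos_block:
  assumes "p < length (assemble ps)"
  shows "\<exists>k<length ps. pos ps k \<le> p \<and> p < pos ps (Suc k)"
proof -
  \<comment> \<open>As \<open>pos ps 0\<close> is 0, this least index is positive; its predecessor
    is the block containing \<open>p\<close>.\<close>
  define k where "k = (LEAST m. p < pos ps m)"
  have "p < pos ps (length ps)" using assms by simp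
  then have k: "p < pos ps k" "k \<le> length ps" unfolding k_def by (rule LeastI, rule Least_le)
  then obtain k' where k': "k = Suc k'" by (cases k) simp_all
  have "\<not> p < pos ps k'" using not_less_Least[of k' "\<lambda>m. p < pos ps m"] k' k_def by simp
  then show ?thesis using k k' by (intro exI[of _ k']) simp
qed

lemma pos_block_unique:
  assumes "k < length ps" "k' < length ps" "pos ps k \<le> p" "p < pos ps (Suc k)" "pos ps k' \<le> p" "p < pos ps (Suc k')"
  shows "k = k'"
proof (rule ccontr)
  assume "k \<noteq> k'"
  then consider "Suc k \<le> k'" | "Suc k' \<le> k" by linarith
  then show False
  proof cases
    case 1
    then show False using pos_less[of "k" k' ps] pos_Suc[of k ps] assms by simp
  next
    case 2
    then show False using pos_less[of "k'" k ps] pos_Suc[of k' ps] assms by simp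
  qed
qed

text \<open>A word \<open>assemble ps\<close> is cut into the skeleton \<open>map fst ps\<close> (index \<open>None\<close>) and, for each
  skeleton letter \<open>k\<close>, the word \<open>snd (ps ! k)\<close> filling the gap after it (index \<open>Some k\<close>).\<close>

definition parts :: "('a \<times> 'a list) list \<Rightarrow> nat option set" where
  "parts ps = insert None (Some ` {..<length ps})"

fun part_word :: "('a \<times> 'a list) list \<Rightarrow> nat option \<Rightarrow> 'a list" where
  "part_word ps None = map fst ps"
| "part_word ps (Some k) = snd (ps ! k)"

fun part_map :: "('a \<times> 'a list) list \<Rightarrow> nat option \<Rightarrow> nat \<Rightarrow> nat" where
  "part_map ps None k = pos ps k"
| "part_map ps (Some k) t = Suc (pos ps k + t)"

lemma part_map_mono: "x \<in> parts ps \<Longrightarrow> strict_mono_on {..<length (part_word ps x)} (part_map ps x)"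
  using pos_strict_mono[of ps] by (cases x) (simp_all add: strict_mono_on_def)

lemma gap_bounds:
  assumes "k < length ps" "t < length (snd (ps ! k))"
  shows "pos ps k < part_map ps (Some k) t" "part_map ps (Some k) t < pos ps (Suc k)"
  using assms by (simp_all add: pos_Suc)

lemma skeleton_not_inside:
  assumes "k < length ps" "m < length ps"
  shows "pos ps m \<le> pos ps k \<or> pos ps (Suc k) \<le> pos ps m"
proof (cases "m \<le> k")
  case True
  then show ?thesis using pos_less[of m k ps] assms by (cases "m = k") simp_all
next
  case False
  then show ?thesis using pos_less[of k m ps] pos_Suc[OF assms(1)] assms by simp
qed

lemma part_map_val:
  assumes "x \<in> parts ps" "i < length (part_word ps x)"
  shows "part_map ps x i < length (assemble ps) \<and> assemble ps ! part_map ps x i = part_word ps x ! i"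
proof (cases x)
  case None
  then have i: "i < length ps" using assms by simp
  then show ?thesis
    using None pos_less[OF i order_refl] assemble_nth(1)[OF i] by simp
next
  case (Some k)
  then have k: "k < length ps" "i < length (snd (ps ! k))" using assms by (auto simp: parts_def)
  then show ?thesis
    using Some gap_bounds[OF k] pos_Suc[OF k(1)] pos_less[OF k(1) order_refl] assemble_nth(2)[OF k] by simp
qed

lemma part_map_cover:
  assumes "p < length (assemble ps)"
  shows "\<exists>x\<in>parts ps. \<exists>i<length (part_word ps x). p = part_map ps x i"
proof -
  obtain k where k: "k < length ps" "pos ps k \<le> p" "p < pos ps (Suc k)" using pos_block[OF assms] by blast
  show ?thesis
  proof (cases "p = pos ps k")
    case True
    then show ?thesis using k by (intro bexI[of _ None] exI[of _ k]) (simp_all add: parts_def)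
  next
    case False
    then have "p = part_map ps (Some k) (p - Suc (pos ps k))" "p - Suc (pos ps k) < length (snd (ps ! k))"
      using k pos_Suc[OF k(1)] by simp_all
    then show ?thesis using k
      by (intro bexI[of _ "Some k"] exI[of _ "p - Suc (pos ps k)"]) (simp_all add: parts_def)
  qed
qed

lemma part_map_separate:
  assumes "x \<in> parts ps" "Some k \<in> parts ps" "x \<noteq> Some k" "i < length (part_word ps x)"
  shows "part_map ps x i \<le> pos ps k \<or> pos ps (Suc k) \<le> part_map ps x i"
proof -
  have k: "k < length ps" using assms(2) by (auto simp: parts_def)
  show ?thesis
  proof (cases x)
    case None
    then show ?thesis using skeleton_not_inside[OF k, of i] assms(4) by simp
  next
    case (Some m)
    then have m: "m < length ps" "i < length (snd (ps ! m))" "m \<noteq> k" using assms by (auto simp: parts_def)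
    then show ?thesis
      using pos_block_unique[OF m(1) k, of "part_map ps x i"] gap_bounds[OF m(1,2)] Some by force
  qed
qed

lemma part_map_disjoint:
  assumes "x \<in> parts ps" "y \<in> parts ps" "i < length (part_word ps x)" "j < length (part_word ps y)"
    and "part_map ps x i = part_map ps y j"
  shows "x = y"
proof (rule ccontr)
  assume ne: "x \<noteq> y"
  have gap: False if "z \<in> parts ps" "Some k \<in> parts ps" "z \<noteq> Some k" "a < length (part_word ps z)"
      "b < length (part_word ps (Some k))" "part_map ps z a = part_map ps (Some k) b" for z k a b
  proof -
    have k: "k < length ps" "b < length (snd (ps ! k))" using that(2,5) by (auto simp: parts_def)
    show False using part_map_separate[OF that(1-4)] gap_bounds[OF k] that(6) by linarith
  qed
  show False
  proof (cases x)
    case (Some k)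
    then show ?thesis using gap[of y k j i] assms ne by metis
  next
    case None
    then obtain k where "y = Some k" using ne by (cases y) simp_all
    then show ?thesis using gap[of x k i j] assms ne by metis
  qed
qed

text \<open>One of two different parts is a gap, which fills an interval free of the other part.
  Interleaving would put an endpoint of the other part strictly inside that interval.\<close>

lemma parts_not_interleaved:
  assumes x: "x \<in> parts ps" and y: "y \<in> parts ps" and ne: "x \<noteq> y"
    and ij: "i < j" "j < length (part_word ps x)" "i' < j'" "j' < length (part_word ps y)"
    and cr: "part_map ps x i < part_map ps y i'" "part_map ps y i' < part_map ps x j"
      "part_map ps x j < part_map ps y j'"
  shows False
proof (cases x)
  case (Some k)
  then have k: "k < length ps" "i < length (snd (ps ! k))" "j < length (snd (ps ! k))"
    using x ij by (auto simp: parts_def)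
  have "part_map ps y i' \<le> pos ps k \<or> pos ps (Suc k) \<le> part_map ps y i'"
    using part_map_separate[of y ps k i'] x[unfolded Some] y ne[unfolded Some] ij by simp
  then show False using gap_bounds[OF k(1,2)] gap_bounds[OF k(1,3)] cr[unfolded Some] by linarith
next
  case None
  then obtain k where Some: "y = Some k" using ne by (cases y) simp_all
  then have k: "k < length ps" "i' < length (snd (ps ! k))" "j' < length (snd (ps ! k))"
    using y ij by (auto simp: parts_def)
  have "part_map ps x j \<le> pos ps k \<or> pos ps (Suc k) \<le> part_map ps x j"
    using part_map_separate[of x ps k j] x y[unfolded Some] ne[unfolded Some] ij by simp
  then show False using gap_bounds[OF k(1,2)] gap_bounds[OF k(1,3)] cr[unfolded Some] by linarith
qed

definition part_arcs :: "(operation \<times> operation list) list \<Rightarrow> nat option \<Rightarrow> arch set" where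
  "part_arcs ps x = amap (part_map ps x) ` arcs (part_word ps x)"

lemma assemble_matching:
  assumes "\<And>x. x \<in> parts ps \<Longrightarrow> op_sequence (part_word ps x)"
  shows "matching (assemble ps) (\<Union>x\<in>parts ps. part_arcs ps x)"
  unfolding part_arcs_def
proof (rule matching_Union)
  show "matching (part_word ps x) (arcs (part_word ps x))" if "x \<in> parts ps" for x
    using op_sequence_matching assms that by blast
next
  show "\<exists>x\<in>parts ps. \<exists>i<length (part_word ps x). p = part_map ps x i" if "p < length (assemble ps)" for p
    using part_map_cover[OF that] .
next
  fix x y i j
  assume "x \<in> parts ps" "y \<in> parts ps" "i < length (part_word ps x)" "j < length (part_word ps y)"
    "part_map ps x i = part_map ps y j"
  then show "x = y" by (rule part_map_disjoint)
next
  fix x y i j i' j'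
  assume "x \<in> parts ps" "y \<in> parts ps" "x \<noteq> y" "i < j" "j < length (part_word ps x)" "i' < j'"
    "j' < length (part_word ps y)" "part_map ps x i < part_map ps y i'"
    "part_map ps y i' < part_map ps x j" "part_map ps x j < part_map ps y j'"
  then show False by (rule parts_not_interleaved)
qed (rule part_map_mono part_map_val; assumption)+

lemma part_arcs_cases:
  assumes "op_sequence (part_word ps x)" "\<alpha> \<in> part_arcs ps x"
  obtains c i j where "\<alpha> = (c, part_map ps x i, part_map ps x j)" "i < j" "j < length (part_word ps x)"
proof -
  obtain \<beta> where b: "\<beta> \<in> arcs (part_word ps x)" "\<alpha> = amap (part_map ps x) \<beta>"
    using assms(2) unfolding part_arcs_def by blast
  obtain c i j where "\<beta> = (c, i, j)" by (cases \<beta>)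
  then show thesis using that b matching_arch[OF op_sequence_matching[OF assms(1)]] by simp
qed

lemma part_arcs_no_cross:
  assumes "\<And>x. x \<in> parts ps \<Longrightarrow> op_sequence (part_word ps x)"
    and x: "x \<in> parts ps" and y: "y \<in> parts ps" and ne: "x \<noteq> y"
    and a: "\<alpha> \<in> part_arcs ps x" and b: "\<beta> \<in> part_arcs ps y"
  shows "\<not> arches_cross \<alpha> \<beta>"
proof -
  obtain c i j where 1: "\<alpha> = (c, part_map ps x i, part_map ps x j)" "i < j" "j < length (part_word ps x)"
    using part_arcs_cases[OF assms(1)[OF x] a] .
  obtain c' i' j' where 2: "\<beta> = (c', part_map ps y i', part_map ps y j')" "i' < j'" "j' < length (part_word ps y)"
    using part_arcs_cases[OF assms(1)[OF y] b] .
  show ?thesis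
    using parts_not_interleaved[OF x y ne 1(2,3) 2(2,3)] parts_not_interleaved[OF y x ne[symmetric] 2(2,3) 1(2,3)]
    unfolding 1(1) 2(1) arches_cross_def left_end_def right_end_def by auto
qed

lemma part_arcs_closed:
  assumes "\<And>x. x \<in> parts ps \<Longrightarrow> op_sequence (part_word ps x)" "x \<in> parts ps"
  shows "crossing_closed (\<Union>x\<in>parts ps. part_arcs ps x) (part_arcs ps x)"
  unfolding crossing_closed_def
  using part_arcs_no_cross[OF assms(1) assms(2)] assms(2) by blast

lemma standard_part_arcs:
  assumes "op_sequence (part_word ps x)" "x \<in> parts ps"
  shows "standard_arches (part_arcs ps x) \<longleftrightarrow> standard_arches (arcs (part_word ps x))"
    "connected_arches (part_arcs ps x) \<longleftrightarrow> connected_arches (arcs (part_word ps x))"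
proof -
  note m = op_sequence_matching[OF assms(1)]
  show "standard_arches (part_arcs ps x) \<longleftrightarrow> standard_arches (arcs (part_word ps x))"
    unfolding part_arcs_def
    by (rule standard_amap[OF matching_endpoints[OF m] part_map_mono[OF assms(2)] matching_left_inj[OF m]])
  show "connected_arches (part_arcs ps x) \<longleftrightarrow> connected_arches (arcs (part_word ps x))"
    unfolding part_arcs_def
    by (rule connected_amap[OF matching_endpoints[OF m] part_map_mono[OF assms(2)]])
qed

definition skeleton_range :: "('a \<times> 'a list) list \<Rightarrow> nat set" where
  "skeleton_range ps = pos ps ` {..<length ps}"

lemma skeleton_range_Nil [simp]: "skeleton_range [] = {}"
  by (simp add: skeleton_range_def)

lemma skeleton_range_snoc:
  "skeleton_range (ps @ [x]) = insert (length (assemble ps)) (skeleton_range ps)"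
proof -
  have "pos (ps @ [x]) k = pos ps k" if "k \<le> length ps" for k
    using that by (simp add: pos_def)
  then show ?thesis unfolding skeleton_range_def by (simp add: lessThan_Suc)
qed

lemma skeleton_range_bound:
  assumes "p \<in> skeleton_range ps"
  shows "p < length (assemble ps)"
proof -
  obtain k where "k < length ps" "p = pos ps k" using assms by (auto simp: skeleton_range_def)
  then show ?thesis using pos_less[of k "length ps" ps] by simp
qed

text \<open>The largest skeleton position is where the last block begins, so the last block can be
  split off on both sides.\<close>

lemma assemble_inj:
  assumes "assemble ps = assemble qs" "skeleton_range ps = skeleton_range qs"
  shows "ps = qs"
  using assms
proof (induction ps arbitrary: qs rule: rev_induct)
  case Nil
  then show ?case by (cases qs rule: rev_cases) (simp_all add: skeleton_range_snoc)
next
  case (snoc x ps)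
  obtain qs' y where qs: "qs = qs' @ [y]"
    using snoc.prems(2) by (cases qs rule: rev_cases) (simp_all add: skeleton_range_snoc)
  obtain s g s' g' where xy: "x = (s, g)" "y = (s', g')" by (metis surj_pair)
  have r: "insert (length (assemble ps)) (skeleton_range ps) = insert (length (assemble qs')) (skeleton_range qs')"
    using snoc.prems(2) unfolding qs skeleton_range_snoc .
  have b: "\<forall>p\<in>skeleton_range ps. p < length (assemble ps)" "\<forall>p\<in>skeleton_range qs'. p < length (assemble qs')"
    using skeleton_range_bound by blast+
  have len: "length (assemble ps) = length (assemble qs')"
  proof (rule antisym)
    have "length (assemble ps) \<in> insert (length (assemble qs')) (skeleton_range qs')" using r by blast
    then show "length (assemble ps) \<le> length (assemble qs')" using b(2) by auto
    have "length (assemble qs') \<in> insert (length (assemble ps)) (skeleton_range ps)" using r by blast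
    then show "length (assemble qs') \<le> length (assemble ps)" using b(1) by auto
  qed
  have "assemble ps = assemble qs' \<and> s # g = s' # g'"
    using snoc.prems(1) len unfolding qs xy by simp
  moreover have "skeleton_range ps = skeleton_range qs'"
  proof -
    have "length (assemble ps) \<notin> skeleton_range ps" "length (assemble ps) \<notin> skeleton_range qs'"
      using b len by auto
    from insert_ident[OF this] show ?thesis using r len by simp
  qed
  ultimately show ?case using snoc.IH qs xy by simp
qed

text \<open>Reading from the left, a letter at a position in \<open>M\<close> opens a block and any
  other letter extends the last gap. Position 0 must be in \<open>M\<close> because no gap precedes
  the first skeleton letter.\<close>

lemma assemble_exists:
  assumes "w \<noteq> []" "0 \<in> M"
  shows "\<exists>ps. assemble ps = w \<and> skeleton_range ps = M \<inter> {..<length w}"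
  using assms(1)
proof (induction w rule: rev_induct)
  case (snoc x w)
  show ?case
  proof (cases "w = []")
    case True
    have "M \<inter> {..<Suc 0} = {0}" using assms(2) by auto
    then show ?thesis using True skeleton_range_snoc[of "[]" "(x, [])"]
      by (intro exI[of _ "[(x, [])]"]) simp
  next
    case False
    then obtain ps where ps: "assemble ps = w" "skeleton_range ps = M \<inter> {..<length w}"
      using snoc.IH by blast
    show ?thesis
    proof (cases "length w \<in> M")
      case True
      then have "M \<inter> {..<Suc (length w)} = insert (length w) (M \<inter> {..<length w})"
        unfolding lessThan_Suc by simp
      then show ?thesis using ps
        by (intro exI[of _ "ps @ [(x, [])]"]) (simp add: skeleton_range_snoc)
    next
      case notin: False
      have "ps \<noteq> []" using ps(1) False by auto
      then obtain qs s g where qs: "ps = qs @ [(s, g)]" by (metis rev_exhaust surj_pair)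
      have "skeleton_range (qs @ [(s, g @ [x])]) = skeleton_range ps"
        by (simp add: skeleton_range_snoc qs)
      moreover have "M \<inter> {..<length (w @ [x])} = M \<inter> {..<length w}"
        using notin by (simp add: lessThan_Suc)
      ultimately show ?thesis using ps[unfolded qs] unfolding qs
        by (intro exI[of _ "qs @ [(s, g @ [x])]"]) simp
    qed
  qed
qed simp

section \<open>Bijection between decompositions and non-empty operation sequences\<close>

definition decomposition :: "(operation \<times> operation list) list \<Rightarrow> bool" where
  "decomposition ps \<longleftrightarrow> op_sequence (map fst ps) \<and> connected_arches (arcs (map fst ps)) \<and>
     (\<forall>g\<in>snd ` set ps. op_sequence g)"

lemma parts_cases: "(\<forall>x\<in>parts ps. P (part_word ps x)) \<longleftrightarrow> P (map fst ps) \<and> (\<forall>g\<in>snd ` set ps. P g)"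
proof -
  have gaps: "(\<forall>g\<in>snd ` set ps. P g) \<longleftrightarrow> (\<forall>k<length ps. P (snd (ps ! k)))"
    by (simp add: all_set_conv_all_nth)
  have "(\<forall>x\<in>parts ps. Q x) \<longleftrightarrow> Q None \<and> (\<forall>k<length ps. Q (Some k))" for Q
    unfolding parts_def by blast
  then show ?thesis unfolding gaps by simp
qed

lemma decomposition_parts:
  "decomposition ps \<Longrightarrow> x \<in> parts ps \<Longrightarrow> op_sequence (part_word ps x)"
  using parts_cases[of ps op_sequence] unfolding decomposition_def by blast

lemma arcs_assemble:
  assumes "decomposition ps"
  shows "arcs (assemble ps) = (\<Union>x\<in>parts ps. part_arcs ps x)"
  by (rule arcs_eqI[OF assemble_matching[OF decomposition_parts[OF assms]]])

lemma op_sequence_assemble: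
  assumes "decomposition ps"
  shows "op_sequence (assemble ps)"
  by (rule matching_imp_op_sequence[OF assemble_matching[OF decomposition_parts[OF assms]]])

lemma decomposition_nonempty:
  assumes "decomposition ps"
  shows "ps \<noteq> []"
proof
  assume "ps = []"
  then have "arcs (map fst ps) = {}" by (simp add: arcs_def)
  then show False using assms by (simp add: decomposition_def connected_arches_def)
qed

lemma first_arch:
  assumes "matching w A" "w \<noteq> []"
  obtains c j where "(c, 0, j) \<in> A"
proof -
  obtain c i j where *: "(c, i, j) \<in> A" "0 = i \<or> 0 = j"
    using matching_cover[OF assms(1), of 0] assms(2) by blast
  then have "i = 0" using matching_arch(1)[OF assms(1) *(1)] by simp
  then show thesis using * that by blast
qed

definition arch_ends :: "arch set \<Rightarrow> nat set" where
  "arch_ends K = left_end ` K \<union> right_end ` K"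

definition first_component :: "operation list \<Rightarrow> arch set" where
  "first_component w = component (arcs w) (THE \<alpha>. \<alpha> \<in> arcs w \<and> left_end \<alpha> = 0)"

lemma first_component_eq:
  assumes "op_sequence w" "\<alpha> \<in> arcs w" "left_end \<alpha> = 0"
  shows "first_component w = component (arcs w) \<alpha>"
proof -
  have "(THE \<alpha>. \<alpha> \<in> arcs w \<and> left_end \<alpha> = 0) = \<alpha>"
    using assms(2,3) inj_onD[OF matching_left_inj[OF op_sequence_matching[OF assms(1)]]]
    by (intro the_equality) simp_all
  then show ?thesis by (simp add: first_component_def)
qed

text \<open>The skeleton is connected, crosses no gap and contains position 0, so it is recovered
  from the assembled word as the component of the arch at 0.\<close>

lemma first_component_assemble:
  assumes d: "decomposition ps"
  shows "first_component (assemble ps) = part_arcs ps None"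
proof -
  have None: "None \<in> parts ps" by (simp add: parts_def)
  have K: "op_sequence (map fst ps)" "connected_arches (arcs (map fst ps))"
    using d by (simp_all add: decomposition_def)
  obtain c j where "(c, 0, j) \<in> arcs (map fst ps)"
    using first_arch[OF op_sequence_matching[OF K(1)]] decomposition_nonempty[OF d] by auto
  then have 0: "(c, 0, pos ps j) \<in> part_arcs ps None"
    unfolding part_arcs_def by (auto intro!: image_eqI[of _ _ "(c, 0, j)"])
  have "connected_arches (part_arcs ps None)"
    using standard_part_arcs(2)[of ps None] K None by simp
  moreover have "crossing_closed (arcs (assemble ps)) (part_arcs ps None)"
    unfolding arcs_assemble[OF d] using part_arcs_closed[OF decomposition_parts[OF d] None] by blast
  ultimately have "component (arcs (assemble ps)) (c, 0, pos ps j) = part_arcs ps None"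
    using connected_imp_comp 0 by blast
  moreover have "(c, 0, pos ps j) \<in> arcs (assemble ps)"
    unfolding arcs_assemble[OF d] using 0 None by blast
  ultimately show ?thesis
    using first_component_eq[OF op_sequence_assemble[OF d], of "(c, 0, pos ps j)"]
    by (simp add: left_end_def)
qed

lemma arch_ends_matching:
  assumes "matching w A"
  shows "arch_ends A = {..<length w}"
proof
  show "arch_ends A \<subseteq> {..<length w}"
    using matching_endpoints[OF assms] by (auto simp: arch_ends_def endpoints_in_def)
  show "{..<length w} \<subseteq> arch_ends A"
  proof
    fix p assume "p \<in> {..<length w}"
    then obtain c i j where "(c, i, j) \<in> A" "p = i \<or> p = j" using matching_cover[OF assms] by blast
    then show "p \<in> arch_ends A" unfolding arch_ends_def left_end_def right_end_def by force
  qed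
qed

lemma arch_ends_amap: "arch_ends (amap f ` A) = f ` arch_ends A"
  by (simp add: arch_ends_def image_Un image_image)

lemma skeleton_range_assemble:
  assumes "decomposition ps"
  shows "arch_ends (first_component (assemble ps)) = skeleton_range ps"
proof -
  have "arch_ends (part_arcs ps None) = part_map ps None ` {..<length ps}"
    unfolding part_arcs_def arch_ends_amap
    using arch_ends_matching[OF op_sequence_matching, of "map fst ps"] assms by (simp add: decomposition_def)
  also have "\<dots> = skeleton_range ps" by (simp add: skeleton_range_def)
  finally show ?thesis by (simp only: first_component_assemble[OF assms])
qed

text \<open>The word determines its first component, the endpoints of this component are the
  skeleton positions, and these fix the cut.\<close>

lemma inj_on_assemble: "inj_on assemble {ps. decomposition ps}"
  by (rule inj_onI) (metis assemble_inj skeleton_range_assemble mem_Collect_eq)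

lemma interleaved_imp_cross:
  assumes m: "matching w A" and a: "(c, i, j) \<in> A" "(c', i', j') \<in> A" and "i < i'" "i' < j" "j < j'"
  shows "arches_cross (c, i, j) (c', i', j')"
proof -
  have "c \<noteq> c'"
  proof
    assume "c = c'"
    then have "j' < j" using matching_noncrossing[OF m] assms by blast
    then show False using \<open>j < j'\<close> by simp
  qed
  then show ?thesis using assms by (simp add: arches_cross_def arch_colour_def left_end_def right_end_def)
qed

lemma part_map_None: "part_map ps None = pos ps"
  by (rule ext) simp

text \<open>Having no endpoint inside an arch outside the component propagates along crossings, because
  no arch of the component is interleaved with that arch.\<close>

lemma component_outside:
  assumes m: "matching w A" and b: "(c, i, j) \<in> A" and \<alpha>: "\<alpha> \<in> A" "left_end \<alpha> < i"
    and nb: "(c, i, j) \<notin> component A \<alpha>" and g: "\<gamma> \<in> component A \<alpha>"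
  shows "left_end \<gamma> \<notin> {i<..<j} \<and> right_end \<gamma> \<notin> {i<..<j}"
proof -
  have both: "left_end \<gamma> \<in> {i<..<j} \<longleftrightarrow> right_end \<gamma> \<in> {i<..<j}" if "\<gamma> \<in> component A \<alpha>" for \<gamma>
  proof -
    obtain c' i' j' where g: "\<gamma> = (c', i', j')" by (cases \<gamma>)
    have gA: "(c', i', j') \<in> A" and gc: "(c', i', j') \<in> component A \<alpha>" using that comp_subset g by blast+
    have nc: "\<not> arches_cross (c', i', j') (c, i, j)"
      using gc nb b crossing_closed_comp[of A \<alpha>] unfolding crossing_closed_def by blast
    have ne: "i' \<noteq> i" "j' \<noteq> j"
      using matching_left_unique[OF m gA, of c j] matching_right_unique[OF m gA, of c i] b gc nb by blast+
    have ne': "i' \<noteq> j" "i \<noteq> j'"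
      using matching_left_right[OF m gA b] matching_left_right[OF m b gA] by simp_all
    have "\<not> (i' < i \<and> i < j' \<and> j' < j)"
      using interleaved_imp_cross[OF m gA b] nc by blast
    moreover have "\<not> (i < i' \<and> i' < j \<and> j < j')"
      using interleaved_imp_cross[OF m b gA] nc arches_cross_sym by blast
    ultimately show ?thesis
      using ne ne' matching_arch(1)[OF m gA] matching_arch(1)[OF m b] g
      by (auto simp: left_end_def right_end_def)
  qed
  have "(\<alpha>, \<gamma>) \<in> (crossing_graph A)\<^sup>*" using g by (simp add: component_def)
  then have "left_end \<gamma> \<notin> {i<..<j}"
  proof (induction rule: rtrancl_induct)
    case base
    then show ?case using \<alpha> by simp
  next
    case (step \<beta> \<gamma>)
    have bc: "\<beta> \<in> component A \<alpha>" and gc: "\<gamma> \<in> component A \<alpha>"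
      using step(1,2) by (auto simp: component_def crossing_graph_def intro: rtrancl.rtrancl_into_rtrancl)
    have "arches_cross \<beta> \<gamma>" using step(2) by (simp add: crossing_graph_def)
    then show ?case
      using both[OF bc] both[OF gc] step.IH unfolding arches_cross_def by auto
  qed
  then show ?thesis using both[OF g] by blast
qed

text \<open>The skeleton consists of the letters at the endpoints \<open>M\<close> of the component
  \<open>K\<close> of the first arch. It remains to see that the skeleton and each gap are closed
  under taking partners, so that \<open>matching_restrict\<close> applies to all of them.\<close>

lemma decomposition_exists:
  assumes w: "op_sequence w" "w \<noteq> []"
  shows "\<exists>ps. decomposition ps \<and> assemble ps = w"
proof -
  define A where "A = arcs w"
  have m: "matching w A" unfolding A_def by (rule op_sequence_matching[OF w(1)])
  obtain c0 j0 where a0: "(c0, 0, j0) \<in> A" using first_arch[OF m w(2)] .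
  define K where "K = component A (c0, 0, j0)"
  have KA: "K \<subseteq> A" and a0K: "(c0, 0, j0) \<in> K"
    unfolding K_def using comp_subset self_in_comp[OF a0] by blast+
  define M where "M = arch_ends K"
  have "0 \<in> M" unfolding M_def arch_ends_def left_end_def using a0K by force
  then obtain ps where ps: "assemble ps = w" and r: "skeleton_range ps = M \<inter> {..<length w}"
    using assemble_exists[OF w(2)] by blast
  have "M \<subseteq> {..<length w}"
    unfolding M_def using KA arch_ends_matching[OF m] unfolding arch_ends_def by blast
  then have M: "pos ps ` {..<length ps} = M" using r by (auto simp: skeleton_range_def)
  \<comment> \<open>A point is an endpoint of only one arch, so an arch with one endpoint in
    \<open>M\<close> is an arch of \<open>K\<close>.\<close>
  have MK: "(c, i, j) \<in> K" if "(c, i, j) \<in> A" "i \<in> M \<or> j \<in> M" for c i j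
  proof -
    have "\<exists>c' i' j'. (c', i', j') \<in> K \<and> (i = i' \<or> i = j' \<or> j = i' \<or> j = j')"
      using that(2) unfolding M_def arch_ends_def left_end_def right_end_def by force
    then obtain c' i' j' where k: "(c', i', j') \<in> K" "i = i' \<or> i = j' \<or> j = i' \<or> j = j'" by blast
    then have kA: "(c', i', j') \<in> A" using KA by blast
    have "i = i' \<or> j = j'"
      using k(2) matching_left_right[OF m that(1) kA] matching_left_right[OF m kA that(1)] by auto
    then have "(c, i, j) = (c', i', j')"
    proof
      assume "i = i'"
      then show ?thesis using matching_left_unique[OF m that(1)] kA by blast
    next
      assume "j = j'"
      then show ?thesis using matching_right_unique[OF m that(1)] kA by blast
    qed
    then show ?thesis using k by simp
  qed
  have KM: "i \<in> M \<and> j \<in> M" if "(c, i, j) \<in> K" for c i j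
    using that unfolding M_def arch_ends_def left_end_def right_end_def by force
  have None: "None \<in> parts ps" by (simp add: parts_def)
  have skel: "op_sequence (map fst ps)"
    "amap (pos ps) ` arcs (map fst ps) = {\<alpha> \<in> A. left_end \<alpha> \<in> pos ps ` {..<length (map fst ps)}}"
  proof -
    have mono: "strict_mono_on {..<length (map fst ps)} (pos ps)" using pos_strict_mono[of ps] by simp
    have val: "pos ps i < length w \<and> w ! pos ps i = map fst ps ! i" if "i < length (map fst ps)" for i
      using part_map_val[OF None, of i] that ps by simp
    have cl: "i \<in> pos ps ` {..<length (map fst ps)} \<longleftrightarrow> j \<in> pos ps ` {..<length (map fst ps)}"
      if "(c, i, j) \<in> A" for c i j
    proof -
      have "i \<in> M \<longleftrightarrow> j \<in> M" using MK[OF that] KM[of c i j] by blast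
      then show ?thesis using M by simp
    qed
    show "op_sequence (map fst ps)" by (rule matching_restrict(1)[OF m mono val cl])
    show "amap (pos ps) ` arcs (map fst ps) = {\<alpha> \<in> A. left_end \<alpha> \<in> pos ps ` {..<length (map fst ps)}}"
      by (rule matching_restrict(2)[OF m mono val cl])
  qed
  have "{\<alpha> \<in> A. left_end \<alpha> \<in> pos ps ` {..<length (map fst ps)}} = K"
  proof (intro equalityI subsetI)
    fix \<alpha> assume a: "\<alpha> \<in> {\<alpha> \<in> A. left_end \<alpha> \<in> pos ps ` {..<length (map fst ps)}}"
    obtain c i j where "\<alpha> = (c, i, j)" by (cases \<alpha>)
    then show "\<alpha> \<in> K" using a MK[of c i j] M by (simp add: left_end_def)
  next
    fix \<alpha> assume a: "\<alpha> \<in> K"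
    obtain c i j where "\<alpha> = (c, i, j)" by (cases \<alpha>)
    then show "\<alpha> \<in> {\<alpha> \<in> A. left_end \<alpha> \<in> pos ps ` {..<length (map fst ps)}}"
      using a KM[of c i j] M KA by (auto simp: left_end_def)
  qed
  then have "connected_arches (amap (pos ps) ` arcs (map fst ps))"
    using skel(2) connected_comp[OF a0] K_def by simp
  then have conn: "connected_arches (arcs (map fst ps))"
    using standard_part_arcs(2)[of ps None] skel(1) None
    by (simp add: part_arcs_def part_map_None)
  have "op_sequence g" if "g \<in> snd ` set ps" for g
  proof -
    obtain k where k: "k < length ps" "g = snd (ps ! k)" using \<open>g \<in> snd ` set ps\<close> by (auto simp: set_conv_nth)
    define f where "f = part_map ps (Some k)"
    have Some: "Some k \<in> parts ps" using k by (simp add: parts_def)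
    have range: "f ` {..<length g} = {pos ps k<..<pos ps (Suc k)}"
    proof (intro equalityI subsetI)
      fix p assume "p \<in> f ` {..<length g}"
      then show "p \<in> {pos ps k<..<pos ps (Suc k)}" using gap_bounds[OF k(1)] k(2) by (auto simp: f_def)
    next
      fix p assume "p \<in> {pos ps k<..<pos ps (Suc k)}"
      then have "p = f (p - Suc (pos ps k))" "p - Suc (pos ps k) < length g"
        using pos_Suc[OF k(1)] k(2) by (auto simp: f_def)
      then show "p \<in> f ` {..<length g}" by blast
    qed
    have disj: "p \<notin> M" if "p \<in> {pos ps k<..<pos ps (Suc k)}" for p
    proof
      assume "p \<in> M"
      then obtain m where "m < length ps" "p = pos ps m" using M by blast
      then show False using skeleton_not_inside[OF k(1), of m] that by auto
    qed
    \<comment> \<open>No arch outside \<open>K\<close> passes over a point of \<open>M\<close>: the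
      first arch starts to its left, so \<open>component_outside\<close> keeps all endpoints of
      \<open>K\<close> out of its interior.\<close>
    have no_between: "False" if a: "(c, i, j) \<in> A" "i < p" "p < j" "p \<in> M" "i \<notin> M" for c i j p
    proof -
      have "0 < i" using \<open>0 \<in> M\<close> \<open>i \<notin> M\<close> by (cases i) auto
      then have "left_end (c0, 0, j0) < i" by (simp add: left_end_def)
      moreover have "(c, i, j) \<notin> component A (c0, 0, j0)" using KM a(5) K_def by blast
      ultimately have "left_end \<gamma> \<notin> {i<..<j} \<and> right_end \<gamma> \<notin> {i<..<j}" if "\<gamma> \<in> K" for \<gamma>
        using component_outside[OF m a(1) a0] that K_def by blast
      note out = this
      obtain \<gamma> where g: "\<gamma> \<in> K" "p = left_end \<gamma> \<or> p = right_end \<gamma>"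
        using a(4) unfolding M_def arch_ends_def by blast
      from out[OF g(1)] show False using a(2,3) g(2) by auto
    qed
    have cl: "i \<in> f ` {..<length g} \<longleftrightarrow> j \<in> f ` {..<length g}" if a: "(c, i, j) \<in> A" for c i j
    proof (rule iffI)
      assume i: "i \<in> f ` {..<length g}"
      then have iM: "i \<notin> M" using disj range by blast
      then have jM: "j \<notin> M" using MK[OF a] KM by blast
      show "j \<in> f ` {..<length g}"
      proof (rule ccontr)
        assume "j \<notin> f ` {..<length g}"
        \<comment> \<open>Leaving the gap to the right means passing over the next skeleton letter.
          For the last gap there is none, but then \<open>pos ps (Suc k)\<close> is the length of
          \<open>w\<close> and \<open>j\<close> would lie beyond the word.\<close>
        then have j: "pos ps (Suc k) \<le> j" using range i matching_arch(1)[OF m a] by auto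
        moreover have "j < length w" by (rule matching_arch(2)[OF m a])
        ultimately have "pos ps (Suc k) < length w" by simp
        then have "Suc k \<noteq> length ps" using ps pos_length[of ps] by (metis less_irrefl)
        then have p: "pos ps (Suc k) \<in> M" using k(1) by (simp flip: M)
        then have "pos ps (Suc k) < j" using j jM by (metis le_neq_implies_less)
        moreover have "i < pos ps (Suc k)" using i range by auto
        ultimately show False using no_between[OF a _ _ p iM] by blast
      qed
    next
      assume j: "j \<in> f ` {..<length g}"
      then have jM: "j \<notin> M" using disj range by blast
      then have iM: "i \<notin> M" using MK[OF a] KM by blast
      show "i \<in> f ` {..<length g}"
      proof (rule ccontr)
        assume "i \<notin> f ` {..<length g}"
        then have i: "i \<le> pos ps k" using range j matching_arch(1)[OF m a] by auto
        have p: "pos ps k \<in> M" using k(1) by (simp flip: M)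
        then have "i < pos ps k" using i iM by (metis le_neq_implies_less)
        moreover have "pos ps k < j" using j range by auto
        ultimately show False using no_between[OF a _ _ p iM] by blast
      qed
    qed
    have mono: "strict_mono_on {..<length g} f"
      using part_map_mono[OF Some] k(2) by (simp add: f_def)
    have val: "f i < length w \<and> w ! f i = g ! i" if "i < length g" for i
      using part_map_val[OF Some, of i] that ps k(2) by (simp add: f_def)
    show "op_sequence g" by (rule matching_restrict(1)[OF m mono val cl])
  qed
  then have "decomposition ps" using skel(1) conn by (simp add: decomposition_def)
  then show ?thesis using ps by blast
qed

lemma bij_betw_assemble: "bij_betw assemble {ps. decomposition ps} {w. op_sequence w \<and> w \<noteq> []}"
  unfolding bij_betw_def
proof (intro conjI inj_on_assemble equalityI subsetI)
  fix w assume "w \<in> assemble ` {ps. decomposition ps}"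
  then obtain ps where ps: "decomposition ps" "w = assemble ps" by blast
  have "assemble ps \<noteq> []" using decomposition_nonempty[OF ps(1)] by (cases ps) auto
  then show "w \<in> {w. op_sequence w \<and> w \<noteq> []}" using ps op_sequence_assemble by simp
next
  fix w assume "w \<in> {w. op_sequence w \<and> w \<noteq> []}"
  then show "w \<in> assemble ` {ps. decomposition ps}" using decomposition_exists[of w] by blast
qed

lemma standard_connected:
  assumes w: "op_sequence w" "connected_arches (arcs w)"
  shows "standard_arches (arcs w) \<longleftrightarrow> w ! 0 = Push Red"
proof -
  note m = op_sequence_matching[OF w(1)]
  have "w \<noteq> []" using w(2) by (auto simp: connected_arches_def arcs_def)
  then obtain c j where a: "(c, 0, j) \<in> arcs w" using first_arch[OF m] by blast
  have "arg_min_on left_end (arcs w) = (c, 0, j)"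
    by (rule arg_min_on_eqI[OF a _ matching_left_inj[OF m]]) (simp add: left_end_def)
  then have "standard_arches (arcs w) \<longleftrightarrow> c = Red"
    using w(2) unfolding standard_arches_iff connected_arches_iff by (auto simp: arch_colour_def)
  then show ?thesis using matching_arch(4)[OF m a] by simp
qed

text \<open>The components of the whole are those of the parts. The connected skeleton contributes
  one component, whose first arch starts at position 0.\<close>

lemma standard_assemble:
  assumes d: "decomposition ps"
  shows "standard_arches (arcs (assemble ps)) \<longleftrightarrow>
    fst (ps ! 0) = Push Red \<and> (\<forall>g\<in>snd ` set ps. standard_arches (arcs g))"
proof -
  have "standard_arches (arcs (assemble ps)) \<longleftrightarrow> (\<forall>x\<in>parts ps. standard_arches (part_arcs ps x))"
    unfolding arcs_assemble[OF d]
    by (rule standard_arches_Union[OF refl part_arcs_closed[OF decomposition_parts[OF d]]])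
  also have "\<dots> \<longleftrightarrow> (\<forall>x\<in>parts ps. standard_arches (arcs (part_word ps x)))"
    using standard_part_arcs(1)[OF decomposition_parts[OF d]] by simp
  also have "\<dots> \<longleftrightarrow> standard_arches (arcs (map fst ps)) \<and> (\<forall>g\<in>snd ` set ps. standard_arches (arcs g))"
    by (rule parts_cases)
  also have "standard_arches (arcs (map fst ps)) \<longleftrightarrow> fst (ps ! 0) = Push Red"
    using standard_connected[of "map fst ps"] d decomposition_nonempty[OF d] by (simp add: decomposition_def)
  finally show ?thesis .
qed

section \<open>Canonical operation sequences\<close>

text \<open>The common form of left-right pairs and of corners, recursive so that it can be
  evaluated along a concatenation.\<close>

fun adj_count :: "('a \<Rightarrow> 'a \<Rightarrow> bool) \<Rightarrow> 'a list \<Rightarrow> nat" where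
  "adj_count R (x # y # w) = (if R x y then 1 else 0) + adj_count R (y # w)"
| "adj_count R _ = 0"

lemma adj_count_append:
  "adj_count R (u @ v) = adj_count R u + adj_count R v +
     (if u \<noteq> [] \<and> v \<noteq> [] \<and> R (last u) (hd v) then 1 else 0)"
proof (induction R u rule: adj_count.induct)
  case ("2_2" R x)
  then show ?case by (cases v) simp_all
qed simp_all

lemma adj_count_map: "adj_count R (map f w) = adj_count (\<lambda>x y. R (f x) (f y)) w"
  by (induction "\<lambda>x y. R (f x) (f y)" w rule: adj_count.induct) simp_all

lemma adj_count_card: "adj_count R w = card {i. Suc i < length w \<and> R (w ! i) (w ! Suc i)}"
proof (induction R w rule: adj_count.induct)
  case (1 R x y w)
  let ?S = "{i. Suc i < length (y # w) \<and> R ((y # w) ! i) ((y # w) ! Suc i)}"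
  have fin: "finite ?S" by (rule finite_subset[of _ "{..<length (y # w)}"]) auto
  have "{i. Suc i < length (x # y # w) \<and> R ((x # y # w) ! i) ((x # y # w) ! Suc i)}
      = (if R x y then {0} else {}) \<union> Suc ` ?S" (is "?L = ?R")
  proof (rule set_eqI)
    show "i \<in> ?L \<longleftrightarrow> i \<in> ?R" for i by (cases i) auto
  qed
  moreover have "card ((if R x y then {0} else {}) \<union> Suc ` ?S) = (if R x y then 1 else 0) + card ?S"
    using fin by (subst card_Un_disjoint) (auto simp: card_image)
  ultimately show ?case using 1 by simp
qed simp_all

fun left_right :: "operation \<Rightarrow> operation \<Rightarrow> bool" where
  "left_right (Push c) (Pop d) = (c \<noteq> d)"
| "left_right _ _ = False"

abbreviation lr_count :: "operation list \<Rightarrow> nat" where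
  "lr_count \<equiv> adj_count left_right"

lemma left_right_iff: "left_right x y \<longleftrightarrow> (\<exists>c d. x = Push c \<and> y = Pop d \<and> c \<noteq> d)"
  by (cases x; cases y) simp_all

text \<open>Every letter is an endpoint of an arch of its own colour, so a left-right pair is
  visible in two adjacent letters.\<close>

lemma left_right_pairs_arch_system_of:
  assumes w: "op_sequence w"
  shows "left_right_pairs (arch_system_of w) = lr_count w"
proof -
  note m = op_sequence_matching[OF w]
  have "{p. \<exists>\<alpha>\<in>arch_system_of w. \<exists>\<beta>\<in>arch_system_of w.
       left_end \<alpha> = p \<and> right_end \<beta> = Suc p \<and> arch_colour \<alpha> \<noteq> arch_colour \<beta>}
     = Suc ` {i. Suc i < length w \<and> left_right (w ! i) (w ! Suc i)}" (is "?L = ?R")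
  proof (intro equalityI subsetI)
    fix p assume "p \<in> ?L"
    then obtain \<alpha> \<beta> where ab: "\<alpha> \<in> arcs w" "\<beta> \<in> arcs w" "Suc (left_end \<alpha>) = p"
      "Suc (right_end \<beta>) = Suc p" "arch_colour \<alpha> \<noteq> arch_colour \<beta>"
      unfolding arch_system_of_arcs by auto
    obtain c i j c' i' j' where *: "\<alpha> = (c, i, j)" "\<beta> = (c', i', j')" by (metis prod_cases3)
    have "p = Suc i" "j' = Suc i" "c \<noteq> c'"
      using ab(3-5) unfolding * by (simp_all add: left_end_def right_end_def arch_colour_def)
    then show "p \<in> ?R"
      using matching_arch[OF m ab(1)[unfolded *]] matching_arch[OF m ab(2)[unfolded *]] by simp
  next
    fix p assume "p \<in> ?R"
    then obtain i where i: "p = Suc i" "Suc i < length w" "left_right (w ! i) (w ! Suc i)" by blast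
    then obtain c d where cd: "w ! i = Push c" "w ! Suc i = Pop d" "c \<noteq> d" by (auto simp: left_right_iff)
    obtain j where j: "(c, i, j) \<in> arcs w" using matching_push[OF m _ cd(1)] i(2) by auto
    obtain k where k: "(d, k, Suc i) \<in> arcs w" using matching_pop[OF m i(2) cd(2)] by blast
    have "amap Suc (c, i, j) \<in> arch_system_of w" "amap Suc (d, k, Suc i) \<in> arch_system_of w"
      unfolding arch_system_of_arcs using j k by blast+
    then have "(c, p, Suc j) \<in> arch_system_of w" "(d, Suc k, Suc p) \<in> arch_system_of w"
      using i(1) by simp_all
    then show "p \<in> ?L" using cd(3) by (force simp: left_end_def right_end_def arch_colour_def)
  qed
  then show ?thesis
    unfolding left_right_pairs_def adj_count_card by (simp add: card_image)
qed

section \<open>The permutation produced by an operation sequence\<close>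

abbreviation pushes :: "operation list \<Rightarrow> nat" where
  "pushes w \<equiv> length (filter is_push w)"

abbreviation pops :: "operation list \<Rightarrow> nat" where
  "pops w \<equiv> length (filter (\<lambda>x. \<not> is_push x) w)"

lemma pushes_count: "pushes w = count_list w (Push Red) + count_list w (Push Blue)"
proof (induction w)
  case (Cons x w)
  show ?case
  proof (cases x)
    case (Push c)
    then show ?thesis using Cons by (cases c) simp_all
  next
    case (Pop c)
    then show ?thesis using Cons by (cases c) simp_all
  qed
qed simp

lemma pops_count: "pops w = count_list w (Pop Red) + count_list w (Pop Blue)"
proof (induction w)
  case (Cons x w)
  show ?case
  proof (cases x)
    case (Push c)
    then show ?thesis using Cons by (cases c) simp_all
  next
    case (Pop c)
    then show ?thesis using Cons by (cases c) simp_all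
  qed
qed simp

lemma op_sequence_pushes_pops:
  assumes "op_sequence w"
  shows "pops w = pushes w" "length w = 2 * pushes w"
proof -
  show "pops w = pushes w"
    using assms unfolding op_sequence_def pushes_count pops_count by simp
  then show "length w = 2 * pushes w" using sum_length_filter_compl[of is_push w] by simp
qed

lemma produced_eq:
  "produced w = map (moved_item w) (filter (\<lambda>j. \<not> is_push (w ! j)) [0..<length w])"
proof (induction w rule: rev_induct)
  case Nil
  then show ?case by (simp add: produced_def)
next
  case (snoc x w)
  have 1: "map (moved_item (w @ [x])) (filter (\<lambda>j. \<not> is_push ((w @ [x]) ! j)) [0..<length w])
    = map (moved_item w) (filter (\<lambda>j. \<not> is_push (w ! j)) [0..<length w])"
    by (rule map_cong) (auto simp: nth_append intro!: filter_cong)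
  obtain k st out where ex: "exec w = (k, st, out)" by (metis prod_cases3)
  then have 2: "produced (w @ [x]) = produced w @ (case x of Push c \<Rightarrow> [] | Pop c \<Rightarrow> [hd (st c)])"
    by (cases x) (simp_all add: produced_def)
  show ?case
    using ex 1 2 snoc.IH by (cases x) simp_all
qed

lemma produced_length: "length (produced w) = pops w"
proof (induction w rule: rev_induct)
  case Nil
  then show ?case by (simp add: produced_def)
next
  case (snoc x w)
  then show ?case by (cases x; cases "exec w") (simp_all add: produced_def)
qed

lemma produced_nth:
  "j < length w \<Longrightarrow> \<not> is_push (w ! j) \<Longrightarrow> produced w ! pops (take j w) = moved_item w j"
proof (induction w rule: rev_induct)
  case (snoc x w)
  obtain k st out where ex: "exec w = (k, st, out)" by (metis prod_cases3)
  then have p: "produced (w @ [x]) = produced w @ (case x of Push c \<Rightarrow> [] | Pop c \<Rightarrow> [hd (st c)])"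
    by (cases x) (simp_all add: produced_def)
  show ?case
  proof (cases "j < length w")
    case True
    then have np: "\<not> is_push (w ! j)" using snoc.prems by (simp add: nth_append)
    have "w = take j w @ w ! j # drop (Suc j) w" using True by (rule id_take_nth_drop)
    then have "pops w = pops (take j w @ w ! j # drop (Suc j) w)" by simp
    then have "pops (take j w) < pops w" using np by simp
    then show ?thesis using snoc.IH[OF True np] True p produced_length[of w] by (simp add: nth_append)
  next
    case False
    then have j: "j = length w" using snoc.prems by simp
    then obtain c where "x = Pop c" using snoc.prems(2) by (cases x) simp_all
    then show ?thesis using p j ex by (simp add: nth_append flip: produced_length)
  qed
qed simp

text \<open>The item is the rank of its push among all pushes. Hence it depends only on the push-pop
  shape and the uncoloured arch, which is how the outputs of differently coloured words are
  compared.\<close>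

lemma moved_item_arc:
  assumes "op_sequence w" "(c, i, j) \<in> arcs w"
  shows "moved_item w i = moved_item w j" "moved_item w j = Suc (pushes (take i w))"
  using assms(2) moved_item_push[of w i c] by (auto simp: arcs_def)

lemma pushes_take_less:
  assumes "i < j" "i < length w" "is_push (w ! i)"
  shows "pushes (take i w) < pushes (take j w)"
proof -
  have "take (Suc i) w = take i w @ [w ! i]" using assms(2) by (rule take_Suc_conv_app_nth)
  moreover obtain v where "take j w = take (Suc i) w @ v"
    using assms(1) by (metis Suc_leI le_add_diff_inverse take_add)
  ultimately show ?thesis using assms(3) by simp
qed

lemma produced_permutation:
  assumes w: "op_sequence w"
  shows "produced w \<in> permutations_of_set {1..pushes w}"
proof -
  note m = op_sequence_matching[OF w] and ok = op_sequence_prefix_ok[OF w]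
  have d: "distinct (produced w)"
    unfolding produced_eq distinct_map
    using moved_item_pop_inj[OF ok] by (auto intro!: inj_onI)
  have "set (produced w) \<subseteq> {1..pushes w}"
  proof
    fix x assume "x \<in> set (produced w)"
    then obtain j where j: "j < length w" "\<not> is_push (w ! j)" "x = moved_item w j"
      unfolding produced_eq by auto
    then obtain c where "w ! j = Pop c" by (cases "w ! j") auto
    then obtain i where i: "(c, i, j) \<in> arcs w" using matching_pop[OF m j(1)] by blast
    note ar = matching_arch[OF m i]
    have "pushes (take i w) < pushes (take (length w) w)"
      using ar by (intro pushes_take_less) simp_all
    then show "x \<in> {1..pushes w}" using moved_item_arc[OF w i] j(3) by simp
  qed
  moreover have "card (set (produced w)) = card {1..pushes w}"
    using distinct_card[OF d] produced_length op_sequence_pushes_pops[OF w] by simp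
  ultimately have "set (produced w) = {1..pushes w}" by (intro card_subset_eq) simp_all
  then show ?thesis using d by (simp add: permutations_of_set_def)
qed

lemma stack_perms_eq: "stack_perms n = produced ` {w. op_sequence w \<and> pushes w = n}"
proof (intro equalityI subsetI)
  fix p assume "p \<in> stack_perms n"
  then obtain w where w: "p \<in> permutations_of_set {1..n}" "op_sequence w" "produced w = p"
    unfolding stack_perms_def by blast
  have "length p = n" using w(1) by (auto simp: permutations_of_set_def dest: distinct_card)
  then have "pushes w = n" using produced_length[of w] op_sequence_pushes_pops[OF w(2)] w(3) by simp
  then show "p \<in> produced ` {w. op_sequence w \<and> pushes w = n}" using w by blast
next
  fix p assume "p \<in> produced ` {w. op_sequence w \<and> pushes w = n}"
  then show "p \<in> stack_perms n" unfolding stack_perms_def using produced_permutation by blast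
qed

text \<open>Expresses the absence of left-right pairs without colours, so that it is seen to survive
  recolouring.\<close>

lemma lr_count_zero_iff:
  assumes w: "op_sequence w"
  shows "lr_count w = 0 \<longleftrightarrow> (\<forall>p. Suc p < length w \<longrightarrow> is_push (w ! p) \<longrightarrow> \<not> is_push (w ! Suc p) \<longrightarrow>
    (p, Suc p) \<in> snd ` arcs w)"
proof -
  note m = op_sequence_matching[OF w]
  have "finite {i. Suc i < length w \<and> left_right (w ! i) (w ! Suc i)}"
    by (rule finite_subset[of _ "{..<length w}"]) auto
  then have "lr_count w = 0 \<longleftrightarrow> (\<forall>p. Suc p < length w \<longrightarrow> \<not> left_right (w ! p) (w ! Suc p))"
    unfolding adj_count_card by auto
  also have "\<dots> \<longleftrightarrow> (\<forall>p. Suc p < length w \<longrightarrow> is_push (w ! p) \<longrightarrow> \<not> is_push (w ! Suc p) \<longrightarrow>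
    (p, Suc p) \<in> snd ` arcs w)"
  proof (intro all_cong1 imp_cong refl)
    fix p assume p: "Suc p < length w"
    show "(\<not> left_right (w ! p) (w ! Suc p)) \<longleftrightarrow>
      (is_push (w ! p) \<longrightarrow> \<not> is_push (w ! Suc p) \<longrightarrow> (p, Suc p) \<in> snd ` arcs w)"
    proof (cases "is_push (w ! p) \<and> \<not> is_push (w ! Suc p)")
      case False
      then show ?thesis by (auto simp: left_right_iff)
    next
      case True
      then obtain c d where cd: "w ! p = Push c" "w ! Suc p = Pop d"
        by (metis is_push.elims(2) is_push.elims(3))
      have "(p, Suc p) \<in> snd ` arcs w \<longleftrightarrow> c = d"
      proof
        assume "(p, Suc p) \<in> snd ` arcs w"
        then obtain e where "(e, p, Suc p) \<in> arcs w" by force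
        from matching_arch[OF m this] show "c = d" using cd by simp
      next
        assume "c = d"
        obtain j where j: "(c, p, j) \<in> arcs w" using matching_push[OF m _ cd(1)] p by auto
        obtain i where i: "(c, i, Suc p) \<in> arcs w" using matching_pop[OF m p] cd(2) \<open>c = d\<close> by blast
        have "i \<le> p" using matching_arch(1)[OF m i] by simp
        have "Suc p \<le> j" using matching_arch(1)[OF m j] by simp
        \<comment> \<open>Otherwise the arches from \<open>i\<close> to \<open>Suc p\<close> and
          from \<open>p\<close> to \<open>j\<close> would have the same colour and be
          interleaved.\<close>
        have "i = p"
        proof (rule ccontr)
          assume "i \<noteq> p"
          then have "j < Suc p" using matching_noncrossing[OF m i j] \<open>i \<le> p\<close> by simp
          then show False using \<open>Suc p \<le> j\<close> by simp
        qed
        then show "(p, Suc p) \<in> snd ` arcs w" using i by force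
      qed
      then show ?thesis using True cd by simp
    qed
  qed
  finally show ?thesis .
qed

section \<open>Removing left-right pairs by exchanging adjacent letters\<close>

lemma produced_swap:
  "c \<noteq> d \<Longrightarrow> produced (u @ [Push c, Pop d] @ v) = produced (u @ [Pop d, Push c] @ v)"
  by (cases "exec u") (simp add: produced_def exec_def fun_upd_twist)

lemma op_sequence_swap:
  assumes w: "op_sequence (u @ [Push c, Pop d] @ v)" and "c \<noteq> d"
  shows "op_sequence (u @ [Pop d, Push c] @ v)"
  unfolding op_sequence_def
proof (intro allI conjI impI)
  fix e
  show "count_list (u @ [Pop d, Push c] @ v) (Push e) = count_list (u @ [Pop d, Push c] @ v) (Pop e)"
  proof -
    have "count_list (u @ [Push c, Pop d] @ v) (Push e) = count_list (u @ [Push c, Pop d] @ v) (Pop e)"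
      using w unfolding op_sequence_def by blast
    then show ?thesis by (simp split: if_splits)
  qed
next
  fix e k assume "k \<le> length (u @ [Pop d, Push c] @ v)"
  then have p: "count_list (take m (u @ [Push c, Pop d] @ v)) (Pop e) \<le>
      count_list (take m (u @ [Push c, Pop d] @ v)) (Push e)" if "m \<le> Suc k" for m
    using w that unfolding op_sequence_def by (metis nle_le take_all)
  consider "k \<le> length u" | "k = Suc (length u)" | r where "k = Suc (Suc (length u)) + r"
  proof -
    have "k \<le> length u \<or> k = Suc (length u) \<or> k = Suc (Suc (length u)) + (k - Suc (Suc (length u)))"
      by linarith
    then show thesis using that by blast
  qed
  then show "count_list (take k (u @ [Pop d, Push c] @ v)) (Pop e) \<le>
      count_list (take k (u @ [Pop d, Push c] @ v)) (Push e)"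
  proof cases
    case 1
    then show ?thesis using p[of k] by simp
  next
    case 2
    \<comment> \<open>The prefix \<open>u\<close> followed by \<open>Pop d\<close> is compared with
      the old prefix \<open>u\<close> followed by \<open>Push c\<close> and \<open>Pop d\<close>:
      since \<open>c\<close> and \<open>d\<close> differ, the push does not help stack
      \<open>d\<close>. For other colours the prefix \<open>u\<close> is enough.\<close>
    then show ?thesis using p[of "length u"] p[of "Suc k"] \<open>c \<noteq> d\<close> by (simp split: if_splits)
  next
    case (3 r)
    then show ?thesis using p[of k] by (simp split: if_splits)
  qed
qed

text \<open>The number of pairs consisting of a push and a later pop. Exchanging the two letters of
  a left-right pair lowers it, so a word minimising it has no such pair.\<close>

fun push_pop_inversions :: "operation list \<Rightarrow> nat" where
  "push_pop_inversions [] = 0"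
| "push_pop_inversions (x # w) = (if is_push x then pops w else 0) + push_pop_inversions w"

lemma push_pop_inversions_swap:
  "push_pop_inversions (u @ [Pop d, Push c] @ v) < push_pop_inversions (u @ [Push c, Pop d] @ v)"
  by (induction u) simp_all

lemma lr_count_nonzero: "lr_count w \<noteq> 0 \<Longrightarrow> \<exists>u c d v. c \<noteq> d \<and> w = u @ [Push c, Pop d] @ v"
proof (induction left_right w rule: adj_count.induct)
  case (1 x y w)
  show ?case
  proof (cases "left_right x y")
    case True
    then show ?thesis by (metis append_Cons append_Nil left_right_iff)
  next
    case False
    then obtain u c d v where "c \<noteq> d" "y # w = u @ [Push c, Pop d] @ v" using 1 by auto
    then show ?thesis by (metis append_Cons)
  qed
qed simp_all

lemma lr_free_exists:
  assumes "op_sequence w"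
  shows "\<exists>w'. op_sequence w' \<and> produced w' = produced w \<and> lr_count w' = 0"
proof -
  obtain w' where w': "op_sequence w'" "produced w' = produced w"
    and min: "\<And>v. op_sequence v \<Longrightarrow> produced v = produced w \<Longrightarrow> push_pop_inversions w' \<le> push_pop_inversions v"
    using ex_has_least_nat[of "\<lambda>v. op_sequence v \<and> produced v = produced w" w push_pop_inversions] assms
    by blast
  have "lr_count w' = 0"
  proof (rule ccontr)
    assume "lr_count w' \<noteq> 0"
    then obtain u c d v where *: "c \<noteq> d" "w' = u @ [Push c, Pop d] @ v" using lr_count_nonzero by blast
    have "push_pop_inversions w' \<le> push_pop_inversions (u @ [Pop d, Push c] @ v)"
      using min op_sequence_swap[of u c d v] produced_swap[of c d u v] w' * by simp
    then show False using push_pop_inversions_swap[of u d c v] * by simp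
  qed
  then show ?thesis using w' by blast
qed

section \<open>Recolouring the arches\<close>

definition interleaved :: "nat \<times> nat \<Rightarrow> nat \<times> nat \<Rightarrow> bool" where
  "interleaved p q \<longleftrightarrow> fst p < fst q \<and> fst q < snd p \<and> snd p < snd q \<or>
     fst q < fst p \<and> fst p < snd q \<and> snd q < snd p"

lemma arches_cross_interleaved:
  "arches_cross \<alpha> \<beta> \<longleftrightarrow> arch_colour \<alpha> \<noteq> arch_colour \<beta> \<and> interleaved (snd \<alpha>) (snd \<beta>)"
  by (simp add: arches_cross_def interleaved_def left_end_def right_end_def)

text \<open>In a matching, interleaved arches automatically have different colours. So crossings,
  and with them components, are unchanged by any recolouring that is again a matching.\<close>

lemma matching_cross_iff:
  assumes m: "matching w A" and "\<alpha> \<in> A" "\<beta> \<in> A"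
  shows "arches_cross \<alpha> \<beta> \<longleftrightarrow> interleaved (snd \<alpha>) (snd \<beta>)"
proof
  assume i: "interleaved (snd \<alpha>) (snd \<beta>)"
  obtain c i j c' i' j' where ab: "\<alpha> = (c, i, j)" "\<beta> = (c', i', j')" by (metis prod_cases3)
  consider "i < i' \<and> i' < j \<and> j < j'" | "i' < i \<and> i < j' \<and> j' < j"
    using i unfolding interleaved_def ab by auto
  then show "arches_cross \<alpha> \<beta>"
  proof cases
    case 1
    then show ?thesis using interleaved_imp_cross[OF m] assms(2,3) ab by blast
  next
    case 2
    then have "arches_cross \<beta> \<alpha>" using interleaved_imp_cross[OF m] assms(2,3) ab by blast
    then show ?thesis by (simp only: arches_cross_sym)
  qed
qed (simp add: arches_cross_interleaved)

lemma matching_snd_inj: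
  assumes "matching w A"
  shows "inj_on snd A"
proof (rule inj_onI)
  fix \<alpha> \<beta> assume "\<alpha> \<in> A" "\<beta> \<in> A" "snd \<alpha> = snd \<beta>"
  then show "\<alpha> = \<beta>"
    using inj_onD[OF matching_left_inj[OF assms]] by (simp add: left_end_def)
qed

lemma is_push_cases: "is_push x \<longleftrightarrow> (\<exists>c. x = Push c)" "\<not> is_push x \<longleftrightarrow> (\<exists>c. x = Pop c)"
  by (cases x; simp)+

text \<open>Separating interleaved arches is precisely what the noncrossing condition asks of a
  colouring. Each position belongs to exactly one arch, so the new colour of its letter is well
  defined.\<close>

lemma recolour:
  assumes m: "matching w A"
    and nc: "\<And>\<alpha> \<beta>. \<alpha> \<in> A \<Longrightarrow> \<beta> \<in> A \<Longrightarrow> interleaved (snd \<alpha>) (snd \<beta>) \<Longrightarrow> \<chi> \<alpha> \<noteq> \<chi> \<beta>"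
  shows "\<exists>w'. map is_push w' = map is_push w \<and> matching w' ((\<lambda>\<alpha>. (\<chi> \<alpha>, snd \<alpha>)) ` A)"
proof -
  define arch_at where "arch_at p = (SOME \<alpha>. \<alpha> \<in> A \<and> (p = left_end \<alpha> \<or> p = right_end \<alpha>))" for p
  have at_left: "arch_at i = (c, i, j)" if "(c, i, j) \<in> A" for c i j
  proof -
    have "arch_at i \<in> A \<and> (i = left_end (arch_at i) \<or> i = right_end (arch_at i))"
      unfolding arch_at_def by (rule someI[of _ "(c, i, j)"]) (simp add: that left_end_def)
    moreover obtain c' i' j' where e: "arch_at i = (c', i', j')" by (metis prod_cases3)
    ultimately have a: "(c', i', j') \<in> A" "i = i' \<or> i = j'"
      by (simp_all add: left_end_def right_end_def)
    then have "i' = i" using matching_left_right[OF m that a(1)] by simp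
    then show ?thesis using matching_left_unique[OF m that] a(1) e by blast
  qed
  have at_right: "arch_at j = (c, i, j)" if "(c, i, j) \<in> A" for c i j
  proof -
    have "arch_at j \<in> A \<and> (j = left_end (arch_at j) \<or> j = right_end (arch_at j))"
      unfolding arch_at_def by (rule someI[of _ "(c, i, j)"]) (simp add: that right_end_def)
    moreover obtain c' i' j' where e: "arch_at j = (c', i', j')" by (metis prod_cases3)
    ultimately have a: "(c', i', j') \<in> A" "j = i' \<or> j = j'"
      by (simp_all add: left_end_def right_end_def)
    then have "j' = j" using matching_left_right[OF m a(1) that] by simp
    then show ?thesis using matching_right_unique[OF m that] a(1) e by blast
  qed
  define w' where "w' = map (\<lambda>p. if is_push (w ! p) then Push (\<chi> (arch_at p)) else Pop (\<chi> (arch_at p))) [0..<length w]"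
  have len: "length w' = length w" by (simp add: w'_def)
  have nth: "w' ! p = (if is_push (w ! p) then Push (\<chi> (arch_at p)) else Pop (\<chi> (arch_at p)))"
    if "p < length w" for p
    using that by (simp add: w'_def)
  have shape: "map is_push w' = map is_push w"
    by (rule nth_equalityI) (simp_all add: len nth)
  define B where "B = (\<lambda>\<alpha>. (\<chi> \<alpha>, snd \<alpha>)) ` A"
  have BI: "(\<chi> (c, i, j), i, j) \<in> B" if "(c, i, j) \<in> A" for c i j
    unfolding B_def using that by force
  have BE: "\<exists>c'. (c', i, j) \<in> A \<and> c = \<chi> (c', i, j)" if "(c, i, j) \<in> B" for c i j
    using that unfolding B_def by auto
  have "matching w' B"
  proof (rule matchingI)
    fix c i j assume "(c, i, j) \<in> B"
    then obtain c' where a: "(c', i, j) \<in> A" "c = \<chi> (c', i, j)" using BE by blast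
    note ar = matching_arch[OF m a(1)]
    show "i < j \<and> j < length w' \<and> w' ! i = Push c \<and> w' ! j = Pop c"
      using ar nth[OF ar(2)] nth[OF ar(3)] at_left[OF a(1)] at_right[OF a(1)] a(2) len by simp
  next
    fix i c assume i: "i < length w'" "w' ! i = Push c"
    then have il: "i < length w" using len by simp
    then have "is_push (w ! i)" using nth[OF il] i(2) by (auto split: if_splits)
    then obtain d where "w ! i = Push d" by (auto simp: is_push_cases)
    then obtain j where a: "(d, i, j) \<in> A" using matching_push[OF m il] by blast
    have "c = \<chi> (d, i, j)" using nth[OF il] i(2) \<open>is_push (w ! i)\<close> at_left[OF a] by simp
    then show "\<exists>j. (c, i, j) \<in> B" using BI[OF a] by blast
  next
    fix j c assume j: "j < length w'" "w' ! j = Pop c"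
    then have jl: "j < length w" using len by simp
    then have np: "\<not> is_push (w ! j)" using nth[OF jl] j(2) by (auto split: if_splits)
    then obtain d where "w ! j = Pop d" by (metis is_push.elims(3))
    then obtain i where a: "(d, i, j) \<in> A" using matching_pop[OF m jl] by blast
    have "c = \<chi> (d, i, j)" using nth[OF jl] j(2) np at_right[OF a] by simp
    then show "\<exists>i. (c, i, j) \<in> B" using BI[OF a] by blast
  next
    fix c i j j' assume "(c, i, j) \<in> B" "(c, i, j') \<in> B"
    then obtain d d' where "(d, i, j) \<in> A" "(d', i, j') \<in> A" using BE by blast
    then show "j = j'" by (rule matching_left_unique(2)[OF m])
  next
    fix c i i' j assume "(c, i, j) \<in> B" "(c, i', j) \<in> B"
    then obtain d d' where "(d, i, j) \<in> A" "(d', i', j) \<in> A" using BE by blast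
    then show "i = i'" by (rule matching_right_unique(2)[OF m])
  next
    fix c i j i' j' assume b: "(c, i, j) \<in> B" "(c, i', j') \<in> B" and cr: "i < i'" "i' < j" "j < j'"
    obtain d d' where a: "(d, i, j) \<in> A" "c = \<chi> (d, i, j)" "(d', i', j') \<in> A" "c = \<chi> (d', i', j')"
      using BE[OF b(1)] BE[OF b(2)] by blast
    have "interleaved (i, j) (i', j')" using cr by (simp add: interleaved_def)
    then show False using nc[OF a(1,3)] a(2,4) by simp
  qed
  then show ?thesis using shape B_def by blast
qed

lemma produced_cong:
  assumes w: "op_sequence w" and w': "op_sequence w'" and shape: "map is_push w' = map is_push w"
    and arcs: "snd ` arcs w' = snd ` arcs w"
  shows "produced w' = produced w"
proof -
  have len: "length w' = length w" using map_eq_imp_length_eq[OF shape] by simp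
  have ip: "is_push (w' ! p) = is_push (w ! p)" if "p < length w" for p
    using arg_cong[OF shape, of "\<lambda>v. v ! p"] that len by simp
  have pt: "pushes (take i w') = pushes (take i w)" for i
  proof -
    have "map is_push (take i w') = map is_push (take i w)" using shape by (simp flip: take_map)
    then have "length (filter id (map is_push (take i w'))) = length (filter id (map is_push (take i w)))" by simp
    then show ?thesis by (simp add: filter_map)
  qed
  have "moved_item w' j = moved_item w j" if j: "j < length w" "\<not> is_push (w ! j)" for j
  proof -
    obtain c where "w ! j = Pop c" using j(2) by (metis is_push.elims(3))
    then obtain i where a: "(c, i, j) \<in> arcs w"
      using matching_pop[OF op_sequence_matching[OF w] j(1)] by blast
    then have "(i, j) \<in> snd ` arcs w'" unfolding arcs by force
    then obtain d where "(d, i, j) \<in> arcs w'" by force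
    then show ?thesis using moved_item_arc(2)[OF w a] moved_item_arc(2)[OF w'] pt by simp
  qed
  moreover have "filter (\<lambda>j. \<not> is_push (w' ! j)) [0..<length w'] = filter (\<lambda>j. \<not> is_push (w ! j)) [0..<length w]"
    unfolding len by (rule filter_cong) (simp_all add: ip)
  ultimately show ?thesis unfolding produced_eq by simp
qed

section \<open>One canonical operation sequence for each permutation\<close>

definition canonical :: "operation list \<Rightarrow> bool" where
  "canonical w \<longleftrightarrow> op_sequence w \<and> lr_count w = 0 \<and> standard_arches (arcs w)"

lemma lr_count_zero_cong:
  assumes w: "op_sequence w" and w': "op_sequence w'" and shape: "map is_push w' = map is_push w"
    and arcs: "snd ` arcs w' = snd ` arcs w" and "lr_count w = 0"
  shows "lr_count w' = 0"
proof -
  have len: "length w' = length w" using map_eq_imp_length_eq[OF shape] by simp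
  have ip: "is_push (w' ! p) = is_push (w ! p)" if "p < length w" for p
    using arg_cong[OF shape, of "\<lambda>v. v ! p"] that len by simp
  show ?thesis
    using assms(5) unfolding lr_count_zero_iff[OF w] lr_count_zero_iff[OF w'] arcs len
    by (auto simp: ip)
qed

lemma canonical_exists:
  assumes "op_sequence w"
  shows "\<exists>w'. canonical w' \<and> produced w' = produced w"
proof -
  obtain v where v: "op_sequence v" "produced v = produced w" "lr_count v = 0"
    using lr_free_exists[OF assms] by blast
  define A where "A = arcs v"
  have m: "matching v A" unfolding A_def by (rule op_sequence_matching[OF v(1)])
  define first where "first \<alpha> = arg_min_on left_end (component A \<alpha>)" for \<alpha>
  \<comment> \<open>An arch turns red iff it has the colour of the first arch of its component: the
    colours are exchanged exactly in the components that start in blue.\<close>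
  define \<chi> where "\<chi> \<alpha> = (if arch_colour (first \<alpha>) = arch_colour \<alpha> then Red else Blue)" for \<alpha>
  define \<phi> where "\<phi> \<alpha> = (\<chi> \<alpha>, snd \<alpha>)" for \<alpha> :: arch
  have snd_\<phi>: "snd (\<phi> \<alpha>) = snd \<alpha>" "arch_colour (\<phi> \<alpha>) = \<chi> \<alpha>" "left_end (\<phi> \<alpha>) = left_end \<alpha>" for \<alpha>
    by (simp_all add: \<phi>_def arch_colour_def left_end_def)
  have nc: "\<chi> \<alpha> \<noteq> \<chi> \<beta>" if "\<alpha> \<in> A" "\<beta> \<in> A" "interleaved (snd \<alpha>) (snd \<beta>)" for \<alpha> \<beta>
  proof -
    have c: "arches_cross \<alpha> \<beta>" using matching_cross_iff[OF m] that by blast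
    then have "\<beta> \<in> component A \<alpha>" using that by (auto simp: component_def crossing_graph_def)
    then have "first \<beta> = first \<alpha>" unfolding first_def by (simp add: comp_eq)
    moreover have "arch_colour \<alpha> \<noteq> arch_colour \<beta>" using c by (simp add: arches_cross_def)
    ultimately show ?thesis unfolding \<chi>_def by (metis colour.exhaust colour.distinct(1))
  qed
  obtain w' where w': "map is_push w' = map is_push v" "matching w' (\<phi> ` A)"
  proof -
    have "\<exists>w'. map is_push w' = map is_push v \<and> matching w' ((\<lambda>\<alpha>. (\<chi> \<alpha>, snd \<alpha>)) ` A)"
      by (rule recolour[OF m nc])
    then show thesis using that unfolding \<phi>_def by blast
  qed
  have os: "op_sequence w'" by (rule matching_imp_op_sequence[OF w'(2)])
  have aw: "arcs w' = \<phi> ` A" by (rule arcs_eqI[OF w'(2)])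
  have sa: "snd ` arcs w' = snd ` arcs v" unfolding aw A_def by (simp add: image_image snd_\<phi>)
  have cr: "arches_cross (\<phi> \<alpha>) (\<phi> \<beta>) = arches_cross \<alpha> \<beta>" if "\<alpha> \<in> A" "\<beta> \<in> A" for \<alpha> \<beta>
    using matching_cross_iff[OF m that] matching_cross_iff[OF w'(2), of "\<phi> \<alpha>" "\<phi> \<beta>"] that
    by (simp add: snd_\<phi>)
  have "standard_arches (arcs w')"
    unfolding standard_arches_iff aw
  proof
    fix \<alpha>' assume "\<alpha>' \<in> \<phi> ` A"
    then obtain \<alpha> where a: "\<alpha> \<in> A" "\<alpha>' = \<phi> \<alpha>" by blast
    have 1: "component (\<phi> ` A) \<alpha>' = \<phi> ` component A \<alpha>" unfolding a(2) by (rule comp_image[OF cr a(1)])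
    have ne: "component A \<alpha> \<noteq> {}" using self_in_comp[OF a(1)] by blast
    have inj: "inj_on left_end (component A \<alpha>)" using matching_left_inj[OF m] comp_subset by (rule inj_on_subset)
    have 2: "arg_min_on left_end (\<phi> ` component A \<alpha>) = \<phi> (first \<alpha>)" "first \<alpha> \<in> component A \<alpha>"
      unfolding first_def using arg_min_on_image[OF ne inj, of left_end \<phi>] snd_\<phi>(3) by simp_all
    have "first (first \<alpha>) = first \<alpha>" using comp_eq[OF 2(2)] by (simp add: first_def)
    then have "\<chi> (first \<alpha>) = Red" by (simp add: \<chi>_def)
    then show "arch_colour (arg_min_on left_end (component (\<phi> ` A) \<alpha>')) = Red"
      unfolding 1 2(1) snd_\<phi>(2) .
  qed
  then have "canonical w'"
    unfolding canonical_def using os lr_count_zero_cong[OF v(1) os w'(1) sa v(3)] by blast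
  then show ?thesis using produced_cong[OF v(1) os w'(1) sa] v(2) by auto
qed

text \<open>At the first position where the two shapes differ, the next item output by \<open>w'\<close> has already been
  pushed, whereas \<open>w\<close> pushes the next item that it outputs only later.\<close>

lemma lr_free_shape_aux:
  assumes w: "op_sequence w" "lr_count w = 0" and w': "op_sequence w'"
    and eq: "produced w = produced w'"
    and p: "p < length w" "p < length w'" "is_push (w ! p)" "\<not> is_push (w' ! p)"
    and before: "map is_push (take p w) = map is_push (take p w')"
  shows False
proof -
  note m = op_sequence_matching[OF w(1)] and m' = op_sequence_matching[OF w']
  obtain c where c: "w ! p = Push c" using p(3) by (auto simp: is_push_cases)
  obtain j where j: "(c, p, j) \<in> arcs w" using matching_push[OF m p(1) c] by blast
  note ar = matching_arch[OF m j]
  define q where "q = (LEAST q. p < q \<and> \<not> is_push (w ! q))"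
  have "p < j \<and> \<not> is_push (w ! j)" using ar by simp
  then have q: "p < q" "\<not> is_push (w ! q)" "q \<le> j"
    unfolding q_def by (metis (mono_tags, lifting) LeastI, metis (mono_tags, lifting) LeastI, metis (mono_tags, lifting) Least_le)
  have ql: "q < length w" using q ar by simp
  have btw: "is_push (w ! r)" if "p \<le> r" "r < q" for r
    using not_less_Least[of r "\<lambda>q. p < q \<and> \<not> is_push (w ! q)"] that p(3) unfolding q_def
    by (cases "r = p") simp_all
  obtain r where r: "q = Suc r" "p \<le> r" using q(1) by (cases q) simp_all
  \<comment> \<open>As \<open>q\<close> is the first pop after \<open>p\<close>, the letter before
    it is a push, and without left-right pairs these two letters are partners: \<open>q\<close>
    outputs the item just pushed.\<close>
  have "(r, Suc r) \<in> snd ` arcs w"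
    using w(2)[unfolded lr_count_zero_iff[OF w(1)]] btw[of r] r q(2) ql by simp
  then obtain d where "(d, r, q) \<in> arcs w" using r by force
  then have mq: "moved_item w q = Suc (pushes (take r w))" by (rule moved_item_arc(2)[OF w(1)])
  have pt: "pushes (take p w) = pushes (take p w') \<and> pops (take p w) = pops (take p w')"
  proof -
    have "length (filter id (map is_push (take p w))) = length (filter id (map is_push (take p w')))"
      "length (filter Not (map is_push (take p w))) = length (filter Not (map is_push (take p w')))"
      unfolding before by simp_all
    then show ?thesis by (simp add: filter_map o_def)
  qed
  have q_split: "take q w = take p w @ take (q - p) (drop p w)"
    using q(1) by (metis le_add_diff_inverse less_imp_le take_add)
  have "filter (\<lambda>x. \<not> is_push x) (take (q - p) (drop p w)) = []"
  proof -
    have "is_push x" if "x \<in> set (take (q - p) (drop p w))" for x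
    proof -
      obtain t where "t < q - p" "x = w ! (p + t)" using \<open>x \<in> _\<close> ql q(1)
        unfolding in_set_conv_nth by fastforce
      then show ?thesis using btw[of "p + t"] by simp
    qed
    then show ?thesis by (simp add: filter_empty_conv)
  qed
  then have "pops (take q w) = pops (take p w)" unfolding q_split by simp
  then have "moved_item w q = moved_item w' p"
    using produced_nth[OF ql q(2)] produced_nth[OF p(2,4)] eq pt by simp
  moreover obtain d' where "w' ! p = Pop d'" using p(4) by (metis is_push.elims(3))
  then obtain i where i: "(d', i, p) \<in> arcs w'" using matching_pop[OF m' p(2)] by blast
  note ar' = matching_arch[OF m' i]
  have "pushes (take i w') < pushes (take p w')" using ar' by (intro pushes_take_less) simp_all
  moreover have "moved_item w' p = Suc (pushes (take i w'))" by (rule moved_item_arc(2)[OF w' i])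
  moreover have "pushes (take p w) \<le> pushes (take r w)"
    using pushes_take_less[of p r w] p r(2) by (cases "p = r") simp_all
  ultimately show False using mq pt by simp
qed

lemma lr_free_shape:
  assumes w: "op_sequence w" "lr_count w = 0" and w': "op_sequence w'" "lr_count w' = 0"
    and eq: "produced w = produced w'"
  shows "map is_push w = map is_push w'"
proof -
  have len: "length w = length w'"
    using op_sequence_pushes_pops[OF w(1)] op_sequence_pushes_pops[OF w'(1)] produced_length eq by metis
  have "is_push (w ! p) = is_push (w' ! p)" if "p < length w" for p
    using that
  proof (induction p rule: less_induct)
    case (less p)
    have "map is_push (take p w) = map is_push (take p w')"
      using less by (intro nth_equalityI) (simp_all add: len)
    then show ?case
      using lr_free_shape_aux[OF w w'(1) eq, of p] lr_free_shape_aux[OF w' w(1) eq[symmetric], of p] less.prems len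
      by metis
  qed
  then show ?thesis using len by (intro nth_equalityI) simp_all
qed

text \<open>For words of equal shape, a given pop has the same rank in both outputs and thus outputs
  the same item. An item determines its push by rank, so the pop has the same partner in both
  words.\<close>

lemma lr_free_snd_arcs:
  assumes w: "op_sequence w" and w': "op_sequence w'"
    and eq: "produced w = produced w'" and shape: "map is_push w = map is_push w'"
  shows "snd ` arcs w \<subseteq> snd ` arcs w'"
proof
  fix x assume "x \<in> snd ` arcs w"
  then obtain c i j where a: "(c, i, j) \<in> arcs w" "x = (i, j)" by force
  note ar = matching_arch[OF op_sequence_matching[OF w] a(1)]
  have len: "length w' = length w" using map_eq_imp_length_eq[OF shape] by simp
  have ip: "is_push (w' ! p) = is_push (w ! p)" if "p < length w" for p
    using arg_cong[OF shape, of "\<lambda>v. v ! p"] that len by simp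
  have tk: "pushes (take p w) = pushes (take p w') \<and> pops (take p w) = pops (take p w')" for p
  proof -
    have "map is_push (take p w) = map is_push (take p w')" using shape by (simp flip: take_map)
    then have "length (filter id (map is_push (take p w))) = length (filter id (map is_push (take p w')))"
      "length (filter Not (map is_push (take p w))) = length (filter Not (map is_push (take p w')))"
      by simp_all
    then show ?thesis by (simp add: filter_map o_def)
  qed
  have j': "j < length w'" "\<not> is_push (w' ! j)" using ar len ip by simp_all
  have "moved_item w' j = moved_item w j"
    using produced_nth[OF j'] produced_nth[OF ar(2)] ar(5) eq tk by simp
  moreover obtain d where "w' ! j = Pop d" using j'(2) by (metis is_push.elims(3))
  then obtain i' where i': "(d, i', j) \<in> arcs w'" using matching_pop[OF op_sequence_matching[OF w'] j'(1)] by blast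
  note ar' = matching_arch[OF op_sequence_matching[OF w'] i']
  ultimately have "pushes (take i w') = pushes (take i' w')"
    using moved_item_arc(2)[OF w a(1)] moved_item_arc(2)[OF w' i'] tk by simp
  moreover have "is_push (w' ! i)" "is_push (w' ! i')" using ar ar' ip by simp_all
  ultimately have "i = i'"
    using pushes_take_less[of i i' w'] pushes_take_less[of i' i w'] ar(3) ar'(3) len
    by (cases i i' rule: linorder_cases) simp_all
  then show "x \<in> snd ` arcs w'" using i' a(2) by force
qed

text \<open>A proper colouring of a connected graph with two colours is fixed by the colour of one
  vertex. Here that vertex is the first arch of the component, red in both systems, and equality
  spreads along crossings.\<close>

lemma standard_arcs_determined:
  assumes m: "matching w A" and m': "matching w' B" and eq: "snd ` A = snd ` B"
    and std: "standard_arches A" "standard_arches B"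
  shows "A \<subseteq> B"
proof
  fix \<alpha> assume a: "\<alpha> \<in> A"
  define \<phi> where "\<phi> \<beta> = (THE \<gamma>. \<gamma> \<in> B \<and> snd \<gamma> = snd \<beta>)" for \<beta> :: arch
  have \<phi>: "\<phi> \<beta> \<in> B \<and> snd (\<phi> \<beta>) = snd \<beta>" if "\<beta> \<in> A" for \<beta>
  proof -
    obtain \<gamma> where g: "\<gamma> \<in> B" "snd \<gamma> = snd \<beta>" using eq \<open>\<beta> \<in> A\<close> by (metis imageE imageI)
    then have "\<phi> \<beta> = \<gamma>"
      unfolding \<phi>_def using inj_onD[OF matching_snd_inj[OF m']] by (intro the_equality) auto
    then show ?thesis using g by simp
  qed
  have im: "\<phi> ` A = B"
  proof (intro equalityI subsetI)
    fix \<gamma> assume "\<gamma> \<in> B"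
    then obtain \<beta> where b: "\<beta> \<in> A" "snd \<beta> = snd \<gamma>" using eq by (metis imageE imageI)
    then have "\<phi> \<beta> = \<gamma>"
      using inj_onD[OF matching_snd_inj[OF m'], of "\<phi> \<beta>" \<gamma>] \<phi>[OF b(1)] \<open>\<gamma> \<in> B\<close> by simp
    then show "\<gamma> \<in> \<phi> ` A" using b(1) by blast
  qed (use \<phi> in blast)
  have cr: "arches_cross (\<phi> \<beta>) (\<phi> \<gamma>) = arches_cross \<beta> \<gamma>" if "\<beta> \<in> A" "\<gamma> \<in> A" for \<beta> \<gamma>
    using matching_cross_iff[OF m that] matching_cross_iff[OF m', of "\<phi> \<beta>" "\<phi> \<gamma>"]
      \<phi>[OF that(1)] \<phi>[OF that(2)] by simp
  have le: "left_end (\<phi> \<beta>) = left_end \<beta>" if "\<beta> \<in> A" for \<beta>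
    using \<phi>[OF that] by (simp add: left_end_def)
  have fix_iff: "\<phi> \<beta> = \<beta> \<longleftrightarrow> arch_colour (\<phi> \<beta>) = arch_colour \<beta>" if "\<beta> \<in> A" for \<beta>
    using \<phi>[OF that] by (auto simp: prod_eq_iff arch_colour_def)
  define \<beta> where "\<beta> = arg_min_on left_end (component A \<alpha>)"
  have ne: "component A \<alpha> \<noteq> {}" using self_in_comp[OF a] by blast
  have inj: "inj_on left_end (component A \<alpha>)" using matching_left_inj[OF m] comp_subset by (rule inj_on_subset)
  have le': "left_end (\<phi> x) \<le> left_end (\<phi> y) \<longleftrightarrow> left_end x \<le> left_end y"
    if "x \<in> component A \<alpha>" "y \<in> component A \<alpha>" for x y
    using le that comp_subset by (metis subsetD)
  have 2: "arg_min_on left_end (\<phi> ` component A \<alpha>) = \<phi> \<beta>" "\<beta> \<in> component A \<alpha>"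
    unfolding \<beta>_def using arg_min_on_image[OF ne inj, of left_end \<phi>, OF le'] by blast+
  have bA: "\<beta> \<in> A" using 2(2) comp_subset by blast
  have "component B (\<phi> \<alpha>) = \<phi> ` component A \<alpha>" using comp_image[OF cr a] im by simp
  then have "arch_colour (\<phi> \<beta>) = Red" 
    using std(2)[unfolded standard_arches_iff, rule_format, of "\<phi> \<alpha>"] \<phi>[OF a] 2(1) by simp
  moreover have "arch_colour \<beta> = Red" using std(1)[unfolded standard_arches_iff] a \<beta>_def by blast
  ultimately have base: "\<phi> \<beta> = \<beta>" using fix_iff[OF bA] by simp
  have "(\<beta>, \<alpha>) \<in> (crossing_graph A)\<^sup>*" using 2(2) by (auto simp: component_def intro: crossing_rtrancl_sym)
  then have "\<phi> \<alpha> = \<alpha>"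
  proof (induction rule: rtrancl_induct)
    case (step \<gamma> \<delta>)
    then have gd: "\<gamma> \<in> A" "\<delta> \<in> A" "arches_cross \<gamma> \<delta>" by (simp_all add: crossing_graph_def)
    then have "arches_cross (\<phi> \<gamma>) (\<phi> \<delta>)" using cr by simp
    then have "arch_colour (\<phi> \<delta>) \<noteq> arch_colour \<gamma>" "arch_colour \<delta> \<noteq> arch_colour \<gamma>"
      using gd(3) step.IH by (auto simp: arches_cross_def)
    then have "arch_colour (\<phi> \<delta>) = arch_colour \<delta>" by (metis colour.exhaust)
    then show ?case using fix_iff[OF gd(2)] by simp
  qed (rule base)
  then show "\<alpha> \<in> B" using \<phi>[OF a] by simp
qed

lemma matching_length:
  assumes "matching w A"
  shows "length w = 2 * card A"
proof -
  have r: "inj_on right_end A"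
  proof (rule inj_onI)
    fix \<alpha> \<beta> assume *: "\<alpha> \<in> A" "\<beta> \<in> A" "right_end \<alpha> = right_end \<beta>"
    obtain c i j c' i' where "\<alpha> = (c, i, j)" "\<beta> = (c', i', j)"
      using *(3) by (cases \<alpha>; cases \<beta>) (simp add: right_end_def)
    then show "\<alpha> = \<beta>" using matching_right_unique[OF assms] * by blast
  qed
  have disj: "left_end ` A \<inter> right_end ` A = {}"
    using matching_left_right[OF assms] by (auto simp: left_end_def right_end_def)
  have "length w = card (left_end ` A \<union> right_end ` A)"
    using arch_ends_matching[OF assms] by (simp add: arch_ends_def)
  also have "\<dots> = card A + card A"
    using card_Un_disjoint[OF _ _ disj] finite_matching[OF assms]
      card_image[OF matching_left_inj[OF assms]] card_image[OF r] by simp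
  finally show ?thesis by simp
qed

lemma matching_word_unique:
  assumes "matching w A" "matching w' A"
  shows "w = w'"
proof (rule nth_equalityI)
  show len: "length w = length w'" using matching_length assms by metis
  fix p assume "p < length w"
  then obtain c i j where a: "(c, i, j) \<in> A" "p = i \<or> p = j" using matching_cover[OF assms(1)] by blast
  then show "w ! p = w' ! p"
    using matching_arch[OF assms(1) a(1)] matching_arch[OF assms(2) a(1)] by auto
qed

lemma canonical_unique:
  assumes "canonical w" "canonical w'" "produced w = produced w'"
  shows "w = w'"
proof -
  have w: "op_sequence w" "lr_count w = 0" "standard_arches (arcs w)"
    and w': "op_sequence w'" "lr_count w' = 0" "standard_arches (arcs w')"
    using assms(1,2) by (simp_all add: canonical_def)
  have shape: "map is_push w = map is_push w'" by (rule lr_free_shape[OF w(1,2) w'(1,2) assms(3)])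
  have snd: "snd ` arcs w = snd ` arcs w'"
    using lr_free_snd_arcs[OF w(1) w'(1) assms(3) shape]
      lr_free_snd_arcs[OF w'(1) w(1) assms(3)[symmetric] shape[symmetric]] by blast
  note m = op_sequence_matching[OF w(1)] and m' = op_sequence_matching[OF w'(1)]
  have "arcs w = arcs w'"
    using standard_arcs_determined[OF m m' snd w(3) w'(3)]
      standard_arcs_determined[OF m' m snd[symmetric] w'(3) w(3)] by blast
  then show ?thesis using matching_word_unique[OF m] m' by simp
qed

lemma card_stack_perms: "card (stack_perms n) = card {w. canonical w \<and> pushes w = n}"
proof -
  have "stack_perms n = produced ` {w. canonical w \<and> pushes w = n}"
    unfolding stack_perms_eq
  proof (intro equalityI subsetI)
    fix p assume "p \<in> produced ` {w. op_sequence w \<and> pushes w = n}"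
    then obtain w where w: "op_sequence w" "pushes w = n" "p = produced w" by blast
    obtain w' where w': "canonical w'" "produced w' = produced w" using canonical_exists[OF w(1)] by blast
    have "pushes w' = n"
      using w' w produced_length op_sequence_pushes_pops(1) canonical_def by metis
    then show "p \<in> produced ` {w. canonical w \<and> pushes w = n}" 
      using w(3) w' by (intro image_eqI[of _ _ w']) simp_all
  qed (auto simp: canonical_def)
  moreover have "inj_on produced {w. canonical w \<and> pushes w = n}"
    using canonical_unique by (auto intro!: inj_onI)
  ultimately show ?thesis by (simp add: card_image)
qed

section \<open>Generating functions\<close>

definition gf :: "'x set \<Rightarrow> ('x \<Rightarrow> nat) \<Rightarrow> ('x \<Rightarrow> 'r::comm_ring_1) \<Rightarrow> 'r fps" where
  "gf X sz wt = Abs_fps (\<lambda>n. \<Sum>x | x \<in> X \<and> sz x = n. wt x)"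

lemma gf_nth: "gf X sz wt $ n = (\<Sum>x | x \<in> X \<and> sz x = n. wt x)"
  by (simp add: gf_def)

lemma gf_bij_betw:
  assumes "bij_betw f X Y" and "\<And>x. x \<in> X \<Longrightarrow> sz' (f x) = sz x" "\<And>x. x \<in> X \<Longrightarrow> wt' (f x) = wt x"
  shows "gf Y sz' wt' = gf X sz wt"
proof (rule fps_ext)
  fix n
  have "bij_betw f {x \<in> X. sz x = n} {y \<in> Y. sz' y = n}"
    using assms(1,2) unfolding bij_betw_def by (auto intro: inj_on_subset)
  then have "(\<Sum>y | y \<in> Y \<and> sz' y = n. wt' y) = (\<Sum>x | x \<in> X \<and> sz x = n. wt' (f x))"
    by (rule sum.reindex_bij_betw[symmetric])
  then show "gf Y sz' wt' $ n = gf X sz wt $ n"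
    unfolding gf_nth by (simp add: assms(3))
qed

text \<open>A sum over an infinite set is 0 by convention, so each size level must be finite before
  pairs can be sorted by the size of the first entry.\<close>

lemma gf_times:
  assumes fin: "\<And>n. finite {x \<in> X. sz x = n}" "\<And>n. finite {y \<in> Y. sz' y = n}"
  shows "gf (X \<times> Y) (\<lambda>(x, y). sz x + sz' y) (\<lambda>(x, y). wt x * wt' y) = gf X sz wt * gf Y sz' wt'"
proof (rule fps_ext)
  fix n
  let ?S = "\<lambda>i. {x \<in> X. sz x = i} \<times> {y \<in> Y. sz' y = n - i}"
  have "(gf X sz wt * gf Y sz' wt') $ n = (\<Sum>i=0..n. \<Sum>(x, y)\<in>?S i. wt x * wt' y)"
    by (simp add: fps_mult_nth gf_nth sum_product sum.cartesian_product)
  also have "\<dots> = (\<Sum>(x, y)\<in>(\<Union>i\<in>{0..n}. ?S i). wt x * wt' y)"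
    using fin by (intro sum.UNION_disjoint[symmetric]) (auto intro!: finite_cartesian_product)
  also have "(\<Union>i\<in>{0..n}. ?S i) = {p \<in> X \<times> Y. (case p of (x, y) \<Rightarrow> sz x + sz' y) = n}"
    by auto
  finally show "gf (X \<times> Y) (\<lambda>(x, y). sz x + sz' y) (\<lambda>(x, y). wt x * wt' y) $ n
    = (gf X sz wt * gf Y sz' wt') $ n"
    by (simp add: gf_nth)
qed

section \<open>Exchange of the two colours\<close>

fun swap_colour :: "colour \<Rightarrow> colour" where
  "swap_colour Red = Blue"
| "swap_colour Blue = Red"

fun swap_op :: "operation \<Rightarrow> operation" where
  "swap_op (Push c) = Push (swap_colour c)"
| "swap_op (Pop c) = Pop (swap_colour c)"

lemma swap_colour_swap [simp]: "swap_colour (swap_colour c) = c"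
  by (cases c) simp_all

lemma swap_colour_eq_iff [simp]: "swap_colour c = swap_colour d \<longleftrightarrow> c = d"
  by (cases c; cases d) simp_all

lemma swap_op_swap [simp]: "swap_op (swap_op x) = x"
  by (cases x) simp_all

lemma swap_op_simps [simp]:
  "swap_op x = Push c \<longleftrightarrow> x = Push (swap_colour c)"
  "swap_op x = Pop c \<longleftrightarrow> x = Pop (swap_colour c)"
  "is_push (swap_op x) = is_push x"
  by (cases x; auto)+

lemma matching_swap:
  assumes m: "matching w A"
  shows "matching (map swap_op w) (apfst swap_colour ` A)"
proof -
  have mem: "(c, i, j) \<in> apfst swap_colour ` A \<longleftrightarrow> (swap_colour c, i, j) \<in> A" for c i j
  proof
    assume "(swap_colour c, i, j) \<in> A"
    then show "(c, i, j) \<in> apfst swap_colour ` A" by (intro image_eqI[of _ _ "(swap_colour c, i, j)"]) simp_all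
  qed auto
  show ?thesis
  proof (rule matchingI)
    fix c i j assume "(c, i, j) \<in> apfst swap_colour ` A"
    then have a: "(swap_colour c, i, j) \<in> A" by (simp add: mem)
    show "i < j \<and> j < length (map swap_op w) \<and> map swap_op w ! i = Push c \<and> map swap_op w ! j = Pop c"
      using matching_arch[OF m a] by simp
  next
    fix i c assume "i < length (map swap_op w)" "map swap_op w ! i = Push c"
    then show "\<exists>j. (c, i, j) \<in> apfst swap_colour ` A" unfolding mem by (intro matching_push[OF m]) simp_all
  next
    fix j c assume "j < length (map swap_op w)" "map swap_op w ! j = Pop c"
    then show "\<exists>i. (c, i, j) \<in> apfst swap_colour ` A" unfolding mem by (intro matching_pop[OF m]) simp_all
  next
    fix c i j j' assume "(c, i, j) \<in> apfst swap_colour ` A" "(c, i, j') \<in> apfst swap_colour ` A"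
    then show "j = j'" unfolding mem by (rule matching_left_unique(2)[OF m])
  next
    fix c i i' j assume "(c, i, j) \<in> apfst swap_colour ` A" "(c, i', j) \<in> apfst swap_colour ` A"
    then show "i = i'" unfolding mem by (rule matching_right_unique(2)[OF m])
  next
    fix c i j i' j' assume "(c, i, j) \<in> apfst swap_colour ` A" "(c, i', j') \<in> apfst swap_colour ` A"
      and cr: "i < i'" "i' < j" "j < j'"
    then have "j' < j" unfolding mem by (intro matching_noncrossing[OF m _ _ cr(1,2)])
    then show False using cr(3) by simp
  qed
qed

definition connected_words :: "operation list set" where
  "connected_words = {w. op_sequence w \<and> connected_arches (arcs w)}"

lemma connected_words_swap:
  assumes "w \<in> connected_words"
  shows "map swap_op w \<in> connected_words"
proof -
  have w: "op_sequence w" "connected_arches (arcs w)" using assms by (simp_all add: connected_words_def)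
  note m = matching_swap[OF op_sequence_matching[OF w(1)]]
  have "inj_on (apfst swap_colour) (arcs w)" by (auto intro!: inj_onI)
  moreover have "arches_cross (apfst swap_colour \<alpha>) (apfst swap_colour \<beta>) = arches_cross \<alpha> \<beta>" for \<alpha> \<beta>
    by (simp add: arches_cross_interleaved arch_colour_def)
  ultimately have "connected_arches (apfst swap_colour ` arcs w)"
    using connected_arches_image w(2) by blast
  then show ?thesis
    using matching_imp_op_sequence[OF m] arcs_eqI[OF m] by (simp add: connected_words_def)
qed

lemma lr_count_swap: "lr_count (map swap_op w) = lr_count w"
proof -
  have "left_right (swap_op x) (swap_op y) = left_right x y" for x y
    by (cases x; cases y) simp_all
  then show ?thesis by (simp add: adj_count_map)
qed

lemma is_push_swap_comp [simp]: "is_push \<circ> swap_op = is_push"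
  by (rule ext) simp

lemma pushes_swap: "pushes (map swap_op w) = pushes w"
  by (simp add: filter_map)

lemma op_sequence_first:
  assumes "op_sequence w" "w \<noteq> []"
  shows "is_push (w ! 0)" "\<not> is_push (last w)"
proof -
  note m = op_sequence_matching[OF assms(1)]
  obtain c j where "(c, 0, j) \<in> arcs w" using first_arch[OF m assms(2)] .
  then show "is_push (w ! 0)" using matching_arch[OF m] by force
  have "length w - 1 < length w" using assms(2) by simp
  then obtain c i j where a: "(c, i, j) \<in> arcs w" "length w - 1 = i \<or> length w - 1 = j"
    using matching_cover[OF m] by blast
  note ar = matching_arch[OF m a(1)]
  have "length w - 1 = j" using a(2) ar(1,2) by auto
  then show "\<not> is_push (last w)" using ar(5) assms(2) by (simp add: last_conv_nth)
qed

lemma finite_words: "finite {w :: operation list. length w = n}"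
proof -
  have "x \<in> {Push Red, Push Blue, Pop Red, Pop Blue}" for x
  proof (cases x)
    case (Push c)
    then show ?thesis by (cases c) simp_all
  next
    case (Pop c)
    then show ?thesis by (cases c) simp_all
  qed
  then have "finite (UNIV :: operation set)"
    by (intro finite_subset[of UNIV "{Push Red, Push Blue, Pop Red, Pop Blue}"]) auto
  then show ?thesis using finite_lists_length_eq[of "UNIV :: operation set" n] by simp
qed

lemma finite_op_sequences: "finite {w. op_sequence w \<and> pushes w = n}"
  by (rule finite_subset[OF _ finite_words[of "2 * n"]]) (auto simp: op_sequence_pushes_pops(2))

text \<open>The arches determine every letter, which gives injectivity. A connected system is its
  own only component, so being standard becomes a condition on the first letter.\<close>

lemma bij_betw_arch_system_of:
  "bij_betw arch_system_of {w \<in> connected_words. w ! 0 = Push Red \<and> pushes w = n}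
     {A. A \<in> arch_systems \<and> standard_arches A \<and> connected_arches A \<and> card A = n}"
  unfolding bij_betw_def
proof
  have "inj (amap Suc)"
  proof (rule injI)
    fix \<alpha> \<beta> assume "amap Suc \<alpha> = amap Suc \<beta>"
    then show "\<alpha> = \<beta>" by (cases \<alpha>; cases \<beta>) simp
  qed
  then have "arcs v = arcs w" if "arch_system_of v = arch_system_of w" for v w
    using that unfolding arch_system_of_arcs by (simp add: inj_image_eq_iff)
  then have "v = w" if "op_sequence v" "op_sequence w" "arch_system_of v = arch_system_of w" for v w
    using matching_word_unique[OF op_sequence_matching[OF that(1)]] op_sequence_matching[OF that(2)] that(3)
    by metis
  then show "inj_on arch_system_of {w \<in> connected_words. w ! 0 = Push Red \<and> pushes w = n}"
    by (intro inj_onI) (simp add: connected_words_def)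
  have *: "card (arch_system_of w) = pushes w" "standard_arches (arch_system_of w) \<and> connected_arches (arch_system_of w)
    \<longleftrightarrow> w ! 0 = Push Red \<and> connected_arches (arcs w)" if "op_sequence w" for w
  proof -
    have "card (arch_system_of w) = card (arcs w)"
      unfolding arch_system_of_arcs using \<open>inj (amap Suc)\<close> by (metis card_image inj_on_subset subset_UNIV)
    then show "card (arch_system_of w) = pushes w"
      using matching_length[OF op_sequence_matching[OF that]] op_sequence_pushes_pops(2)[OF that] by simp
    show "standard_arches (arch_system_of w) \<and> connected_arches (arch_system_of w)
        \<longleftrightarrow> w ! 0 = Push Red \<and> connected_arches (arcs w)"
      using standard_arch_system_of[OF that] standard_connected[OF that] by blast
  qed
  show "arch_system_of ` {w \<in> connected_words. w ! 0 = Push Red \<and> pushes w = n}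
    = {A. A \<in> arch_systems \<and> standard_arches A \<and> connected_arches A \<and> card A = n}"
  proof (intro equalityI subsetI)
    fix A assume "A \<in> arch_system_of ` {w \<in> connected_words. w ! 0 = Push Red \<and> pushes w = n}"
    then obtain w where "A = arch_system_of w" "op_sequence w" "connected_arches (arcs w)"
      "w ! 0 = Push Red" "pushes w = n" by (auto simp: connected_words_def)
    then show "A \<in> {A. A \<in> arch_systems \<and> standard_arches A \<and> connected_arches A \<and> card A = n}"
      using * by (simp add: arch_systems_def)
  next
    fix A assume A: "A \<in> {A. A \<in> arch_systems \<and> standard_arches A \<and> connected_arches A \<and> card A = n}"
    then obtain w where w: "A = arch_system_of w" "op_sequence w" by (auto simp: arch_systems_def)
    then have "w \<in> {w \<in> connected_words. w ! 0 = Push Red \<and> pushes w = n}"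
      using A *[OF w(2)] by (simp add: connected_words_def)
    then show "A \<in> arch_system_of ` {w \<in> connected_words. w ! 0 = Push Red \<and> pushes w = n}"
      using w(1) by blast
  qed
qed

lemma arch_gf_nth:
  "arch_gf $ n = (\<Sum>w | w \<in> connected_words \<and> w ! 0 = Push Red \<and> pushes w = n. [:0, 1:] ^ lr_count w)"
proof -
  have "arch_gf $ n = (\<Sum>w | w \<in> connected_words \<and> w ! 0 = Push Red \<and> pushes w = n.
      [:0, 1:] ^ left_right_pairs (arch_system_of w))"
    unfolding arch_gf_def fps_nth_Abs_fps
    by (rule sum.reindex_bij_betw[OF bij_betw_arch_system_of, symmetric])
  also have "\<dots> = (\<Sum>w | w \<in> connected_words \<and> w ! 0 = Push Red \<and> pushes w = n. [:0, 1:] ^ lr_count w)"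
    by (rule sum.cong) (auto simp: left_right_pairs_arch_system_of connected_words_def)
  finally show ?thesis .
qed

text \<open>Covers the embeddings of both substitutions: constant polynomials in a for loops, the
  identity on the rationals for permutations. The coefficients of \<open>arch_gf\<close> are sums of
  powers of b, so additivity and the values at 0 and 1 are all that is needed to evaluate
  them.\<close>

locale ring_embedding =
  fixes h :: "rat \<Rightarrow> 'r::comm_ring_1"
  assumes h_0 [simp]: "h 0 = 0" and h_1 [simp]: "h 1 = 1" and h_add: "h (x + y) = h x + h y"
begin

lemma poly_map_add:
  "poly (map_poly (\<lambda>r. fps_const (h r)) (p + q)) B =
   poly (map_poly (\<lambda>r. fps_const (h r)) p) B + poly (map_poly (\<lambda>r. fps_const (h r)) q) B"
proof -
  have "map_poly (\<lambda>r. fps_const (h r)) (p + q) = map_poly (\<lambda>r. fps_const (h r)) p + map_poly (\<lambda>r. fps_const (h r)) q"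
    by (rule poly_eqI) (simp add: coeff_map_poly h_add)
  then show ?thesis by simp
qed

lemma poly_map_sum:
  "poly (map_poly (\<lambda>r. fps_const (h r)) (\<Sum>x\<in>X. p x)) B = (\<Sum>x\<in>X. poly (map_poly (\<lambda>r. fps_const (h r)) (p x)) B)"
  by (induction X rule: infinite_finite_induct) (simp_all add: poly_map_add)

lemma poly_map_power: "poly (map_poly (\<lambda>r. fps_const (h r)) ([:0, 1:] ^ k)) B = B ^ k"
proof -
  have "[:0, 1:] ^ k = (monom 1 k :: rat poly)" by (simp add: monom_altdef)
  then show ?thesis by (simp add: map_poly_monom poly_monom)
qed

lemma fps_subst_arch_gf:
  "fps_subst h arch_gf B V $ n =
    (\<Sum>w | w \<in> connected_words \<and> w ! 0 = Push Red \<and> pushes w \<le> n. (B ^ lr_count w * V ^ pushes w) $ n)"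
proof -
  let ?K = "\<lambda>i. {w \<in> connected_words. w ! 0 = Push Red \<and> pushes w = i}"
  have fin: "finite (?K i)" for i
    by (rule finite_subset[OF _ finite_op_sequences[of i]]) (auto simp: connected_words_def)
  have "fps_subst h arch_gf B V $ n = (\<Sum>i=0..n. \<Sum>w\<in>?K i. (B ^ lr_count w * V ^ pushes w) $ n)"
    unfolding fps_subst_def fps_nth_Abs_fps arch_gf_nth poly_map_sum poly_map_power
    by (simp add: sum_distrib_right fps_sum_nth)
  also have "\<dots> = (\<Sum>w\<in>(\<Union>i\<in>{0..n}. ?K i). (B ^ lr_count w * V ^ pushes w) $ n)"
    using fin by (intro sum.UNION_disjoint[symmetric]) auto
  also have "(\<Union>i\<in>{0..n}. ?K i) = {w \<in> connected_words. w ! 0 = Push Red \<and> pushes w \<le> n}"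
    by auto
  finally show ?thesis .
qed

end

section \<open>Operation sequences counted by skeletons and their fillings\<close>

definition words :: "bool \<Rightarrow> operation list set" where
  "words std = {w. op_sequence w \<and> (std \<longrightarrow> standard_arches (arcs w))}"

lemma finite_words_level: "finite {w \<in> words std. pushes w = n}"
  by (rule finite_subset[OF _ finite_op_sequences[of n]]) (auto simp: words_def)

lemma Nil_in_words [simp]: "[] \<in> words std"
proof -
  have "arcs [] = {}" by (simp add: arcs_def)
  then show ?thesis
    by (simp add: words_def op_sequence_def standard_arches_iff)
qed

lemma words_pushes_0: "w \<in> words std \<Longrightarrow> pushes w = 0 \<longleftrightarrow> w = []"
  using op_sequence_pushes_pops(2)[of w] by (auto simp: words_def)

text \<open>The flag lets one computation serve both equations: \<open>std = False\<close> with the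
  variable a gives the loop series, \<open>std = True\<close> with a = 0 the permutation
  series.\<close>

definition word_gf :: "bool \<Rightarrow> 'r::comm_ring_1 \<Rightarrow> 'r fps" where
  "word_gf std a = gf (words std) pushes (\<lambda>w. a ^ lr_count w)"

lemma word_gf_0: "word_gf std a $ 0 = 1"
proof -
  have "{w \<in> words std. pushes w = 0} = {[]}" using words_pushes_0 by auto
  then show ?thesis by (simp add: word_gf_def gf_nth)
qed

definition fillings :: "bool \<Rightarrow> operation list \<Rightarrow> (operation \<times> operation list) list set" where
  "fillings std K = {ps. map fst ps = K \<and> (\<forall>g\<in>snd ` set ps. g \<in> words std)}"

definition filling_size :: "(operation \<times> operation list) list \<Rightarrow> nat" where
  "filling_size ps = sum_list (map (pushes \<circ> snd) ps)"

text \<open>\<open>F\<close> is the contribution of an ordinary gap and \<open>F'\<close> that of a gap separating a left-right pair of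
  the skeleton.\<close>

fun gap_product :: "'r::comm_ring_1 fps \<Rightarrow> 'r fps \<Rightarrow> operation list \<Rightarrow> 'r fps" where
  "gap_product F F' [] = 1"
| "gap_product F F' [x] = F"
| "gap_product F F' (x # y # K) = (if left_right x y then F' else F) * gap_product F F' (y # K)"

lemma lr_count_assemble_single:
  assumes "op_sequence g"
  shows "lr_count (x # g) = lr_count g"
proof (cases g)
  case (Cons y g')
  then have "\<not> left_right x y" using op_sequence_first[OF assms] by (auto simp: left_right_iff)
  then show ?thesis using Cons by simp
qed simp

text \<open>A non-empty gap starts with a push and ends with a pop, while a left-right pair needs a
  pop on its right and a push on its left. So a gap forms no pair with its neighbours, and
  \<open>x\<close> and \<open>y\<close> meet only across an empty gap.\<close>

lemma lr_count_assemble_step: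
  assumes g: "op_sequence g"
  shows "lr_count (x # g @ y # v) = lr_count g + lr_count (y # v) + (if g = [] \<and> left_right x y then 1 else 0)"
proof (cases "g = []")
  case False
  have "\<not> left_right (last g) y" using op_sequence_first(2)[OF g False] by (auto simp: left_right_iff)
  then have "lr_count ((x # g) @ y # v) = lr_count (x # g) + lr_count (y # v)"
    unfolding adj_count_append using False by simp
  then show ?thesis using lr_count_assemble_single[OF g] False by simp
qed simp

lemma finite_fillings: "finite {ps \<in> fillings std K. filling_size ps = n}"
proof (induction K arbitrary: n)
  case Nil
  then show ?case by (simp add: fillings_def)
next
  case (Cons x K)
  have "{ps \<in> fillings std (x # K). filling_size ps = n} \<subseteq>
    (\<lambda>(g, ps). (x, g) # ps) ` ((\<Union>i\<in>{..n}. {g \<in> words std. pushes g = i}) \<times>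
       (\<Union>i\<in>{..n}. {ps \<in> fillings std K. filling_size ps = i}))"
  proof
    fix qs assume qs: "qs \<in> {ps \<in> fillings std (x # K). filling_size ps = n}"
    then obtain g ps where e: "qs = (x, g) # ps" "map fst ps = K" by (auto simp: fillings_def)
    then have "g \<in> words std" "pushes g \<le> n" "ps \<in> fillings std K" "filling_size ps \<le> n"
      using qs by (auto simp: fillings_def filling_size_def)
    then show "qs \<in> (\<lambda>(g, ps). (x, g) # ps) ` ((\<Union>i\<in>{..n}. {g \<in> words std. pushes g = i}) \<times>
       (\<Union>i\<in>{..n}. {ps \<in> fillings std K. filling_size ps = i}))"
      using e by (intro image_eqI[of _ _ "(g, ps)"]) auto
  qed
  moreover have "finite ((\<lambda>(g, ps). (x, g) # ps) ` ((\<Union>i\<in>{..n}. {g \<in> words std. pushes g = i}) \<times>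
       (\<Union>i\<in>{..n}. {ps \<in> fillings std K. filling_size ps = i})))"
    using Cons finite_words_level by (intro finite_imageI finite_cartesian_product finite_UN_I) simp_all
  ultimately show ?case by (rule finite_subset)
qed

text \<open>The gaps are filled independently, so the first one splits off as a factor. The gap
  after the last letter separates no pair, which is why a single letter is a case of its
  own.\<close>

lemma gf_fillings:
  "gf (fillings std K) filling_size (\<lambda>ps. a ^ lr_count (assemble ps)) =
   gap_product (word_gf std a) (word_gf std a - 1 + fps_const a) K"
proof (induction K rule: induct_list012)
  case 1
  have "{ps. ps \<in> fillings std [] \<and> filling_size ps = n} = (if n = 0 then {[]} else {})" for n
    by (auto simp: fillings_def filling_size_def)
  then show ?case by (intro fps_ext) (simp add: gf_nth)
next
  case (2 x)
  have "gf (fillings std [x]) filling_size (\<lambda>ps. a ^ lr_count (assemble ps)) = word_gf std a"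
    unfolding word_gf_def
  proof (rule gf_bij_betw)
    show "bij_betw (\<lambda>g. [(x, g)]) (words std) (fillings std [x])"
      unfolding bij_betw_def by (auto simp: fillings_def inj_on_def)
  qed (auto simp: filling_size_def words_def lr_count_assemble_single)
  then show ?case by simp
next
  case (3 x y K)
  \<comment> \<open>The factor a of a pair formed by \<open>x\<close> and \<open>y\<close> is
    charged to the gap between them. Only the empty filling pays it, so the constant term 1 of the
    gap series turns into a.\<close>
  define wt where "wt g = a ^ lr_count g * (if g = [] \<and> left_right x y then a else 1)" for g
  have "gf (fillings std (x # y # K)) filling_size (\<lambda>ps. a ^ lr_count (assemble ps)) =
    gf (words std \<times> fillings std (y # K)) (\<lambda>(g, ps). pushes g + filling_size ps)
      (\<lambda>(g, ps). wt g * a ^ lr_count (assemble ps))"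
  proof (rule gf_bij_betw)
    show "bij_betw (\<lambda>(g, ps). (x, g) # ps) (words std \<times> fillings std (y # K)) (fillings std (x # y # K))"
      unfolding bij_betw_def
    proof (intro conjI equalityI subsetI)
      fix qs assume qs: "qs \<in> fillings std (x # y # K)"
      then obtain g ps where e: "qs = (x, g) # ps" "map fst ps = y # K" by (auto simp: fillings_def)
      then have "g \<in> words std" "ps \<in> fillings std (y # K)"
        using qs by (auto simp: fillings_def)
      then show "qs \<in> (\<lambda>(g, ps). (x, g) # ps) ` (words std \<times> fillings std (y # K))"
        using e by (intro image_eqI[of _ _ "(g, ps)"]) auto
    qed (auto simp: fillings_def inj_on_def)
  next
    fix p assume "p \<in> words std \<times> fillings std (y # K)"
    then obtain g ps where p: "p = (g, ps)" "g \<in> words std" "ps \<in> fillings std (y # K)" by blast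
    then obtain g' ps' where ps: "ps = (y, g') # ps'" by (auto simp: fillings_def)
    show "filling_size (case p of (g, ps) \<Rightarrow> (x, g) # ps) = (case p of (g, ps) \<Rightarrow> pushes g + filling_size ps)"
      using p by (simp add: filling_size_def)
    have "op_sequence g" using p(2) by (simp add: words_def)
    from lr_count_assemble_step[OF this, of x y "g' @ assemble ps'"]
    show "a ^ lr_count (assemble (case p of (g, ps) \<Rightarrow> (x, g) # ps)) =
        (case p of (g, ps) \<Rightarrow> wt g * a ^ lr_count (assemble ps))"
      using p(1) ps by (simp add: wt_def power_add mult_ac)
  qed
  also have "\<dots> = gf (words std) pushes wt * gf (fillings std (y # K)) filling_size (\<lambda>ps. a ^ lr_count (assemble ps))"
    by (rule gf_times[OF finite_words_level finite_fillings])
  also have "gf (words std) pushes wt = (if left_right x y then word_gf std a - 1 + fps_const a else word_gf std a)"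
  proof (rule fps_ext)
    fix n
    show "gf (words std) pushes wt $ n = (if left_right x y then word_gf std a - 1 + fps_const a else word_gf std a) $ n"
    proof (cases "n = 0")
      case True
      have "{w \<in> words std. pushes w = 0} = {[]}" using words_pushes_0 by auto
      then show ?thesis using True by (simp add: gf_nth wt_def word_gf_0)
    next
      case False
      have "gf (words std) pushes wt $ n = word_gf std a $ n"
        unfolding gf_nth word_gf_def using False by (intro sum.cong) (auto simp: wt_def)
      then show ?thesis using False by simp
    qed
  qed
  finally show ?case using 3 by simp
qed

lemma gap_product_eq:
  assumes "F' = F * B"
  shows "gap_product F F' K = F ^ length K * B ^ lr_count K"
  using assms by (induction F F' K rule: gap_product.induct) (simp_all add: mult_ac)

lemma pushes_assemble: "pushes (assemble ps) = pushes (map fst ps) + filling_size ps"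
  by (induction ps) (auto simp: filling_size_def)

definition skeletons :: "bool \<Rightarrow> operation list set" where
  "skeletons std = {K \<in> connected_words. std \<longrightarrow> K ! 0 = Push Red}"

lemma connected_words_pushes:
  assumes "K \<in> connected_words"
  shows "K \<noteq> []" "pushes K \<noteq> 0"
proof -
  show "K \<noteq> []" using assms by (auto simp: connected_words_def connected_arches_def arcs_def)
  then show "pushes K \<noteq> 0"
    using op_sequence_pushes_pops(2)[of K] assms by (auto simp: connected_words_def)
qed

lemma bij_betw_assemble_fillings:
  "bij_betw assemble (\<Union>K\<in>{K \<in> skeletons std. pushes K \<le> n}. {ps \<in> fillings std K. filling_size ps = n - pushes K})
     {w \<in> words std. w \<noteq> [] \<and> pushes w = n}"
proof -
  have D: "(\<Union>K\<in>{K \<in> skeletons std. pushes K \<le> n}. {ps \<in> fillings std K. filling_size ps = n - pushes K})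
    = {ps. decomposition ps \<and> assemble ps \<in> words std \<and> pushes (assemble ps) = n}" (is "?L = ?R")
  proof (intro equalityI subsetI)
    fix ps assume "ps \<in> ?L"
    then have K: "map fst ps \<in> skeletons std" "pushes (map fst ps) \<le> n" "\<forall>g\<in>snd ` set ps. g \<in> words std"
      "filling_size ps = n - pushes (map fst ps)"
      by (auto simp: fillings_def)
    then have d: "decomposition ps"
      by (auto simp: decomposition_def skeletons_def connected_words_def words_def)
    have "map fst ps ! 0 = fst (ps ! 0)" using decomposition_nonempty[OF d] by simp
    then have "assemble ps \<in> words std"
      using K op_sequence_assemble[OF d] standard_assemble[OF d] by (simp add: words_def skeletons_def)
    then show "ps \<in> ?R" using d K pushes_assemble[of ps] by simp
  next
    fix ps assume "ps \<in> ?R"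
    then have d: "decomposition ps" and a: "assemble ps \<in> words std" "pushes (assemble ps) = n" by simp_all
    have 0: "map fst ps ! 0 = fst (ps ! 0)" using decomposition_nonempty[OF d] by simp
    have "map fst ps \<in> skeletons std"
      using d a 0 standard_assemble[OF d]
      by (simp add: words_def skeletons_def connected_words_def decomposition_def)
    moreover have "\<forall>g\<in>snd ` set ps. g \<in> words std"
      using d a standard_assemble[OF d] by (simp add: words_def decomposition_def)
    ultimately show "ps \<in> ?L"
      using a(2) pushes_assemble[of ps] by (intro UN_I[of "map fst ps"]) (simp_all add: fillings_def)
  qed
  show ?thesis
    unfolding D bij_betw_def
  proof
    show "inj_on assemble ?R" using inj_on_assemble by (rule inj_on_subset) blast
    show "assemble ` ?R = {w \<in> words std. w \<noteq> [] \<and> pushes w = n}"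
    proof (intro equalityI subsetI)
      fix w assume "w \<in> assemble ` ?R"
      then obtain ps where ps: "w = assemble ps" "ps \<in> ?R" by blast
      then have "w \<noteq> []" using bij_betw_apply[OF bij_betw_assemble, of ps] by simp
      then show "w \<in> {w \<in> words std. w \<noteq> [] \<and> pushes w = n}" using ps by simp
    next
      fix w assume w: "w \<in> {w \<in> words std. w \<noteq> [] \<and> pushes w = n}"
      then obtain ps where "decomposition ps" "assemble ps = w"
        using decomposition_exists[of w] by (auto simp: words_def)
      then show "w \<in> assemble ` ?R" using w by blast
    qed
  qed
qed

lemma finite_skeletons: "finite {K \<in> skeletons std. pushes K \<le> n}"
proof -
  have "{K \<in> skeletons std. pushes K \<le> n} \<subseteq> (\<Union>i\<in>{..n}. {w. op_sequence w \<and> pushes w = i})"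
    by (auto simp: skeletons_def connected_words_def)
  then show ?thesis by (rule finite_subset) (intro finite_UN_I finite_atMost finite_op_sequences)
qed

text \<open>The inverse of \<open>F\<close> is a parameter, so that \<open>fps_right_inverse\<close>
  over polynomials and division over the rationals are both instances. A skeleton with m arches has
  2m gaps and yields m factors \<open>fps_X * F\<^sup>2\<close>; each of its left-right pairs adds a
  factor \<open>B\<close>, because \<open>F - 1 + fps_const a = F * B\<close>.\<close>

lemma word_gf_skeletons:
  fixes a :: "'r::comm_ring_1"
  assumes F: "F = word_gf std a" and I: "F * I = 1" and B: "B = 1 - (1 - fps_const a) * I"
  shows "F $ n = (if n = 0 then 1 else 0) +
    (\<Sum>K | K \<in> skeletons std \<and> pushes K \<le> n. (B ^ lr_count K * (fps_X * F\<^sup>2) ^ pushes K) $ n)"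
proof -
  let ?D = "\<lambda>K. {ps \<in> fillings std K. filling_size ps = n - pushes K}"
  have FB: "F - 1 + fps_const a = F * B"
  proof -
    have "F * B = F - (1 - fps_const a) * (F * I)" by (simp add: B algebra_simps)
    then show ?thesis by (simp add: I)
  qed
  have "F $ n = (if n = 0 then 1 else 0) + (\<Sum>w\<in>{w \<in> words std. w \<noteq> [] \<and> pushes w = n}. a ^ lr_count w)"
  proof (cases "n = 0")
    case True
    have "{w \<in> words std. w \<noteq> [] \<and> pushes w = 0} = {}" using words_pushes_0 by blast
    then have "(\<Sum>w\<in>{w \<in> words std. w \<noteq> [] \<and> pushes w = 0}. a ^ lr_count w) = 0" by (simp only: sum.empty)
    then show ?thesis using True word_gf_0[of std a] F by simp
  next
    case False
    then have "{w \<in> words std. pushes w = n} = {w \<in> words std. w \<noteq> [] \<and> pushes w = n}" by auto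
    then show ?thesis unfolding F word_gf_def gf_nth using False by simp
  qed
  also have "(\<Sum>w\<in>{w \<in> words std. w \<noteq> [] \<and> pushes w = n}. a ^ lr_count w) =
      (\<Sum>ps\<in>(\<Union>K\<in>{K \<in> skeletons std. pushes K \<le> n}. ?D K). a ^ lr_count (assemble ps))"
    by (rule sum.reindex_bij_betw[OF bij_betw_assemble_fillings, symmetric])
  also have "\<dots> = (\<Sum>K\<in>{K \<in> skeletons std. pushes K \<le> n}. \<Sum>ps\<in>?D K. a ^ lr_count (assemble ps))"
  proof (rule sum.UNION_disjoint[OF finite_skeletons])
    show "\<forall>K\<in>{K \<in> skeletons std. pushes K \<le> n}. finite (?D K)" using finite_fillings by blast
    show "\<forall>K\<in>{K \<in> skeletons std. pushes K \<le> n}. \<forall>K'\<in>{K \<in> skeletons std. pushes K \<le> n}. K \<noteq> K' \<longrightarrow> ?D K \<inter> ?D K' = {}"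
      by (auto simp: fillings_def)
  qed
  also have "\<dots> = (\<Sum>K\<in>{K \<in> skeletons std. pushes K \<le> n}. (B ^ lr_count K * (fps_X * F\<^sup>2) ^ pushes K) $ n)"
  proof (rule sum.cong[OF refl])
    fix K assume K: "K \<in> {K \<in> skeletons std. pushes K \<le> n}"
    then have len: "length K = 2 * pushes K"
      using op_sequence_pushes_pops(2) by (simp add: skeletons_def connected_words_def)
    have "(\<Sum>ps\<in>?D K. a ^ lr_count (assemble ps)) = gap_product F (F * B) K $ (n - pushes K)"
      using arg_cong[OF gf_fillings[of std K a], of "\<lambda>f. f $ (n - pushes K)"]
      unfolding F[symmetric] FB gf_nth .
    also have "\<dots> = (fps_X ^ pushes K * (F ^ (2 * pushes K) * B ^ lr_count K)) $ n"
      using K by (simp add: gap_product_eq len fps_X_power_mult_nth)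
    also have "fps_X ^ pushes K * (F ^ (2 * pushes K) * B ^ lr_count K) =
        B ^ lr_count K * (fps_X * F\<^sup>2) ^ pushes K"
      by (simp add: power_mult_distrib power_mult mult_ac)
    finally show "(\<Sum>ps\<in>?D K. a ^ lr_count (assemble ps)) = (B ^ lr_count K * (fps_X * F\<^sup>2) ^ pushes K) $ n" .
  qed
  finally show ?thesis by simp
qed

context ring_embedding
begin

lemma word_gf_equation:
  assumes F: "F = word_gf std a" and I: "F * I = 1" and B: "B = 1 - (1 - fps_const a) * I"
  shows "F = 1 + (if std then 1 else 2) * fps_subst h arch_gf B (fps_X * F\<^sup>2)"
proof (rule fps_ext)
  fix n
  let ?t = "\<lambda>K. (B ^ lr_count K * (fps_X * F\<^sup>2) ^ pushes K) $ n"
  let ?R = "{K. K \<in> connected_words \<and> K ! 0 = Push Red \<and> pushes K \<le> n}"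
  let ?B = "{K. K \<in> connected_words \<and> K ! 0 = Push Blue \<and> pushes K \<le> n}"
  have step: "(\<Sum>K | K \<in> skeletons std \<and> pushes K \<le> n. ?t K) = (if std then 1 else 2) * (\<Sum>K\<in>?R. ?t K)"
  proof (cases std)
    case True
    then have "{K. K \<in> skeletons std \<and> pushes K \<le> n} = ?R" unfolding skeletons_def by blast
    then show ?thesis using True by (simp only: if_True mult_1)
  next
    case False
    have hd: "K ! 0 = Push Red \<or> K ! 0 = Push Blue" if "K \<in> connected_words" for K
    proof -
      have "op_sequence K" using that by (simp add: connected_words_def)
      then have "is_push (K ! 0)" using connected_words_pushes(1)[OF that] by (rule op_sequence_first(1))
      then obtain c where "K ! 0 = Push c" unfolding is_push_cases(1) ..
      then show ?thesis by (cases c) simp_all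
    qed
    have split: "{K. K \<in> skeletons std \<and> pushes K \<le> n} = ?R \<union> ?B"
      unfolding skeletons_def using False hd by blast
    have fin: "finite (?R \<union> ?B)"
      by (rule finite_subset[OF _ finite_skeletons[of False n]]) (auto simp: skeletons_def)
    have "?R \<inter> ?B = {}" by auto
    then have "sum ?t (?R \<union> ?B) = sum ?t ?R + sum ?t ?B"
      using fin[unfolded finite_Un] by (intro sum.union_disjoint) simp_all
    then have sp: "(\<Sum>K | K \<in> skeletons std \<and> pushes K \<le> n. ?t K) = sum ?t ?R + sum ?t ?B"
      unfolding split .
    \<comment> \<open>Exchanging the colours turns skeletons starting in red into those starting in
      blue and preserves the numbers of arches and of left-right pairs, so the two sums
      agree.\<close>
    have "bij_betw (map swap_op) ?R ?B"
    proof (rule bij_betwI[where g = "map swap_op"])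
      have "map swap_op K \<in> connected_words \<and> map swap_op K ! 0 = swap_op (K ! 0) \<and> pushes (map swap_op K) = pushes K"
        if "K \<in> connected_words" for K
        using connected_words_swap[OF that] connected_words_pushes(1)[OF that] pushes_swap[of K] by simp
      then show "map swap_op \<in> ?R \<rightarrow> ?B" "map swap_op \<in> ?B \<rightarrow> ?R" by (intro funcsetI; simp)+
    qed (simp_all add: o_def)
    then have "sum ?t ?B = sum (\<lambda>K. ?t (map swap_op K)) ?R"
      by (rule sum.reindex_bij_betw[symmetric])
    then have "sum ?t ?B = sum ?t ?R" unfolding lr_count_swap pushes_swap .
    then show ?thesis unfolding sp using False by (simp only: if_False mult_2)
  qed
  have "F $ n = (if n = 0 then 1 else 0) +
      (if std then 1 else 2) * fps_subst h arch_gf B (fps_X * F\<^sup>2) $ n"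
    unfolding fps_subst_arch_gf word_gf_skeletons[OF F I B, of n] step by (rule refl)
  moreover have "((if std then 1 else 2) * fps_subst h arch_gf B (fps_X * F\<^sup>2)) $ n
      = (if std then 1 else 2) * fps_subst h arch_gf B (fps_X * F\<^sup>2) $ n"
    by (cases std) (simp_all only: if_True if_False mult_1 mult_2 fps_add_nth)
  ultimately show "F $ n = (1 + (if std then 1 else 2) * fps_subst h arch_gf B (fps_X * F\<^sup>2)) $ n"
    by (simp only: fps_add_nth fps_one_nth)
qed

end

section \<open>Uniqueness of the solutions of the two substitution equations\<close>

lemma arch_gf_0: "arch_gf $ 0 = 0"
proof -
  have "{w. w \<in> connected_words \<and> w ! 0 = Push Red \<and> pushes w = 0} = {}"
    using connected_words_pushes(2) by blast
  then show ?thesis by (simp only: arch_gf_nth sum.empty)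
qed

text \<open>Evaluating at a series with constant term a returns, in the constant term, the
  polynomial itself. The series 1 - (1 - a) / Q is of this kind because Q has constant term
  1.\<close>

lemma poly_embed_nth_0:
  fixes B :: "rat poly fps"
  assumes "B $ 0 = [:0, 1:]"
  shows "poly (map_poly (\<lambda>r. fps_const [:r:]) p) B $ 0 = p"
proof (induction p)
  case (pCons c p)
  then show ?case by (simp add: map_poly_pCons assms)
qed simp

text \<open>Triangularity: the power with exponent \<open>n\<close> of
  \<open>fps_X * F\<^sup>2\<close> starts at order \<open>n\<close> with coefficient 1, so
  coefficient \<open>n\<close> of the substitution is that of \<open>C\<close> plus terms in which
  only earlier coefficients of \<open>C\<close> occur.\<close>

lemma fps_subst_top_coeff:
  fixes C :: "rat poly fps"
  assumes "B $ 0 = [:0, 1:]" "F $ 0 = 1"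
  shows "fps_subst (\<lambda>r. [:r:]) C B (fps_X * F\<^sup>2) $ n = C $ n +
    (\<Sum>i<n. (poly (map_poly (\<lambda>r. fps_const [:r:]) (C $ i)) B * (fps_X * F\<^sup>2) ^ i) $ n)"
proof -
  let ?t = "\<lambda>i. (poly (map_poly (\<lambda>r. fps_const [:r:]) (C $ i)) B * (fps_X * F\<^sup>2) ^ i) $ n"
  have "?t n = (fps_X ^ n * (poly (map_poly (\<lambda>r. fps_const [:r:]) (C $ n)) B * (F\<^sup>2) ^ n)) $ n"
    by (simp add: power_mult_distrib mult_ac)
  also have "\<dots> = C $ n"
    by (simp add: fps_X_power_mult_nth fps_power_zeroth poly_embed_nth_0 assms)
  finally have "?t n = C $ n" .
  moreover have "{0..n} = insert n {..<n}" by auto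
  ultimately show ?thesis by (simp add: fps_subst_def)
qed

lemma arch_equation_unique:
  assumes "Q $ 0 = 1" "arch_equation Q C" "arch_equation Q D"
  shows "C = D"
proof -
  define B where "B = 1 - (1 - fps_const [:0, 1:]) * fps_right_inverse Q 1"
  have B0: "B $ 0 = [:0, 1:]" by (simp add: B_def)
  have "Q = 1 + 2 * fps_subst (\<lambda>r. [:r:]) C B (fps_X * Q\<^sup>2)"
    "Q = 1 + 2 * fps_subst (\<lambda>r. [:r:]) D B (fps_X * Q\<^sup>2)"
    using assms(2,3) unfolding arch_equation_def Let_def B_def by - assumption+
  then have "1 + 2 * fps_subst (\<lambda>r. [:r:]) C B (fps_X * Q\<^sup>2) = 1 + 2 * fps_subst (\<lambda>r. [:r:]) D B (fps_X * Q\<^sup>2)"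
    by (rule trans[OF sym])
  then have eq: "fps_subst (\<lambda>r. [:r:]) C B (fps_X * Q\<^sup>2) = fps_subst (\<lambda>r. [:r:]) D B (fps_X * Q\<^sup>2)"
    by simp
  show ?thesis
  proof (rule fps_ext)
    fix n
    show "C $ n = D $ n"
    proof (induction n rule: less_induct)
      case (less n)
      have "(\<Sum>i<n. (poly (map_poly (\<lambda>r. fps_const [:r:]) (C $ i)) B * (fps_X * Q\<^sup>2) ^ i) $ n)
          = (\<Sum>i<n. (poly (map_poly (\<lambda>r. fps_const [:r:]) (D $ i)) B * (fps_X * Q\<^sup>2) ^ i) $ n)"
        by (rule sum.cong) (simp_all add: less)
      then show ?case
        using arg_cong[OF eq, of "\<lambda>f. f $ n"] by (simp add: fps_subst_top_coeff[OF B0 assms(1)])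
    qed
  qed
qed

text \<open>Congruence modulo the \<open>m\<close>-th power of the variable, hence compatible with
  the ring operations.\<close>

definition agree :: "nat \<Rightarrow> 'r::comm_ring_1 fps \<Rightarrow> 'r fps \<Rightarrow> bool" where
  "agree m f g \<longleftrightarrow> (\<forall>k<m. f $ k = g $ k)"

lemma agreeD: "agree m f g \<Longrightarrow> k < m \<Longrightarrow> f $ k = g $ k"
  by (simp add: agree_def)

lemma agree_refl: "agree m f f"
  by (simp add: agree_def)

lemma agree_add: "agree m f g \<Longrightarrow> agree m f' g' \<Longrightarrow> agree m (f + f') (g + g')"
  by (simp add: agree_def)

lemma agree_diff: "agree m f g \<Longrightarrow> agree m f' g' \<Longrightarrow> agree m (f - f') (g - g')"
  by (simp add: agree_def)

lemma agree_mult: "agree m f g \<Longrightarrow> agree m f' g' \<Longrightarrow> agree m (f * f') (g * g')"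
  by (simp add: agree_def fps_mult_nth)

lemma agree_power: "agree m f g \<Longrightarrow> agree m (f ^ k) (g ^ k)"
  by (induction k) (simp_all add: agree_refl agree_mult)

lemma agree_poly: "agree m f g \<Longrightarrow> agree m (poly p f) (poly p g)"
  by (induction p) (simp_all add: agree_refl agree_add agree_mult)

text \<open>Both inverses are multiples of \<open>f' * g'\<close>, namely by \<open>g\<close> and by \<open>f\<close>.\<close>

lemma agree_inverse:
  assumes "agree m f g" "f * f' = 1" "g * g' = 1"
  shows "agree m f' g'"
proof -
  have "agree m (f' * g' * g) (f' * g' * f)"
    using assms(1) by (intro agree_mult agree_refl) (simp add: agree_def)
  moreover have "f' * g' * g = f' * (g * g')" "f' * g' * f = g' * (f * f')" by (simp_all add: mult_ac)
  ultimately show ?thesis using assms(2,3) by simp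
qed

lemma fps_mult_one_divide:
  fixes F :: "'a::field fps"
  assumes "F $ 0 = 1"
  shows "F * (1 / F) = 1"
proof -
  have "F $ 0 \<noteq> 0" using assms by simp
  then show ?thesis
    unfolding fps_divide_unit[OF \<open>F $ 0 \<noteq> 0\<close>] mult_1_left by (rule inverse_mult_eq_1')
qed

text \<open>If \<open>S\<close> and \<open>T\<close> agree below order \<open>n\<close>, then so do
  the right-hand sides at order \<open>n\<close>: the term with i = 0 vanishes because
  \<open>C $ 0 = 0\<close>, and for i > 0 the factor \<open>fps_X ^ i\<close> leaves only
  coefficients of order n - i, which is below n.\<close>

lemma stack_equation_unique:
  fixes S T :: "rat fps"
  assumes C: "C $ 0 = 0" and S: "S $ 0 = 1" "stack_equation C S" and T: "T $ 0 = 1" "stack_equation C T"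
  shows "S = T"
proof (rule fps_ext)
  fix n
  show "S $ n = T $ n"
  proof (induction n rule: less_induct)
    case (less n)
    have ag: "agree n S T" using less by (simp add: agree_def)
    have "agree n (1 / S) (1 / T)"
      by (rule agree_inverse[OF ag fps_mult_one_divide fps_mult_one_divide]) (rule S(1) T(1))+
    then have agB: "agree n (1 - 1 / S) (1 - 1 / T)" by (intro agree_diff agree_refl)
    have "(poly (map_poly (\<lambda>r. fps_const r) (C $ i)) (1 - 1 / S) * (fps_X * S\<^sup>2) ^ i) $ n
      = (poly (map_poly (\<lambda>r. fps_const r) (C $ i)) (1 - 1 / T) * (fps_X * T\<^sup>2) ^ i) $ n" if "i \<le> n" for i
    proof (cases "i = 0")
      case True
      then show ?thesis by (simp add: C)
    next
      case False
      have shift: "(p * (fps_X * U\<^sup>2) ^ i) $ n = (p * (U\<^sup>2) ^ i) $ (n - i)" for p U :: "rat fps"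
      proof -
        have eq: "p * (fps_X * U\<^sup>2) ^ i = fps_X ^ i * (p * (U\<^sup>2) ^ i)"
          unfolding power_mult_distrib by (rule mult.left_commute)
        show ?thesis unfolding eq fps_X_power_mult_nth using that by simp
      qed
      have "agree n (poly (map_poly (\<lambda>r. fps_const r) (C $ i)) (1 - 1 / S) * (S\<^sup>2) ^ i)
          (poly (map_poly (\<lambda>r. fps_const r) (C $ i)) (1 - 1 / T) * (T\<^sup>2) ^ i)"
        by (intro agree_mult agree_poly agB agree_power ag)
      then show ?thesis
        unfolding shift by (rule agreeD) (use False that in simp)
    qed
    then have eq: "fps_subst (\<lambda>r. r) C (1 - 1 / S) (fps_X * S\<^sup>2) $ n = fps_subst (\<lambda>r. r) C (1 - 1 / T) (fps_X * T\<^sup>2) $ n"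
      unfolding fps_subst_def fps_nth_Abs_fps by (intro sum.cong) simp_all
    have "S $ n = (1 + fps_subst (\<lambda>r. r) C (1 - 1 / S) (fps_X * S\<^sup>2)) $ n"
      using S(2) unfolding stack_equation_def Let_def by (rule arg_cong)
    also have "\<dots> = (1 + fps_subst (\<lambda>r. r) C (1 - 1 / T) (fps_X * T\<^sup>2)) $ n"
      by (simp only: fps_add_nth eq)
    also have "\<dots> = T $ n"
      using T(2) unfolding stack_equation_def Let_def by (rule arg_cong[OF sym])
    finally show ?case .
  qed
qed

text \<open>As \<open>0 ^ 0 = 1\<close>, putting a = 0 keeps exactly the words without left-right
  pairs, that is, the canonical ones.\<close>

lemma stack_gf_word_gf: "stack_gf = word_gf True 0"
proof (rule fps_ext)
  fix n
  have "word_gf True (0::rat) $ n = (\<Sum>w\<in>{w \<in> words True. pushes w = n}. if lr_count w = 0 then 1 else 0)"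
    unfolding word_gf_def gf_nth by (rule sum.cong[OF refl]) (rule power_0_left)
  also have "\<dots> = of_nat (card {w \<in> {w \<in> words True. pushes w = n}. lr_count w = 0})"
  proof -
    have "(\<Sum>w\<in>{w \<in> {w \<in> words True. pushes w = n}. lr_count w = 0}. 1::rat)
      = (\<Sum>w\<in>{w \<in> words True. pushes w = n}. if lr_count w = 0 then 1 else 0)"
      by (rule sum.inter_filter[OF finite_words_level])
    then show ?thesis by (simp only: sum_constant mult_1_right)
  qed
  also have "{w \<in> {w \<in> words True. pushes w = n}. lr_count w = 0} = {w. canonical w \<and> pushes w = n}"
    unfolding words_def canonical_def by blast
  finally show "stack_gf $ n = word_gf True 0 $ n" 
    unfolding stack_gf_def card_stack_perms fps_nth_Abs_fps by (rule sym)
qed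

lemma stack_equation_stack_gf: "stack_gf $ 0 = 1" "stack_equation arch_gf stack_gf"
proof -
  interpret ring_embedding "\<lambda>r::rat. r" by unfold_locales simp_all
  show 0: "stack_gf $ 0 = 1" unfolding stack_gf_word_gf by (rule word_gf_0)
  have "1 - 1 / stack_gf = 1 - (1 - fps_const 0) * (1 / stack_gf)"
    by (simp only: fps_const_0_eq_0 diff_zero mult_1_left)
  from word_gf_equation[OF stack_gf_word_gf fps_mult_one_divide[OF 0] this]
  show "stack_equation arch_gf stack_gf"
    unfolding stack_equation_def Let_def if_True mult_1 .
qed

lemma stack_equation_iff:
  "S $ 0 = 1 \<and> stack_equation arch_gf S \<longleftrightarrow> S = stack_gf"
proof
  assume "S $ 0 = 1 \<and> stack_equation arch_gf S"
  then show "S = stack_gf"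
    by (elim conjE) (rule stack_equation_unique[OF arch_gf_0 _ _ stack_equation_stack_gf])
next
  assume "S = stack_gf"
  then show "S $ 0 = 1 \<and> stack_equation arch_gf S" by (simp only: stack_equation_stack_gf simp_thms)
qed

section \<open>Quarter plane walks\<close>

text \<open>The coordinates of the walk become the heights of the red and the blue stack, and the
  corners NW and ES become a push followed by a pop on the other stack.\<close>

fun dir_op :: "dir \<Rightarrow> operation" where
  "dir_op East = Push Red"
| "dir_op West = Pop Red"
| "dir_op North = Push Blue"
| "dir_op South = Pop Blue"

fun op_dir :: "operation \<Rightarrow> dir" where
  "op_dir (Push Red) = East"
| "op_dir (Pop Red) = West"
| "op_dir (Push Blue) = North"
| "op_dir (Pop Blue) = South"

lemma dir_op_op_dir [simp]: "dir_op (op_dir x) = x"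
  by (cases x rule: op_dir.cases) simp_all

lemma op_dir_dir_op [simp]: "op_dir (dir_op d) = d"
  by (cases d) simp_all

lemma endpoint_Nil [simp]: "endpoint [] = (0, 0)"
  by (simp add: endpoint_def)

lemma endpoint_snoc [simp]:
  "fst (endpoint (w @ [d])) = fst (endpoint w) + fst (dir_vec d)"
  "snd (endpoint (w @ [d])) = snd (endpoint w) + snd (dir_vec d)"
  by (simp_all add: endpoint_def)

lemma endpoint_count:
  "fst (endpoint w) = int (count_list (map dir_op w) (Push Red)) - int (count_list (map dir_op w) (Pop Red))"
  "snd (endpoint w) = int (count_list (map dir_op w) (Push Blue)) - int (count_list (map dir_op w) (Pop Blue))"
proof (induction w rule: rev_induct)
  case (snoc d w)
  {
    case 1
    show ?case using snoc(1) by (cases d) simp_all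
  next
    case 2
    show ?case using snoc(2) by (cases d) simp_all
  }
qed simp_all

lemma all_colour: "(\<forall>c. P c) \<longleftrightarrow> P Red \<and> P Blue"
  by (metis colour.exhaust)

lemma quarter_walk_prefix_ok: "quarter_walk w \<longleftrightarrow> prefix_ok (map dir_op w)"
  unfolding quarter_walk_def prefix_ok_def all_colour endpoint_count by (auto simp: take_map)

lemma quarter_loop_op_sequence: "quarter_loop w \<longleftrightarrow> op_sequence (map dir_op w)"
proof -
  have "op_sequence v \<longleftrightarrow> prefix_ok v \<and> (\<forall>c. count_list v (Push c) = count_list v (Pop c))" for v
    unfolding op_sequence_def prefix_ok_def by blast
  moreover have "endpoint w = (0, 0) \<longleftrightarrow> fst (endpoint w) = 0 \<and> snd (endpoint w) = 0"
    by (simp add: prod_eq_iff)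
  ultimately show ?thesis
    unfolding quarter_loop_def quarter_walk_prefix_ok all_colour endpoint_count by simp
qed

definition corner :: "dir \<Rightarrow> dir \<Rightarrow> bool" where
  "corner d e \<longleftrightarrow> d = North \<and> e = West \<or> d = East \<and> e = South"

lemma corners_adj_count: "corners w = adj_count corner w"
  unfolding corners_def adj_count_card corner_def ..

lemma corners_lr_count: "corners w = lr_count (map dir_op w)"
proof -
  have "left_right (dir_op d) (dir_op e) = corner d e" for d e
    by (cases d; cases e) (simp_all add: corner_def)
  then show ?thesis by (simp add: corners_adj_count adj_count_map)
qed

lemma bij_betw_loops:
  "bij_betw (map dir_op) {w. quarter_loop w \<and> length w = 2 * n} {w \<in> words False. pushes w = n}"
proof (rule bij_betwI[where g = "map op_dir"])
  show "map dir_op \<in> {w. quarter_loop w \<and> length w = 2 * n} \<rightarrow> {w \<in> words False. pushes w = n}"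
  proof
    fix w assume "w \<in> {w. quarter_loop w \<and> length w = 2 * n}"
    then have "op_sequence (map dir_op w)" "length (map dir_op w) = 2 * n"
      by (simp_all add: quarter_loop_op_sequence)
    then show "map dir_op w \<in> {w \<in> words False. pushes w = n}"
      using op_sequence_pushes_pops(2)[of "map dir_op w"] by (simp add: words_def)
  qed
  show "map op_dir \<in> {w \<in> words False. pushes w = n} \<rightarrow> {w. quarter_loop w \<and> length w = 2 * n}"
    using op_sequence_pushes_pops(2) by (auto simp: words_def quarter_loop_op_sequence o_def)
qed (simp_all add: o_def)

lemma loop_gf_word_gf: "loop_gf = word_gf False [:0, 1:]"
proof (rule fps_ext)
  fix n
  show "loop_gf $ n = word_gf False [:0, 1:] $ n"
    unfolding loop_gf_def word_gf_def gf_nth fps_nth_Abs_fps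
    using sum.reindex_bij_betw[OF bij_betw_loops, of "\<lambda>w. [:0, 1:] ^ lr_count w :: rat poly" n]
    by (simp add: corners_lr_count)
qed

section \<open>The walk series and its values at x = 0 and at y = 0\<close>

definition walks :: "nat \<Rightarrow> walk set" where
  "walks n = {w. quarter_walk w \<and> length w = n}"

lemma finite_walks: "finite (walks n)"
proof -
  have "finite (map dir_op ` walks n)"
    by (rule finite_subset[OF _ finite_words[of n]]) (auto simp: walks_def)
  moreover have "inj (map dir_op)" by (rule inj_mapI) (metis injI op_dir_dir_op)
  ultimately show ?thesis by (metis finite_imageD inj_on_subset subset_UNIV)
qed

definition weight :: "walk \<Rightarrow> poly_axy" where
  "weight w = var_a ^ corners w * var_x ^ nat (fst (endpoint w)) * var_y ^ nat (snd (endpoint w))"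

lemma walk_gf_nth: "walk_gf $ n = (\<Sum>w\<in>walks n. weight w)"
  by (simp add: walk_gf_def walks_def weight_def)

lemma walks_endpoint:
  assumes "w \<in> walks n"
  shows "0 \<le> fst (endpoint w)" "0 \<le> snd (endpoint w)"
proof -
  have "0 \<le> fst (endpoint (take (length w) w)) \<and> 0 \<le> snd (endpoint (take (length w) w))"
    using assms unfolding walks_def quarter_walk_def by blast
  then show "0 \<le> fst (endpoint w)" "0 \<le> snd (endpoint w)" by simp_all
qed

lemma const_poly_power: "[:c:] ^ n = [:c ^ n:]"
  by (induction n) (simp_all add: one_pCons power_commutes)

lemma const_poly_sum: "[:\<Sum>x\<in>A. f x:] = (\<Sum>x\<in>A. [:f x:])"
proof (induction A rule: infinite_finite_induct)
  case (insert x A)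
  then show ?case unfolding sum.insert[OF insert(1,2)] insert(3)[symmetric] by simp
qed simp_all

lemma weight_at_y0: "[:poly (weight w) 0:] = (if nat (snd (endpoint w)) = 0 then weight w else 0)"
  by (simp add: weight_def var_a_def var_x_def var_y_def const_poly_power)

text \<open>The outermost variable is y, so putting x = 0 acts on the coefficients of a polynomial
  in y. The weight is therefore first written as a monomial in y.\<close>

lemma weight_at_x0:
  "map_poly (\<lambda>q. [:poly q 0:]) (weight w) = (if nat (fst (endpoint w)) = 0 then weight w else 0)"
proof -
  have w: "weight w = monom ([:[:0, 1:]:] ^ corners w * [:0, 1:] ^ nat (fst (endpoint w))) (nat (snd (endpoint w)))"
    by (simp add: weight_def var_a_def var_x_def var_y_def const_poly_power monom_altdef)
  show ?thesis
    unfolding w by (simp add: map_poly_monom const_poly_power)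
qed

lemma weight_at_x0_y0: "w \<in> walks n \<Longrightarrow>
  poly (poly (weight w) 0) 0 = (if endpoint w = (0, 0) then [:0, 1:] ^ corners w else 0)"
  using walks_endpoint[of w n]
  by (simp add: weight_def var_a_def var_x_def var_y_def const_poly_power prod_eq_iff power_0_left)

lemma at_y0_walk_gf: "at_y0 walk_gf $ n = (\<Sum>w\<in>{w \<in> walks n. snd (endpoint w) = 0}. weight w)"
proof -
  have "at_y0 walk_gf $ n = (\<Sum>w\<in>walks n. [:poly (weight w) 0:])"
    unfolding at_y0_def fps_nth_Abs_fps walk_gf_nth poly_sum by (rule const_poly_sum)
  also have "\<dots> = (\<Sum>w\<in>walks n. if snd (endpoint w) = 0 then weight w else 0)"
    unfolding weight_at_y0
  proof (rule sum.cong[OF refl])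
    fix w assume "w \<in> walks n"
    then have "nat (snd (endpoint w)) = 0 \<longleftrightarrow> snd (endpoint w) = 0" using walks_endpoint(2)[of w n] by auto
    then show "(if nat (snd (endpoint w)) = 0 then weight w else 0) = (if snd (endpoint w) = 0 then weight w else 0)"
      by (simp only:)
  qed
  finally show ?thesis by (simp only: sum.inter_filter[OF finite_walks])
qed

lemma map_poly_eval_0_sum:
  "map_poly (\<lambda>q. [:poly q 0:]) (\<Sum>w\<in>A. f w) = (\<Sum>w\<in>A. map_poly (\<lambda>q. [:poly q 0:]) (f w))"
proof -
  have add: "map_poly (\<lambda>q. [:poly q 0:]) (p + q) = map_poly (\<lambda>q. [:poly q 0:]) p + map_poly (\<lambda>q. [:poly q 0:]) q" for p q
    by (rule poly_eqI) (simp add: coeff_map_poly)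
  show ?thesis by (induction A rule: infinite_finite_induct) (simp_all add: add)
qed

lemma at_x0_walk_gf: "at_x0 walk_gf $ n = (\<Sum>w\<in>{w \<in> walks n. fst (endpoint w) = 0}. weight w)"
proof -
  have "at_x0 walk_gf $ n = (\<Sum>w\<in>walks n. map_poly (\<lambda>q. [:poly q 0:]) (weight w))"
    by (simp only: at_x0_def fps_nth_Abs_fps walk_gf_nth map_poly_eval_0_sum)
  also have "\<dots> = (\<Sum>w\<in>walks n. if fst (endpoint w) = 0 then weight w else 0)"
    unfolding weight_at_x0
  proof (rule sum.cong[OF refl])
    fix w assume "w \<in> walks n"
    then have "nat (fst (endpoint w)) = 0 \<longleftrightarrow> fst (endpoint w) = 0" using walks_endpoint(1)[of w n] by auto
    then show "(if nat (fst (endpoint w)) = 0 then weight w else 0) = (if fst (endpoint w) = 0 then weight w else 0)"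
      by (simp only:)
  qed
  finally show ?thesis by (simp only: sum.inter_filter[OF finite_walks])
qed

text \<open>Replacing u by its square avoids the square root; as loops have even length, the odd
  coefficients vanish on both sides.\<close>

lemma loop_gf_at_x0_y0: "fps_compose loop_gf (fps_X ^ 2) = at_x0_y0 walk_gf"
proof (rule fps_ext)
  fix n
  have "at_x0_y0 walk_gf $ n = (\<Sum>w\<in>walks n. poly (poly (weight w) 0) 0)"
    by (simp add: at_x0_y0_def walk_gf_nth poly_sum)
  also have "\<dots> = (\<Sum>w\<in>walks n. if endpoint w = (0, 0) then [:0, 1:] ^ corners w else 0)"
    by (rule sum.cong[OF refl weight_at_x0_y0])
  also have "\<dots> = (\<Sum>w\<in>{w \<in> walks n. endpoint w = (0, 0)}. [:0, 1:] ^ corners w)"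
    by (simp only: sum.inter_filter[OF finite_walks])
  also have "{w \<in> walks n. endpoint w = (0, 0)} = {w. quarter_loop w \<and> length w = n}"
    by (auto simp: walks_def quarter_loop_def)
  finally have *: "at_x0_y0 walk_gf $ n = (\<Sum>w | quarter_loop w \<and> length w = n. [:0, 1:] ^ corners w)" .
  show "fps_compose loop_gf (fps_X ^ 2) $ n = at_x0_y0 walk_gf $ n"
  proof (cases "even n")
    case True
    then show ?thesis unfolding * by (simp add: fps_nth_compose_X_power loop_gf_def)
  next
    case False
    have "even (length w)" if "quarter_loop w" for w
      using op_sequence_pushes_pops(2)[of "map dir_op w"] that by (simp add: quarter_loop_op_sequence)
    then have none: "{w. quarter_loop w \<and> length w = n} = {}" using False by blast
    show ?thesis unfolding * none using False by (simp add: fps_nth_compose_X_power)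
  qed
qed

section \<open>A recurrence in polynomial coefficients that has only one solution\<close>

definition pred_nth :: "'a::zero fps \<Rightarrow> nat \<Rightarrow> 'a" where
  "pred_nth F n = (case n of 0 \<Rightarrow> 0 | Suc m \<Rightarrow> F $ m)"

lemma pred_nth_simps [simp]: "pred_nth F 0 = 0" "pred_nth F (Suc n) = F $ n"
  by (simp_all add: pred_nth_def)

text \<open>The functional equation multiplied by \<open>x y\<close>, read off coefficientwise.\<close>

definition walk_recurrence :: "poly_axy fps \<Rightarrow> bool" where
  "walk_recurrence F \<longleftrightarrow> F $ 0 = 1 \<and>
    (\<forall>n. var_x * var_y * F $ Suc n =
       (var_x\<^sup>2 * var_y + var_x * var_y\<^sup>2) * F $ n + var_y * (F $ n - at_x0 F $ n) + var_x * (F $ n - at_y0 F $ n)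
     + (var_a - 1) * (var_y\<^sup>2 * (pred_nth F n - pred_nth (at_x0 F) n) + var_x\<^sup>2 * (pred_nth F n - pred_nth (at_y0 F) n)))"

lemma var_nonzero [simp]: "var_x \<noteq> 0" "var_y \<noteq> 0"
  by (simp_all add: var_x_def var_y_def)

text \<open>A coefficient of \<open>at_x0 F\<close> or \<open>at_y0 F\<close> depends only on the
  same coefficient of \<open>F\<close>, so the right-hand side is known from earlier coefficients,
  and x y cancels in a polynomial ring over a field.\<close>

lemma walk_recurrence_unique:
  assumes F: "walk_recurrence F" and G: "walk_recurrence G"
  shows "F = G"
proof (rule fps_ext)
  fix n
  show "F $ n = G $ n"
  proof (induction n rule: less_induct)
    case (less n)
    have at: "at_x0 F $ m = at_x0 G $ m" "at_y0 F $ m = at_y0 G $ m" if "F $ m = G $ m" for m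
      using that by (simp_all add: at_x0_def at_y0_def)
    show ?case
    proof (cases n)
      case 0
      then show ?thesis using F G by (simp add: walk_recurrence_def)
    next
      case (Suc m)
      have m: "F $ m = G $ m" using less Suc by simp
      have p: "pred_nth F m = pred_nth G m" "pred_nth (at_x0 F) m = pred_nth (at_x0 G) m"
        "pred_nth (at_y0 F) m = pred_nth (at_y0 G) m"
        using less[of "m - 1"] at[of "m - 1"] Suc by (cases m; simp)+
      have "var_x * var_y * F $ Suc m = var_x * var_y * G $ Suc m"
        using F G unfolding walk_recurrence_def by (simp add: m at[OF m] p)
      then show ?thesis using Suc by simp
    qed
  qed
qed

section \<open>Adding a last step to a quarter plane walk\<close>

definition step_ok :: "dir \<Rightarrow> walk \<Rightarrow> bool" where
  "step_ok d w \<longleftrightarrow> 0 \<le> fst (endpoint w) + fst (dir_vec d) \<and> 0 \<le> snd (endpoint w) + snd (dir_vec d)"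

lemma quarter_walk_snoc: "quarter_walk (w @ [d]) \<longleftrightarrow> quarter_walk w \<and> step_ok d w"
proof -
  have "quarter_walk (w @ [d]) \<longleftrightarrow> (\<forall>k\<le>length w. 0 \<le> fst (endpoint (take k (w @ [d]))) \<and> 0 \<le> snd (endpoint (take k (w @ [d])))) \<and>
    0 \<le> fst (endpoint (w @ [d])) \<and> 0 \<le> snd (endpoint (w @ [d]))"
    unfolding quarter_walk_def by (simp only: length_append_singleton le_Suc_eq) auto
  also have "\<dots> \<longleftrightarrow> quarter_walk w \<and> step_ok d w"
    unfolding quarter_walk_def step_ok_def endpoint_snoc by simp
  finally show ?thesis .
qed

lemma sum_walks_Suc:
  fixes f :: "walk \<Rightarrow> poly_axy"
  shows "(\<Sum>w\<in>walks (Suc n). f w) = (\<Sum>w\<in>walks n. f (w @ [East])) + (\<Sum>w\<in>walks n. f (w @ [North]))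
    + (\<Sum>w\<in>{w \<in> walks n. fst (endpoint w) \<noteq> 0}. f (w @ [West]))
    + (\<Sum>w\<in>{w \<in> walks n. snd (endpoint w) \<noteq> 0}. f (w @ [South]))"
proof -
  let ?S = "SIGMA d:{East, North, West, South}. {w \<in> walks n. step_ok d w}"
  have bij: "bij_betw (\<lambda>(d, w). w @ [d]) ?S (walks (Suc n))"
    unfolding bij_betw_def
  proof (intro conjI equalityI subsetI)
    fix v assume "v \<in> walks (Suc n)"
    then have v: "quarter_walk v" "length v = Suc n" by (simp_all add: walks_def)
    then obtain w d where wd: "v = w @ [d]" by (cases v rule: rev_cases) simp_all
    have "(d, w) \<in> ?S" using v wd by (cases d) (simp_all add: quarter_walk_snoc walks_def)
    then show "v \<in> (\<lambda>(d, w). w @ [d]) ` ?S" using wd by (intro image_eqI[of _ _ "(d, w)"]) simp_all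
  next
    fix v assume "v \<in> (\<lambda>(d, w). w @ [d]) ` ?S"
    then obtain p where "p \<in> ?S" "v = (case p of (d, w) \<Rightarrow> w @ [d])" by blast
    then obtain d w where "v = w @ [d]" "w \<in> walks n" "step_ok d w" by (cases p) simp
    then show "v \<in> walks (Suc n)" by (simp add: quarter_walk_snoc walks_def)
  qed (auto simp: inj_on_def)
  have ok: "{w \<in> walks n. step_ok East w} = walks n" "{w \<in> walks n. step_ok North w} = walks n"
    "{w \<in> walks n. step_ok West w} = {w \<in> walks n. fst (endpoint w) \<noteq> 0}"
    "{w \<in> walks n. step_ok South w} = {w \<in> walks n. snd (endpoint w) \<noteq> 0}"
    unfolding step_ok_def by (auto dest: walks_endpoint)
  have "(\<Sum>v\<in>walks (Suc n). f v) = (\<Sum>p\<in>?S. f (case p of (d, w) \<Rightarrow> w @ [d]))"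
    by (rule sum.reindex_bij_betw[OF bij, symmetric])
  also have "\<dots> = (\<Sum>(d, w)\<in>?S. f (w @ [d]))"
    by (rule sum.cong) auto
  also have "\<dots> = (\<Sum>d\<in>{East, North, West, South}. \<Sum>w\<in>{w \<in> walks n. step_ok d w}. f (w @ [d]))"
    using finite_walks[of n] by (intro sum.Sigma[symmetric]) auto
  finally show ?thesis by (simp add: ok add.assoc)
qed

lemma corners_snoc:
  "corners (w @ [d]) = corners w + (if w \<noteq> [] \<and> corner (last w) d then 1 else 0)"
  unfolding corners_adj_count adj_count_append by simp

lemma weight_East: "w \<in> walks n \<Longrightarrow> weight (w @ [East]) = var_x * weight w"
  using walks_endpoint[of w n] by (simp add: weight_def corners_snoc corner_def nat_add_distrib mult_ac)

lemma weight_North: "w \<in> walks n \<Longrightarrow> weight (w @ [North]) = var_y * weight w"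
  using walks_endpoint[of w n] by (simp add: weight_def corners_snoc corner_def nat_add_distrib mult_ac)

text \<open>Multiplied by x to keep exponents nonnegative. The factor a arises when the new step
  completes an NW corner; ES corners are treated symmetrically below.\<close>

lemma weight_West:
  assumes "w \<in> walks n" "fst (endpoint w) \<noteq> 0"
  shows "var_x * weight (w @ [West]) = (if w \<noteq> [] \<and> last w = North then var_a else 1) * weight w"
proof -
  have "nat (fst (endpoint w)) = Suc (nat (fst (endpoint w) - 1))"
    using walks_endpoint(1)[OF assms(1)] assms(2) by linarith
  then show ?thesis by (simp add: weight_def corners_snoc corner_def mult_ac)
qed

lemma weight_South:
  assumes "w \<in> walks n" "snd (endpoint w) \<noteq> 0"
  shows "var_y * weight (w @ [South]) = (if w \<noteq> [] \<and> last w = East then var_a else 1) * weight w"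
proof -
  have "nat (snd (endpoint w)) = Suc (nat (snd (endpoint w) - 1))"
    using walks_endpoint(2)[OF assms(1)] assms(2) by linarith
  then show ?thesis by (simp add: weight_def corners_snoc corner_def mult_ac)
qed

lemma sum_walks_nonzero:
  "(\<Sum>w\<in>{w \<in> walks n. fst (endpoint w) \<noteq> 0}. weight w) = walk_gf $ n - at_x0 walk_gf $ n"
  "(\<Sum>w\<in>{w \<in> walks n. snd (endpoint w) \<noteq> 0}. weight w) = walk_gf $ n - at_y0 walk_gf $ n"
proof -
  have split: "(\<Sum>w\<in>{w \<in> walks n. \<not> P w}. weight w) = (\<Sum>w\<in>walks n. weight w) - (\<Sum>w\<in>{w \<in> walks n. P w}. weight w)" for P
  proof -
    have "{w \<in> walks n. \<not> P w} = walks n - {w \<in> walks n. P w}" by blast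
    then show ?thesis using finite_walks[of n] by (simp only:) (rule sum_diff; auto)
  qed
  show "(\<Sum>w\<in>{w \<in> walks n. fst (endpoint w) \<noteq> 0}. weight w) = walk_gf $ n - at_x0 walk_gf $ n"
    "(\<Sum>w\<in>{w \<in> walks n. snd (endpoint w) \<noteq> 0}. weight w) = walk_gf $ n - at_y0 walk_gf $ n"
    unfolding walk_gf_nth at_x0_walk_gf at_y0_walk_gf by (rule split)+
qed

text \<open>Deleting the last step \<open>d\<close>. In both applications \<open>P\<close> concerns
  the coordinate that \<open>d\<close> does not change, so it passes to the shorter walk.\<close>

lemma sum_walks_last:
  assumes inv: "\<And>w. P (w @ [d]) \<longleftrightarrow> P w" and ok: "\<And>w n. w \<in> walks n \<Longrightarrow> step_ok d w"
    and wt: "\<And>w n. w \<in> walks n \<Longrightarrow> weight (w @ [d]) = c * weight w"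
  shows "(\<Sum>w\<in>{w \<in> {w \<in> walks n. P w}. w \<noteq> [] \<and> last w = d}. weight w) =
    (case n of 0 \<Rightarrow> 0 | Suc m \<Rightarrow> c * (\<Sum>w\<in>{w \<in> walks m. P w}. weight w))"
proof (cases n)
  case 0
  then have "{w \<in> {w \<in> walks n. P w}. w \<noteq> [] \<and> last w = d} = {}" by (auto simp: walks_def)
  then show ?thesis using 0 by (simp only: sum.empty nat.case)
next
  case (Suc m)
  have "bij_betw (\<lambda>w. w @ [d]) {w \<in> walks m. P w} {w \<in> {w \<in> walks n. P w}. w \<noteq> [] \<and> last w = d}"
    unfolding bij_betw_def
  proof (intro conjI equalityI subsetI)
    fix v assume v: "v \<in> {w \<in> {w \<in> walks n. P w}. w \<noteq> [] \<and> last w = d}"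
    then obtain w where w: "v = w @ [d]" by (metis (mono_tags, lifting) append_butlast_last_id mem_Collect_eq)
    then have "w \<in> {w \<in> walks m. P w}" using v Suc by (simp add: inv walks_def quarter_walk_snoc)
    then show "v \<in> (\<lambda>w. w @ [d]) ` {w \<in> walks m. P w}" using w by blast
  next
    fix v assume "v \<in> (\<lambda>w. w @ [d]) ` {w \<in> walks m. P w}"
    then obtain w where w: "v = w @ [d]" "w \<in> walks m" "P w" by blast
    then show "v \<in> {w \<in> {w \<in> walks n. P w}. w \<noteq> [] \<and> last w = d}"
      using ok[OF w(2)] Suc by (simp add: inv walks_def quarter_walk_snoc)
  qed (auto simp: inj_on_def)
  then have "(\<Sum>w\<in>{w \<in> {w \<in> walks n. P w}. w \<noteq> [] \<and> last w = d}. weight w) = (\<Sum>w\<in>{w \<in> walks m. P w}. weight (w @ [d]))"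
    by (rule sum.reindex_bij_betw[symmetric])
  also have "\<dots> = (\<Sum>w\<in>{w \<in> walks m. P w}. c * weight w)"
    by (rule sum.cong[OF refl], rule wt, blast)
  finally show ?thesis using Suc by (simp add: sum_distrib_left)
qed

text \<open>The factor is 1, plus c - 1 when \<open>Q\<close> holds; this is the origin of a - 1 in
  the functional equation.\<close>

lemma sum_corner_weights:
  fixes c :: poly_axy
  assumes "finite A"
  shows "(\<Sum>w\<in>A. (if Q w then c else 1) * weight w) = (\<Sum>w\<in>A. weight w) + (c - 1) * (\<Sum>w\<in>{w \<in> A. Q w}. weight w)"
proof -
  have "(if Q w then c else 1) * weight w = weight w + (c - 1) * (if Q w then weight w else 0)" for w
    by (simp add: algebra_simps)
  then show ?thesis
    by (simp only: sum.distrib sum_distrib_left[symmetric] sum.inter_filter[OF assms])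
qed

text \<open>Split by the last step. A West step needs a start with x > 0, which removes the part at
  x = 0, and South is symmetric. The corner terms look back two steps, since they count walks whose
  last step is already known, hence \<open>pred_nth\<close>.\<close>

lemma walk_gf_Suc:
  "var_x * var_y * walk_gf $ Suc n =
     (var_x\<^sup>2 * var_y + var_x * var_y\<^sup>2) * walk_gf $ n
     + var_y * (walk_gf $ n - at_x0 walk_gf $ n) + var_x * (walk_gf $ n - at_y0 walk_gf $ n)
     + (var_a - 1) * (var_y\<^sup>2 * (pred_nth walk_gf n - pred_nth (at_x0 walk_gf) n)
       + var_x\<^sup>2 * (pred_nth walk_gf n - pred_nth (at_y0 walk_gf) n))"
proof -
  let ?X = "{w \<in> walks n. fst (endpoint w) \<noteq> 0}" and ?Y = "{w \<in> walks n. snd (endpoint w) \<noteq> 0}"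
  have fin: "finite ?X" "finite ?Y" using finite_walks[of n] by simp_all
  have okN: "step_ok North w" and okE: "step_ok East w" if "w \<in> walks m" for w m
    using walks_endpoint[OF that] by (simp_all add: step_ok_def)
  have N: "(\<Sum>w\<in>{w \<in> ?X. w \<noteq> [] \<and> last w = North}. weight w) = var_y * (pred_nth walk_gf n - pred_nth (at_x0 walk_gf) n)"
    using sum_walks_last[of "\<lambda>w. fst (endpoint w) \<noteq> 0" North var_y n, OF _ okN weight_North]
    by (cases n) (simp_all add: sum_walks_nonzero)
  have E: "(\<Sum>w\<in>{w \<in> ?Y. w \<noteq> [] \<and> last w = East}. weight w) = var_x * (pred_nth walk_gf n - pred_nth (at_y0 walk_gf) n)"
    using sum_walks_last[of "\<lambda>w. snd (endpoint w) \<noteq> 0" East var_x n, OF _ okE weight_East]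
    by (cases n) (simp_all add: sum_walks_nonzero)
  have W: "(\<Sum>w\<in>?X. var_x * weight (w @ [West])) = (walk_gf $ n - at_x0 walk_gf $ n)
      + (var_a - 1) * (var_y * (pred_nth walk_gf n - pred_nth (at_x0 walk_gf) n))"
  proof -
    have "(\<Sum>w\<in>?X. var_x * weight (w @ [West])) = (\<Sum>w\<in>?X. (if w \<noteq> [] \<and> last w = North then var_a else 1) * weight w)"
      by (rule sum.cong[OF refl], rule weight_West) blast+
    then show ?thesis by (simp only: sum_corner_weights[OF fin(1)] N sum_walks_nonzero)
  qed
  have S: "(\<Sum>w\<in>?Y. var_y * weight (w @ [South])) = (walk_gf $ n - at_y0 walk_gf $ n)
      + (var_a - 1) * (var_x * (pred_nth walk_gf n - pred_nth (at_y0 walk_gf) n))"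
  proof -
    have "(\<Sum>w\<in>?Y. var_y * weight (w @ [South])) = (\<Sum>w\<in>?Y. (if w \<noteq> [] \<and> last w = East then var_a else 1) * weight w)"
      by (rule sum.cong[OF refl], rule weight_South) blast+
    then show ?thesis by (simp only: sum_corner_weights[OF fin(2)] E sum_walks_nonzero)
  qed
  have EN: "(\<Sum>w\<in>walks n. weight (w @ [East])) = var_x * walk_gf $ n"
    "(\<Sum>w\<in>walks n. weight (w @ [North])) = var_y * walk_gf $ n"
    unfolding walk_gf_nth sum_distrib_left by (intro sum.cong refl weight_East weight_North; assumption)+
  have "var_x * var_y * walk_gf $ Suc n = var_x * var_y * (\<Sum>w\<in>walks n. weight (w @ [East]))
    + var_x * var_y * (\<Sum>w\<in>walks n. weight (w @ [North]))
    + var_y * (\<Sum>w\<in>?X. var_x * weight (w @ [West])) + var_x * (\<Sum>w\<in>?Y. var_y * weight (w @ [South]))"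
    unfolding walk_gf_nth sum_walks_Suc sum_distrib_left[symmetric] by (simp add: algebra_simps)
  also have "\<dots> = (var_x\<^sup>2 * var_y + var_x * var_y\<^sup>2) * walk_gf $ n
     + var_y * (walk_gf $ n - at_x0 walk_gf $ n) + var_x * (walk_gf $ n - at_y0 walk_gf $ n)
     + (var_a - 1) * (var_y\<^sup>2 * (pred_nth walk_gf n - pred_nth (at_x0 walk_gf) n)
       + var_x\<^sup>2 * (pred_nth walk_gf n - pred_nth (at_y0 walk_gf) n))"
    unfolding EN W S by (simp add: algebra_simps power2_eq_square)
  finally show ?thesis .
qed

lemma walk_recurrence_walk_gf: "walk_recurrence walk_gf"
proof -
  have "walks 0 = {[]}" by (auto simp: walks_def quarter_walk_def)
  then have "walk_gf $ 0 = 1"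
    by (simp add: walk_gf_nth weight_def corners_adj_count)
  then show ?thesis unfolding walk_recurrence_def using walk_gf_Suc by blast
qed

section \<open>Equivalence of the functional equation and the recurrence\<close>

lemma fps_to_fract_nth [simp]: "fps_to_fract F $ n = to_fract (F $ n)"
  by (simp add: fps_to_fract_def)

lemma fps_to_fract_hom:
  "fps_to_fract (F + G) = fps_to_fract F + fps_to_fract G"
  "fps_to_fract (F - G) = fps_to_fract F - fps_to_fract G"
  "fps_to_fract (F * G) = fps_to_fract F * fps_to_fract G"
  "fps_to_fract fps_X = fps_X"
  "fps_to_fract 1 = 1"
  "fps_to_fract (fps_const c) = fps_const (to_fract c)"
  by (rule fps_ext; simp add: fps_mult_nth fps_X_def fps_const_def)+

lemma fps_to_fract_eq_iff: "fps_to_fract F = fps_to_fract G \<longleftrightarrow> F = G"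
  by (simp add: fps_eq_iff)

text \<open>Multiplying by x y, which is nonzero, removes both inverses and so gives an equivalent
  equation. With the inverses as parameters this is a polynomial identity modulo the two
  assumptions.\<close>

lemma kernel_cleared:
  fixes x y a u F F0 F1 :: "'a::idom"
  assumes x: "x * x' = 1" and y: "y * y' = 1"
  shows "(1 - u * (x + x' + y + y') - u\<^sup>2 * (a - 1) * (x * y' + y * x')) * F
      = 1 - u * y' * (1 + u * x * (a - 1)) * F0 - u * x' * (1 + u * y * (a - 1)) * F1
    \<longleftrightarrow> x * y * F = x * y + u * ((x\<^sup>2 * y + x * y\<^sup>2) * F + y * (F - F1) + x * (F - F0))
      + u * (u * ((a - 1) * (y\<^sup>2 * (F - F1) + x\<^sup>2 * (F - F0))))" (is "?L = ?R \<longleftrightarrow> ?L' = ?R'")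
proof -
  have "x * y * (?L - ?R) = ?L' - ?R'" using x y by algebra
  moreover have "x * y \<noteq> 0" using x y by auto
  ultimately show ?thesis by (metis eq_iff_diff_eq_0 mult_eq_0_iff)
qed

lemma fps_X_mult_pred_nth: "(fps_X * G) $ n = pred_nth (G :: 'a::comm_ring_1 fps) n"
  by (cases n) simp_all

text \<open>Once the inverses are cleared, both sides are images of power series over the polynomial
  ring. The embedding into the fraction field is injective, so coefficients may be compared as
  polynomials.\<close>

lemma walk_equation_recurrence: "walk_equation F \<longleftrightarrow> walk_recurrence F"
proof -
  define x y a where "x = fps_const var_x" and "y = fps_const var_y" and "a = fps_const var_a"
  define F0 F1 where "F0 = at_y0 F" and "F1 = at_x0 F"
  define K where "K = (a - 1) * (y\<^sup>2 * (F - F1) + x\<^sup>2 * (F - F0))"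
  define H where "H = (x\<^sup>2 * y + x * y\<^sup>2) * F + y * (F - F1) + x * (F - F0)"
  let ?c = "\<lambda>p. fps_const (to_fract p)"
  have inv: "?c var_x * inverse (?c var_x) = 1" "?c var_y * inverse (?c var_y) = 1"
    by (simp_all add: inverse_mult_eq_1')
  have "walk_equation F \<longleftrightarrow> fps_to_fract (x * y * F) = fps_to_fract (x * y + fps_X * H + fps_X * (fps_X * K))"
    unfolding walk_equation_def Let_def kernel_cleared[OF inv] F0_def[symmetric] F1_def[symmetric]
    by (simp only: H_def K_def x_def y_def a_def power2_eq_square fps_to_fract_hom)
  also have "\<dots> \<longleftrightarrow> x * y * F = x * y + fps_X * H + fps_X * (fps_X * K)"
    by (rule fps_to_fract_eq_iff)
  also have "\<dots> \<longleftrightarrow> (x * y * F) $ 0 = (x * y + fps_X * H + fps_X * (fps_X * K)) $ 0 \<and>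
      (\<forall>n. (x * y * F) $ Suc n = (x * y + fps_X * H + fps_X * (fps_X * K)) $ Suc n)"
    unfolding fps_eq_iff by (metis not0_implies_Suc)
  also have "(x * y * F) $ 0 = (x * y + fps_X * H + fps_X * (fps_X * K)) $ 0 \<longleftrightarrow> F $ 0 = 1"
  proof -
    have "(x * y * F) $ 0 = var_x * var_y * F $ 0" by (simp add: x_def y_def)
    moreover have "(x * y + fps_X * H + fps_X * (fps_X * K)) $ 0 = var_x * var_y" by (simp add: x_def y_def)
    ultimately show ?thesis by simp
  qed
  also have "(\<forall>n. (x * y * F) $ Suc n = (x * y + fps_X * H + fps_X * (fps_X * K)) $ Suc n) \<longleftrightarrow>
    (\<forall>n. var_x * var_y * F $ Suc n = H $ n + pred_nth K n)"
  proof -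
    have "(x * y * F) $ Suc n = var_x * var_y * F $ Suc n" for n
      by (simp add: x_def y_def mult.assoc)
    moreover have "(x * y) $ Suc n = 0" for n
      by (simp add: x_def y_def)
    ultimately show ?thesis 
      by (simp only: fps_add_nth fps_X_mult_pred_nth pred_nth_simps add_0_left)
  qed
  also have "F $ 0 = 1 \<and> (\<forall>n. var_x * var_y * F $ Suc n = H $ n + pred_nth K n) \<longleftrightarrow> walk_recurrence F"
  proof -
    have H: "H $ n = (var_x\<^sup>2 * var_y + var_x * var_y\<^sup>2) * F $ n + var_y * (F $ n - at_x0 F $ n)
        + var_x * (F $ n - at_y0 F $ n)" for n
    proof -
      have "H = fps_const (var_x\<^sup>2 * var_y + var_x * var_y\<^sup>2) * F + y * (F - F1) + x * (F - F0)"
        by (simp add: H_def x_def y_def power2_eq_square)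
      then show ?thesis by (simp add: x_def y_def F0_def F1_def)
    qed
    have "K = fps_const (var_a - 1) * (fps_const (var_y\<^sup>2) * (F - F1) + fps_const (var_x\<^sup>2) * (F - F0))"
    proof -
      have "a - 1 = fps_const (var_a - 1)" unfolding a_def fps_const_1_eq_1[symmetric] by (rule fps_const_sub)
      then show ?thesis by (simp add: K_def x_def y_def power2_eq_square)
    qed
    then have K: "pred_nth K n = (var_a - 1) * (var_y\<^sup>2 * (pred_nth F n - pred_nth (at_x0 F) n)
        + var_x\<^sup>2 * (pred_nth F n - pred_nth (at_y0 F) n))" for n
      by (cases n) (simp_all add: F0_def F1_def)
    show ?thesis unfolding walk_recurrence_def H K ..
  qed
  finally show ?thesis .
qed

lemma walk_equation_iff: "walk_equation F \<longleftrightarrow> F = walk_gf"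
  unfolding walk_equation_recurrence
  using walk_recurrence_unique walk_recurrence_walk_gf by blast

lemma arch_equation_arch_gf: "arch_equation loop_gf arch_gf"
proof -
  interpret ring_embedding "\<lambda>r::rat. [:r:]" by unfold_locales (simp_all add: one_pCons)
  have "loop_gf $ 0 = 1" unfolding loop_gf_word_gf by (rule word_gf_0)
  then have "loop_gf * fps_right_inverse loop_gf 1 = 1" by (intro fps_right_inverse) simp
  from word_gf_equation[OF loop_gf_word_gf this refl]
  show ?thesis unfolding arch_equation_def Let_def if_False .
qed

lemma arch_equation_iff: "C $ 0 = 0 \<and> arch_equation loop_gf C \<longleftrightarrow> C = arch_gf"
proof
  assume "C $ 0 = 0 \<and> arch_equation loop_gf C"
  then show "C = arch_gf"
    using arch_equation_unique[OF _ _ arch_equation_arch_gf] word_gf_0 loop_gf_word_gf by metis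
next
  assume "C = arch_gf"
  then show "C $ 0 = 0 \<and> arch_equation loop_gf C"
    by (simp only: arch_gf_0 arch_equation_arch_gf simp_thms)
qed

theorem theorem3p1:
  shows "(\<forall>F :: rat poly poly poly fps. walk_equation F \<longleftrightarrow> F = walk_gf) \<and>
         fps_compose loop_gf (fps_X ^ 2) = at_x0_y0 walk_gf \<and>
         (\<forall>C :: rat poly fps.
            fps_nth C 0 = 0 \<and> arch_equation loop_gf C \<longleftrightarrow> C = arch_gf) \<and>
         (\<forall>S :: rat fps.
            fps_nth S 0 = 1 \<and> stack_equation arch_gf S \<longleftrightarrow> S = stack_gf)"
  by (intro conjI allI walk_equation_iff loop_gf_at_x0_y0 arch_equation_iff stack_equation_iff)

end
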